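(* Let $\mathcal{M}$ be the triangular lattice with $L^2$ sites and periodic boundary conditions, and consider the Hubbard model described in the context on it. Fix an arbitrary $\nu$ with $0<\nu<1$. Suppose that the electron number $N_e$ satisfies $|\mathcal{M}|\ge N_e\ge|\mathcal{M}|-\frac{(1-\nu)^{1/4}}{5}|\mathcal{M}|^{3/4}$. Then, in the limits $U\uparrow\infty$ and $s\uparrow\infty$, every ground state of the model has total spin $S_{\mathrm{tot}}>\nu S_{\max}$, where $S_{\max}=N_e/2$.
   Context: Lattice: $\mathcal{M}$ is the triangular lattice with $L\times L$ sites and periodic boundary conditions in both directions. Its sites are $x=(n_1,n_2)\in(\mathbb{Z}/L\mathbb{Z})^2$, and each site is joined to its six neighbours $x\pm(1,0)$, $x\pm(0,1)$, $x\pm(1,-1)$. The bond set $\mathcal{B}$ contains each nearest-neighbour pair exactly once with an arbitrary orientation, and $\mathcal{E}=\mathcal{B}\cup\{(y,x):(x,y)\in\mathcal{B}\}$; thus $\zeta=6$. For each $(x,y)\in\mathcal{B}$ introduce two additional sites $u(x,y),\bar u(x,y)$; let $\mathcal{O}$ and $\bar{\mathcal{O}}$ be the sets of all $u(x,y)$ and all $\bar u(x,y)$ respectively, and let $\Lambda=\mathcal{M}\cup\mathcal{O}\cup\bar{\mathcal{O}}$. Operators: $c_{z,\sigma}$ ($z\in\Lambda$, $\sigma\in\{\uparrow,\downarrow\}$) are the fermion annihilation operators, $n_{z,\sigma}=c^\dagger_{z,\sigma}c_{z,\sigma}$. Fix $\mu>0$. For $x\in\mathcal{M}$, $a_{x,\sigma}=(1+2\zeta\mu^2)^{-1/2}\{c_{x,\sigma}+\mu\sum_{y:(x,y)\in\mathcal{B}}(c_{u(x,y),\sigma}-c_{\bar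 u(x,y),\sigma})+\mu\sum_{y:(y,x)\in\mathcal{B}}(c_{u(y,x),\sigma}+c_{\bar u(y,x),\sigma})\}$. For $u=u(x,y)$, $b_{u,\sigma}=c_{u,\sigma}-\mu(c_{x,\sigma}+c_{y,\sigma})$; for $\bar u=\bar u(x,y)$, $b_{\bar u,\sigma}=c_{\bar u,\sigma}+\mu(c_{x,\sigma}-c_{y,\sigma})$. Hamiltonian, with $s,t,U>0$: $H=t\sum_{(x,y)\in\mathcal{E},\sigma}a^\dagger_{x,\sigma}a_{y,\sigma}+s\sum_{v\in\mathcal{O}\cup\bar{\mathcal{O}},\sigma}b^\dagger_{v,\sigma}b_{v,\sigma}+U\sum_{z\in\Lambda}n_{z,\uparrow}n_{z,\downarrow}$. It acts on the $N_e$-electron space with $N_e\le|\mathcal{M}|$. Spin: $S^+_z=c^\dagger_{z,\uparrow}c_{z,\downarrow}$, $S^-_z=c^\dagger_{z,\downarrow}c_{z,\uparrow}$, $S^{(3)}_z=\tfrac12(n_{z,\uparrow}-n_{z,\downarrow})$, $S^{(1)}_z=(S^+_z+S^-_z)/2$, $S^{(2)}_z=(S^+_z-S^-_z)/(2i)$. The total spin is $\mathbf{S}_{\mathrm{tot}}=\sum_{z\in\Lambda}\mathbf{S}_z$, with eigenvalues of $(\mathbf{S}_{\mathrm{tot}})^2$ written $S_{\mathrm{tot}}(S_{\mathrm{tot}}+1)$. Ground states in the limits: a fixed state $|\Phi\rangle$ is a finite-energy state if $\lim_{s\uparrow\infty}\lim_{U\uparrow\infty}\langle\Phi|H|\Phi\rangle<\infty$.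 The ground states in the limits $U\uparrow\infty$, $s\uparrow\infty$ are the normalized $N_e$-electron states minimizing this limiting energy. *)

theory Defs
  imports Complex_Main
begin

text \<open>Single-particle modes are encoded as natural numbers; the natural order on nat is
the fixed ordering used for the Jordan-Wigner signs. A Fock-space vector is a function
from finite sets of occupied modes (occupation-number basis) to complex amplitudes.\<close>

type_synonym fstate = "nat set \<Rightarrow> complex"
type_synonym fop = "fstate \<Rightarrow> fstate"

definition fsign :: "nat set \<Rightarrow> nat \<Rightarrow> complex" where
  "fsign S j = (-1) ^ card {i\<in>S. i < j}"

definition cann :: "nat \<Rightarrow> fop" where
  "cann j \<psi> = (\<lambda>S. if j \<notin> S then fsign S j * \<psi> (insert j S) else 0)"

definition ccre :: "nat \<Rightarrow> fop" where
  "ccre j \<psi> = (\<lambda>S. if j \<in> S then fsign S j * \<psi> (S - {j}) else 0)"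

text \<open>Sites of M: (n1,n2) with n1,n2 < L, encoded as n1*L+n2 (indices 0..L^2-1).
Bonds: b < 3 L^2, with base site b div 3 and direction b mod 3, joining x to
x+(1,0), x+(0,1), x+(1,-1) respectively; this lists each nearest-neighbour pair once.
The orientation of bond b is arbitrary and given by ori b.
Sites u(b) are encoded as L^2+b, sites ubar(b) as 4 L^2+b, so Lambda = {..<7 L^2}.
The mode (z,sigma) is 2z (spin up, sigma = True) or 2z+1 (spin down).\<close>

definition msite :: "nat \<Rightarrow> nat \<Rightarrow> nat \<Rightarrow> nat" where
  "msite L n1 n2 = (n1 mod L) * L + (n2 mod L)"

definition nbr :: "nat \<Rightarrow> nat \<Rightarrow> nat \<Rightarrow> nat" where
  "nbr L x d = (let n1 = x div L; n2 = x mod L in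
     if d = 0 then msite L (n1 + 1) n2
     else if d = 1 then msite L n1 (n2 + 1)
     else msite L (n1 + 1) (n2 + L - 1))"

definition nbonds :: "nat \<Rightarrow> nat" where "nbonds L = 3 * L^2"
definition nsites :: "nat \<Rightarrow> nat" where "nsites L = 7 * L^2"
definition nmodes :: "nat \<Rightarrow> nat" where "nmodes L = 2 * nsites L"

definition bfst :: "nat \<Rightarrow> (nat \<Rightarrow> bool) \<Rightarrow> nat \<Rightarrow> nat" where
  "bfst L ori b = (if ori b then b div 3 else nbr L (b div 3) (b mod 3))"
definition bsnd :: "nat \<Rightarrow> (nat \<Rightarrow> bool) \<Rightarrow> nat \<Rightarrow> nat" where
  "bsnd L ori b = (if ori b then nbr L (b div 3) (b mod 3) else b div 3)"

definition usite :: "nat \<Rightarrow> nat \<Rightarrow> nat" where "usite L b = L^2 + b"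
definition ubsite :: "nat \<Rightarrow> nat \<Rightarrow> nat" where "ubsite L b = 4 * L^2 + b"

definition mode :: "nat \<Rightarrow> bool \<Rightarrow> nat" where
  "mode z \<sigma> = 2 * z + (if \<sigma> then 0 else 1)"

definition ind :: "bool \<Rightarrow> real" where "ind P = (if P then 1 else 0)"

text \<open>Coefficient vectors (over sites z of Lambda) of a_{x,sigma}, b_{u,sigma}, b_{ubar,sigma}; zeta = 6.\<close>

definition zeta :: real where "zeta = 6"

definition avec :: "nat \<Rightarrow> real \<Rightarrow> (nat \<Rightarrow> bool) \<Rightarrow> nat \<Rightarrow> nat \<Rightarrow> real" where
  "avec L \<mu> ori x z = (1 / sqrt (1 + 2 * zeta * \<mu>^2)) *
     (ind (z = x)
      + \<mu> * (\<Sum>b<nbonds L. if bfst L ori b = x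
               then ind (z = usite L b) - ind (z = ubsite L b) else 0)
      + \<mu> * (\<Sum>b<nbonds L. if bsnd L ori b = x
               then ind (z = usite L b) + ind (z = ubsite L b) else 0))"

definition buvec :: "nat \<Rightarrow> real \<Rightarrow> (nat \<Rightarrow> bool) \<Rightarrow> nat \<Rightarrow> nat \<Rightarrow> real" where
  "buvec L \<mu> ori b z = ind (z = usite L b) - \<mu> * (ind (z = bfst L ori b) + ind (z = bsnd L ori b))"

definition bubvec :: "nat \<Rightarrow> real \<Rightarrow> (nat \<Rightarrow> bool) \<Rightarrow> nat \<Rightarrow> nat \<Rightarrow> real" where
  "bubvec L \<mu> ori b z = ind (z = ubsite L b) + \<mu> * (ind (z = bfst L ori b) - ind (z = bsnd L ori b))"

definition lann :: "nat \<Rightarrow> (nat \<Rightarrow> real) \<Rightarrow> bool \<Rightarrow> fop" where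
  "lann L w \<sigma> \<psi> = (\<lambda>T. \<Sum>z<nsites L. complex_of_real (w z) * cann (mode z \<sigma>) \<psi> T)"
definition lcre :: "nat \<Rightarrow> (nat \<Rightarrow> real) \<Rightarrow> bool \<Rightarrow> fop" where
  "lcre L w \<sigma> \<psi> = (\<lambda>T. \<Sum>z<nsites L. complex_of_real (w z) * ccre (mode z \<sigma>) \<psi> T)"

definition hub :: "nat \<Rightarrow> real \<Rightarrow> (nat \<Rightarrow> bool) \<Rightarrow> real \<Rightarrow> real \<Rightarrow> real \<Rightarrow> fop" where
  "hub L \<mu> ori t s U \<psi> = (\<lambda>T.
     complex_of_real t * (\<Sum>b<nbonds L. \<Sum>\<sigma>\<in>UNIV.
         lcre L (avec L \<mu> ori (bfst L ori b)) \<sigma> (lann L (avec L \<mu> ori (bsnd L ori b)) \<sigma> \<psi>) T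
       + lcre L (avec L \<mu> ori (bsnd L ori b)) \<sigma> (lann L (avec L \<mu> ori (bfst L ori b)) \<sigma> \<psi>) T)
   + complex_of_real s * (\<Sum>b<nbonds L. \<Sum>\<sigma>\<in>UNIV.
         lcre L (buvec L \<mu> ori b) \<sigma> (lann L (buvec L \<mu> ori b) \<sigma> \<psi>) T
       + lcre L (bubvec L \<mu> ori b) \<sigma> (lann L (bubvec L \<mu> ori b) \<sigma> \<psi>) T)
   + complex_of_real U * (\<Sum>z<nsites L.
         ccre (mode z True) (cann (mode z True)
           (ccre (mode z False) (cann (mode z False) \<psi>))) T))"

definition energy :: "nat \<Rightarrow> real \<Rightarrow> (nat \<Rightarrow> bool) \<Rightarrow> real \<Rightarrow> real \<Rightarrow> real \<Rightarrow> fstate \<Rightarrow> real" where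
  "energy L \<mu> ori t s U \<Phi> =
     Re (\<Sum>T\<in>Pow {..<nmodes L}. cnj (\<Phi> T) * hub L \<mu> ori t s U \<Phi> T)"

definition ne_state :: "nat \<Rightarrow> nat \<Rightarrow> fstate \<Rightarrow> bool" where
  "ne_state L N \<Phi> \<longleftrightarrow> (\<forall>T. \<Phi> T \<noteq> 0 \<longrightarrow> T \<subseteq> {..<nmodes L} \<and> card T = N)"

definition normalized :: "nat \<Rightarrow> fstate \<Rightarrow> bool" where
  "normalized L \<Phi> \<longleftrightarrow> (\<Sum>T\<in>Pow {..<nmodes L}. (cmod (\<Phi> T))^2) = 1"

definition lim_energy :: "nat \<Rightarrow> real \<Rightarrow> (nat \<Rightarrow> bool) \<Rightarrow> real \<Rightarrow> fstate \<Rightarrow> real \<Rightarrow> bool" where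
  "lim_energy L \<mu> ori t \<Phi> E \<longleftrightarrow>
     (\<exists>f. (\<forall>s>0. ((\<lambda>U. energy L \<mu> ori t s U \<Phi>) \<longlongrightarrow> f s) at_top) \<and> (f \<longlongrightarrow> E) at_top)"

definition ground_state :: "nat \<Rightarrow> real \<Rightarrow> (nat \<Rightarrow> bool) \<Rightarrow> real \<Rightarrow> nat \<Rightarrow> fstate \<Rightarrow> bool" where
  "ground_state L \<mu> ori t N \<Phi> \<longleftrightarrow> ne_state L N \<Phi> \<and> normalized L \<Phi> \<and>
     (\<exists>E. lim_energy L \<mu> ori t \<Phi> E \<and>
        (\<forall>\<Psi> E'. ne_state L N \<Psi> \<and> normalized L \<Psi> \<and> lim_energy L \<mu> ori t \<Psi> E' \<longrightarrow> E \<le> E'))"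

definition splus :: "nat \<Rightarrow> fop" where
  "splus L \<psi> = (\<lambda>T. \<Sum>z<nsites L. ccre (mode z True) (cann (mode z False) \<psi>) T)"
definition sminus :: "nat \<Rightarrow> fop" where
  "sminus L \<psi> = (\<lambda>T. \<Sum>z<nsites L. ccre (mode z False) (cann (mode z True) \<psi>) T)"
definition s3 :: "nat \<Rightarrow> fop" where
  "s3 L \<psi> = (\<lambda>T. \<Sum>z<nsites L. (1/2) * (ccre (mode z True) (cann (mode z True) \<psi>) T
                                     - ccre (mode z False) (cann (mode z False) \<psi>) T))"
definition s1 :: "nat \<Rightarrow> fop" where
  "s1 L \<psi> = (\<lambda>T. (splus L \<psi> T + sminus L \<psi> T) / 2)"
definition s2 :: "nat \<Rightarrow> fop" where
  "s2 L \<psi> = (\<lambda>T. (splus L \<psi> T - sminus L \<psi> T) / (2 * \<i>))"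
definition stot2 :: "nat \<Rightarrow> fop" where
  "stot2 L \<psi> = (\<lambda>T. s1 L (s1 L \<psi>) T + s2 L (s2 L \<psi>) T + s3 L (s3 L \<psi>) T)"

end

theory Submission
  imports Defs "HOL-Analysis.Analysis"
begin

text \<open>
  Finite energy in the two limits means that all \<open>b\<close> operators and all double occupancies
  annihilate the state. Such a state is determined by its amplitudes on the sites of the
  triangular lattice; there no site is doubly occupied and the amplitudes are symmetric under
  exchange of the spins of neighbouring electrons, so every connected cluster of electrons is
  fully polarized. A highest weight argument then shows that an eigenstate of total spin \<open>S\<close>
  contains only clusters of at most \<open>N / 2 + S\<close> electrons. If \<open>S \<le> \<nu> N / 2\<close>, the holes have to
  separate two regions whose areas are comparable to \<open>(1 - \<nu>) L\<^sup>2\<close>, and by an isoperimetric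
  inequality they form of the order of \<open>sqrt (1 - \<nu>) L\<close> pairs of neighbouring holes.
  Each such pair blocks two hopping processes, so the energy is at least \<open>t (2 V - 6 h)\<close>, where
  \<open>h\<close> is the number of holes and \<open>V\<close> the number of such pairs. Filling the fully polarized
  band except for \<open>h\<close> momenta near its top has energy at most \<open>t (12/5 pi\<^sup>2 h\<^sup>2 / L\<^sup>2 - 6 h)\<close>, which is
  lower under the assumed bound on \<open>h\<close>. Energy and norm are both invariant forms for the total
  spin, so the component of a ground state with small spin must vanish.
\<close>

section \<open>Fock space operators\<close>

text \<open>The exponents in the bound on the number \<open>h\<close> of holes balance two
  quantities. With \<open>X = sqrt (1 - \<nu>) * L\<close> it gives
  \<open>h\<^sup>2 / L\<^sup>2 \<le> X / 25\<close>, so the excess energy of the trial state and the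
  perimeter forced on the holes are both of order \<open>X\<close>, and \<open>1 / 5\<close> is
  small enough for the constants to conflict. The perimeter is not found by following a boundary,
  which may wind around the torus. A row that meets both regions forces at least two pairs of
  neighbouring holes between it and the next row, and likewise for columns. Apart from few rows and
  columns rich in holes, one region lies in mixed rows and mixed columns only, so with
  \<open>V\<close> hole pairs its area is at most \<open>(V / 2 + 3 * h / L)\<^sup>2\<close>. A
  ground state need not be an eigenvector of the total spin. Its spin components are constructed by
  induction on the number of down spins instead of by a spectral theorem: the ladder operators
  preserve the finite-energy conditions, so each component is again a finite-energy state and can be
  compared with the ground state by the variational principle.\<close>

lemma fsign_insert:
  "fsign (insert i S) j = (if i < j \<and> i \<notin> S then - fsign S j else fsign S j)"
proof (cases "i < j \<and> i \<notin> S")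
  case True
  then have "{k \<in> insert i S. k < j} = insert i {k\<in>S. k < j}" by auto
  with True show ?thesis by (simp add: fsign_def)
next
  case False
  then have "{k \<in> insert i S. k < j} = {k\<in>S. k < j}" by auto
  with False show ?thesis by (auto simp add: fsign_def)
qed

lemma fsign_remove:
  "fsign (S - {i}) j = (if i < j \<and> i \<in> S then - fsign S j else fsign S j)"
proof (cases "i \<in> S")
  case True
  then have "fsign S j = fsign (insert i (S - {i})) j" by (simp add: insert_absorb)
  also have "\<dots> = (if i < j then - fsign (S - {i}) j else fsign (S - {i}) j)"
    by (simp add: fsign_insert del: insert_Diff_single)
  finally show ?thesis using True by auto
qed auto

lemma fsign_mult_self [simp]: "fsign S j * fsign S j = 1" "fsign S j * (fsign S j * c) = c"
  by (simp_all add: fsign_def flip: power_add mult.assoc)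

lemma cnj_fsign [simp]: "cnj (fsign S j) = fsign S j"
  by (simp add: fsign_def)

section \<open>Canonical anticommutation relations\<close>

lemma cann_cann: "cann i (cann j \<psi>) T = - cann j (cann i \<psi>) T"
proof (cases "i = j \<or> i \<in> T \<or> j \<in> T")
  case False
  then show ?thesis
    by (cases "i < j") (auto simp: cann_def fsign_insert insert_commute)
qed (auto simp: cann_def)

lemma cann_cann_same: "cann i (cann i \<psi>) T = 0"
  by (simp add: cann_def)

lemma ccre_ccre: "ccre i (ccre j \<psi>) T = - ccre j (ccre i \<psi>) T"
proof (cases "i \<noteq> j \<and> i \<in> T \<and> j \<in> T")
  case True
  then show ?thesis
    by (cases "i < j") (auto simp: ccre_def fsign_remove Diff_insert2[symmetric] insert_commute)
qed (auto simp: ccre_def)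

lemma cann_ccre: "cann i (ccre j \<psi>) T = (if i = j then \<psi> T else 0) - ccre j (cann i \<psi>) T"
proof (cases "i = j")
  case True
  then show ?thesis by (auto simp: cann_def ccre_def fsign_insert fsign_remove insert_absorb)
next
  case False
  have *: "insert i T - {j} = insert i (T - {j})" using False by auto
  show ?thesis using False
    by (cases "i < j") (auto simp: cann_def ccre_def fsign_insert fsign_remove *)
qed

lemma cann_zero [simp]: "cann j (\<lambda>T. 0) = (\<lambda>T. 0)" by (auto simp: cann_def)
lemma ccre_zero [simp]: "ccre j (\<lambda>T. 0) = (\<lambda>T. 0)" by (auto simp: ccre_def)

lemma cann_sum: "cann j (\<lambda>T. \<Sum>i\<in>I. f i T) = (\<lambda>T. (\<Sum>i\<in>I. cann j (f i) T))"
  by (rule ext) (simp add: cann_def sum_distrib_left)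
lemma ccre_sum: "ccre j (\<lambda>T. \<Sum>i\<in>I. f i T) = (\<lambda>T. (\<Sum>i\<in>I. ccre j (f i) T))"
  by (rule ext) (simp add: ccre_def sum_distrib_left)
lemma cann_scale: "cann j (\<lambda>T. c * f T) = (\<lambda>T. c * cann j f T)"
  by (rule ext) (simp add: cann_def)
lemma ccre_scale: "ccre j (\<lambda>T. c * f T) = (\<lambda>T. c * ccre j f T)"
  by (rule ext) (simp add: ccre_def)
lemma cann_minus: "cann j (\<lambda>T. - f T) = (\<lambda>T. - cann j f T)"
  by (rule ext) (simp add: cann_def)
lemma ccre_minus: "ccre j (\<lambda>T. - f T) = (\<lambda>T. - ccre j f T)"
  by (rule ext) (simp add: ccre_def)
lemma cann_add: "cann j (\<lambda>T. f T + g T) = (\<lambda>T. cann j f T + cann j g T)"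
  by (rule ext) (simp add: cann_def algebra_simps)
lemma ccre_add: "ccre j (\<lambda>T. f T + g T) = (\<lambda>T. ccre j f T + ccre j g T)"
  by (rule ext) (simp add: ccre_def algebra_simps)
lemma cann_diff: "cann j (\<lambda>T. f T - g T) = (\<lambda>T. cann j f T - cann j g T)"
  by (rule ext) (simp add: cann_def algebra_simps)
lemma ccre_diff: "ccre j (\<lambda>T. f T - g T) = (\<lambda>T. ccre j f T - ccre j g T)"
  by (rule ext) (simp add: ccre_def algebra_simps)

lemmas fock_lin = cann_sum ccre_sum cann_scale ccre_scale cann_minus ccre_minus
  cann_add ccre_add cann_diff ccre_diff

lemma number_apply: "ccre j (cann j \<psi>) T = (if j \<in> T then \<psi> T else 0)"
  by (auto simp: ccre_def cann_def fsign_remove insert_absorb)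

lemma mode_eq_iff [simp]: "mode z \<sigma> = mode z' \<sigma>' \<longleftrightarrow> z = z' \<and> \<sigma> = \<sigma>'"
  by (auto simp: mode_def split: if_splits) presburger+

lemma mode_less [simp]: "mode z \<sigma> < 2 * n \<longleftrightarrow> z < n"
  by (auto simp: mode_def)

lemma sum_mode: "(\<Sum>j<2*n. f j) = (\<Sum>z<n. \<Sum>\<sigma>\<in>UNIV. f (mode z \<sigma>) :: 'a::comm_monoid_add)"
  by (induction n) (auto simp: UNIV_bool mode_def add_ac)

lemma lann_zero [simp]: "lann L w \<sigma> (\<lambda>T. 0) = (\<lambda>T. 0)" by (simp add: lann_def)
lemma lcre_zero [simp]: "lcre L w \<sigma> (\<lambda>T. 0) = (\<lambda>T. 0)" by (simp add: lcre_def)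

lemma cann_lann: "cann j (lann L w \<sigma> \<psi>) T = - lann L w \<sigma> (cann j \<psi>) T"
proof -
  have "cann j (lann L w \<sigma> \<psi>) T = (\<Sum>z<nsites L. complex_of_real (w z) * cann j (cann (mode z \<sigma>) \<psi>) T)"
    unfolding lann_def by (simp add: fock_lin)
  also have "\<dots> = - lann L w \<sigma> (cann j \<psi>) T"
    unfolding lann_def by (subst cann_cann) (simp add: sum_negf)
  finally show ?thesis .
qed

lemma lcre_lcre: "lcre L w \<sigma> (lcre L w' \<sigma>' \<psi>) T = - lcre L w' \<sigma>' (lcre L w \<sigma> \<psi>) T"
proof -
  have "lcre L w \<sigma> (lcre L w' \<sigma>' \<psi>) T =
    (\<Sum>z<nsites L. \<Sum>z'<nsites L. complex_of_real (w z) * (complex_of_real (w' z') * ccre (mode z \<sigma>) (ccre (mode z' \<sigma>') \<psi>) T))"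
    unfolding lcre_def by (simp add: fock_lin sum_distrib_left)
  also have "\<dots> = - (\<Sum>z<nsites L. \<Sum>z'<nsites L. complex_of_real (w z) * (complex_of_real (w' z') * ccre (mode z' \<sigma>') (ccre (mode z \<sigma>) \<psi>) T))"
    by (subst ccre_ccre) (simp add: sum_negf)
  also have "\<dots> = - lcre L w' \<sigma>' (lcre L w \<sigma> \<psi>) T"
    unfolding lcre_def by (subst sum.swap) (simp add: fock_lin sum_distrib_left mult_ac)
  finally show ?thesis .
qed

lemma lann_lcre: "lann L w \<sigma> (lcre L w' \<sigma>' \<psi>) T =
   (if \<sigma> = \<sigma>' then complex_of_real (\<Sum>z<nsites L. w z * w' z) * \<psi> T else 0) - lcre L w' \<sigma>' (lann L w \<sigma> \<psi>) T"
proof -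
  have "lann L w \<sigma> (lcre L w' \<sigma>' \<psi>) T =
    (\<Sum>z<nsites L. \<Sum>z'<nsites L. complex_of_real (w z) * (complex_of_real (w' z') * cann (mode z \<sigma>) (ccre (mode z' \<sigma>') \<psi>) T))"
    unfolding lcre_def lann_def by (simp add: fock_lin sum_distrib_left)
  also have "\<dots> = (\<Sum>z<nsites L. \<Sum>z'<nsites L.
      (if z' = z then (if \<sigma> = \<sigma>' then complex_of_real (w z) * (complex_of_real (w' z') * \<psi> T) else 0) else 0)
       - complex_of_real (w z) * (complex_of_real (w' z') * ccre (mode z' \<sigma>') (cann (mode z \<sigma>) \<psi>) T))"
    by (intro sum.cong refl, subst cann_ccre) (auto simp: algebra_simps)
  also have "\<dots> = (\<Sum>z<nsites L. if \<sigma> = \<sigma>' then complex_of_real (w z) * (complex_of_real (w' z) * \<psi> T) else 0)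
    - (\<Sum>z<nsites L. \<Sum>z'<nsites L. complex_of_real (w z) * (complex_of_real (w' z') * ccre (mode z' \<sigma>') (cann (mode z \<sigma>) \<psi>) T))"
    by (simp add: sum_subtractf)
  also have "(\<Sum>z<nsites L. \<Sum>z'<nsites L. complex_of_real (w z) * (complex_of_real (w' z') * ccre (mode z' \<sigma>') (cann (mode z \<sigma>) \<psi>) T))
    = lcre L w' \<sigma>' (lann L w \<sigma> \<psi>) T"
    unfolding lcre_def lann_def by (subst sum.swap) (simp add: fock_lin sum_distrib_left mult_ac)
  also have "(\<Sum>z<nsites L. if \<sigma> = \<sigma>' then complex_of_real (w z) * (complex_of_real (w' z) * \<psi> T) else 0) =
     (if \<sigma> = \<sigma>' then complex_of_real (\<Sum>z<nsites L. w z * w' z) * \<psi> T else 0)"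
    by (simp add: sum_distrib_right sum_distrib_left mult_ac)
  finally show ?thesis .
qed

text \<open>The cutoff \<open>m\<close> is a parameter because the modes of the triangular lattice
  come first: \<open>m = nmodes L\<close> gives the full inner product, while
  \<open>m = 2 * L\<^sup>2\<close> keeps only the configurations with all electrons on the
  triangular lattice.\<close>

definition ip :: "nat \<Rightarrow> fstate \<Rightarrow> fstate \<Rightarrow> complex" where
  "ip m \<phi> \<psi> = (\<Sum>T\<in>Pow {..<m}. cnj (\<phi> T) * \<psi> T)"

lemma ip_zero [simp]: "ip m (\<lambda>T. 0) \<psi> = 0" "ip m \<phi> (\<lambda>T. 0) = 0"
  by (simp_all add: ip_def)

lemma ip_sum_right: "ip m \<phi> (\<lambda>T. \<Sum>i\<in>I. f i T) = (\<Sum>i\<in>I. ip m \<phi> (f i))"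
  unfolding ip_def by (simp add: sum_distrib_left) (rule sum.swap)
lemma ip_sum_left: "ip m (\<lambda>T. \<Sum>i\<in>I. f i T) \<psi> = (\<Sum>i\<in>I. ip m (f i) \<psi>)"
  unfolding ip_def by (simp add: sum_distrib_right) (rule sum.swap)
lemma ip_scale_right: "ip m \<phi> (\<lambda>T. c * f T) = c * ip m \<phi> f"
  unfolding ip_def by (simp add: sum_distrib_left mult_ac)
lemma ip_scale_left: "ip m (\<lambda>T. c * f T) \<psi> = cnj c * ip m f \<psi>"
  unfolding ip_def by (simp add: sum_distrib_left mult_ac)
lemma ip_add_right: "ip m \<phi> (\<lambda>T. f T + g T) = ip m \<phi> f + ip m \<phi> g"
  unfolding ip_def by (simp add: sum.distrib algebra_simps)
lemma ip_add_left: "ip m (\<lambda>T. f T + g T) \<psi> = ip m f \<psi> + ip m g \<psi>"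
  unfolding ip_def by (simp add: sum.distrib algebra_simps)
lemma ip_diff_right: "ip m \<phi> (\<lambda>T. f T - g T) = ip m \<phi> f - ip m \<phi> g"
  unfolding ip_def by (simp add: sum_subtractf algebra_simps)
lemma ip_diff_left: "ip m (\<lambda>T. f T - g T) \<psi> = ip m f \<psi> - ip m g \<psi>"
  unfolding ip_def by (simp add: sum_subtractf algebra_simps)
lemma ip_cnj: "cnj (ip m \<phi> \<psi>) = ip m \<psi> \<phi>"
  unfolding ip_def by (simp add: mult.commute)

lemma ip_self: "ip m \<psi> \<psi> = complex_of_real (\<Sum>T\<in>Pow {..<m}. (cmod (\<psi> T))\<^sup>2)"
  unfolding ip_def by (simp add: complex_norm_square mult.commute del: of_real_power)

lemma ip_self_nonneg: "Re (ip m \<psi> \<psi>) \<ge> 0"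
  by (simp add: ip_self sum_nonneg)

lemma ip_self_eq_0: "Re (ip m \<psi> \<psi>) = 0 \<longleftrightarrow> (\<forall>T\<in>Pow {..<m}. \<psi> T = 0)"
  by (simp add: ip_self sum_nonneg_eq_0_iff)

lemma ip_ccre:
  assumes "j < m"
  shows "ip m (ccre j \<phi>) \<psi> = ip m \<phi> (cann j \<psi>)"
proof -
  have "ip m (ccre j \<phi>) \<psi> = (\<Sum>T\<in>{T\<in>Pow {..<m}. j \<in> T}. fsign T j * cnj (\<phi> (T - {j})) * \<psi> T)"
    unfolding ip_def ccre_def
    by (subst sum.inter_filter) (auto intro!: sum.cong)
  also have "\<dots> = (\<Sum>T\<in>{T\<in>Pow {..<m}. j \<notin> T}. fsign T j * cnj (\<phi> T) * \<psi> (insert j T))"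
    using assms
    by (intro sum.reindex_bij_witness[where i="insert j" and j="\<lambda>T. T - {j}"])
       (auto simp: fsign_remove insert_absorb)
  also have "\<dots> = ip m \<phi> (cann j \<psi>)"
    unfolding ip_def cann_def
    by (subst sum.inter_filter) (auto intro!: sum.cong)
  finally show ?thesis .
qed

lemma ip_cann:
  assumes "j < m"
  shows "ip m (cann j \<phi>) \<psi> = ip m \<phi> (ccre j \<psi>)"
  by (metis assms ip_ccre ip_cnj)

lemma ip_lcre: "ip (nmodes L) (lcre L w \<sigma> \<phi>) \<psi> = ip (nmodes L) \<phi> (lann L w \<sigma> \<psi>)"
  unfolding lcre_def lann_def
  by (simp add: ip_sum_left ip_sum_right ip_scale_left ip_scale_right ip_ccre nmodes_def)

text \<open>The number operator has eigenvalue \<open>N\<close> on \<open>\<phi>\<close>. The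
  identity expresses an inner product through states with one electron less, which allows induction
  on the electron number.\<close>

lemma ip_number:
  assumes "\<And>T. T \<subseteq> {..<m} \<Longrightarrow> \<phi> T \<noteq> 0 \<Longrightarrow> card T = N"
  shows "(\<Sum>j<m. ip m (cann j \<phi>) (cann j \<psi>)) = of_nat N * ip m \<phi> \<psi>"
proof -
  have "(\<Sum>j<m. ip m (cann j \<phi>) (cann j \<psi>)) = (\<Sum>j<m. ip m \<phi> (ccre j (cann j \<psi>)))"
    by (simp add: ip_cann)
  also have "\<dots> = (\<Sum>T\<in>Pow {..<m}. \<Sum>j<m. cnj (\<phi> T) * (if j \<in> T then \<psi> T else 0))"
    unfolding ip_def number_apply by (rule sum.swap)
  also have "\<dots> = (\<Sum>T\<in>Pow {..<m}. of_nat N * (cnj (\<phi> T) * \<psi> T))"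
  proof (rule sum.cong[OF refl])
    fix T assume T: "T \<in> Pow {..<m}"
    then have "{j. j < m \<and> j \<in> T} = T" by auto
    then have "(\<Sum>j<m. cnj (\<phi> T) * (if j \<in> T then \<psi> T else 0)) = of_nat (card T) * (cnj (\<phi> T) * \<psi> T)"
      by (simp add: if_distrib sum.If_cases Int_def cong: if_cong)
    also have "\<dots> = of_nat N * (cnj (\<phi> T) * \<psi> T)" using assms[of T] T by (cases "\<phi> T = 0") auto
    finally show "(\<Sum>j<m. cnj (\<phi> T) * (if j \<in> T then \<psi> T else 0)) = of_nat N * (cnj (\<phi> T) * \<psi> T)" .
  qed
  finally show ?thesis by (simp add: ip_def sum_distrib_left)
qed

section \<open>Total spin\<close>

lemma cann_hop: "cann i (ccre k (cann l \<psi>)) T = (if i = k then cann l \<psi> T else 0) + ccre k (cann l (cann i \<psi>)) T"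
proof -
  have "cann i (cann l \<psi>) = (\<lambda>T. - cann l (cann i \<psi>) T)"
    by (rule ext, rule cann_cann)
  then show ?thesis by (simp add: cann_ccre fock_lin)
qed

lemma ccre_hop: "ccre k (cann l (ccre i \<psi>)) T = (if i = l then ccre k \<psi> T else 0) + ccre i (ccre k (cann l \<psi>)) T"
proof -
  have "cann l (ccre i \<psi>) = (\<lambda>T. (if l = i then \<psi> T else 0) - ccre i (cann l \<psi>) T)"
    by (rule ext, rule cann_ccre)
  then show ?thesis by (subst ccre_ccre) (simp add: fock_lin)
qed

lemma splus_sum: "splus L (\<lambda>T. \<Sum>i\<in>I. f i T) = (\<lambda>T. (\<Sum>i\<in>I. splus L (f i) T))"
  by (rule ext) (simp add: splus_def fock_lin, rule sum.swap)
lemma sminus_sum: "sminus L (\<lambda>T. \<Sum>i\<in>I. f i T) = (\<lambda>T. (\<Sum>i\<in>I. sminus L (f i) T))"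
  by (rule ext) (simp add: sminus_def fock_lin, rule sum.swap)
lemma splus_scale: "splus L (\<lambda>T. c * f T) = (\<lambda>T. c * splus L f T)"
  by (rule ext) (simp add: splus_def fock_lin sum_distrib_left)
lemma sminus_scale: "sminus L (\<lambda>T. c * f T) = (\<lambda>T. c * sminus L f T)"
  by (rule ext) (simp add: sminus_def fock_lin sum_distrib_left)
lemma splus_add: "splus L (\<lambda>T. f T + g T) = (\<lambda>T. splus L f T + splus L g T)"
  by (rule ext) (simp add: splus_def fock_lin sum.distrib)
lemma sminus_add: "sminus L (\<lambda>T. f T + g T) = (\<lambda>T. sminus L f T + sminus L g T)"
  by (rule ext) (simp add: sminus_def fock_lin sum.distrib)
lemma splus_diff: "splus L (\<lambda>T. f T - g T) = (\<lambda>T. splus L f T - splus L g T)"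
  by (rule ext) (simp add: splus_def fock_lin sum_subtractf)
lemma sminus_diff: "sminus L (\<lambda>T. f T - g T) = (\<lambda>T. sminus L f T - sminus L g T)"
  by (rule ext) (simp add: sminus_def fock_lin sum_subtractf)
lemma splus_zero [simp]: "splus L (\<lambda>T. 0) = (\<lambda>T. 0)"
  unfolding splus_def by simp
lemma sminus_zero [simp]: "sminus L (\<lambda>T. 0) = (\<lambda>T. 0)"
  unfolding sminus_def by simp

lemmas spin_lin = splus_sum sminus_sum splus_scale sminus_scale splus_add sminus_add splus_diff sminus_diff

text \<open>A spin flip is bilinear, so an annihilation operator passes it with a single
  contraction; only the term at the same site with matching spin survives.\<close>

lemma cann_splus: "z < nsites L \<Longrightarrow> cann (mode z \<sigma>) (splus L \<psi>) T =
    splus L (cann (mode z \<sigma>) \<psi>) T + (if \<sigma> then cann (mode z False) \<psi> T else 0)"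
  unfolding splus_def by (simp add: fock_lin cann_hop sum.distrib)

lemma cann_sminus: "z < nsites L \<Longrightarrow> cann (mode z \<sigma>) (sminus L \<psi>) T =
    sminus L (cann (mode z \<sigma>) \<psi>) T + (if \<sigma> then 0 else cann (mode z True) \<psi> T)"
  unfolding sminus_def by (simp add: fock_lin cann_hop sum.distrib)

lemma splus_ccre: "z < nsites L \<Longrightarrow> splus L (ccre (mode z False) \<psi>) T =
    ccre (mode z False) (splus L \<psi>) T + ccre (mode z True) \<psi> T"
  unfolding splus_def by (simp add: fock_lin ccre_hop sum.distrib)

lemma splus_sminus: "splus L (sminus L \<psi>) T = sminus L (splus L \<psi>) T + 2 * s3 L \<psi> T"
proof -
  have c: "cann (mode z True) (splus L \<psi>) = (\<lambda>T. splus L (cann (mode z True) \<psi>) T + cann (mode z False) \<psi> T)"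
    if "z < nsites L" for z using cann_splus[OF that, of True] by auto
  have "splus L (sminus L \<psi>) T = (\<Sum>z<nsites L. splus L (ccre (mode z False) (cann (mode z True) \<psi>)) T)"
    unfolding sminus_def by (simp add: spin_lin)
  also have "\<dots> = (\<Sum>z<nsites L. ccre (mode z False) (cann (mode z True) (splus L \<psi>)) T
     - ccre (mode z False) (cann (mode z False) \<psi>) T + ccre (mode z True) (cann (mode z True) \<psi>) T)"
    by (intro sum.cong) (simp_all add: splus_ccre c fock_lin)
  also have "\<dots> = sminus L (splus L \<psi>) T + 2 * s3 L \<psi> T"
    unfolding sminus_def s3_def
    by (simp add: sum.distrib sum_subtractf flip: sum_distrib_left sum_divide_distrib)
  finally show ?thesis .
qed

lemma ip_splus: "ip (nmodes L) (splus L \<phi>) \<psi> = ip (nmodes L) \<phi> (sminus L \<psi>)"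
  unfolding splus_def sminus_def by (simp add: ip_sum_left ip_sum_right ip_ccre ip_cann nmodes_def)

lemma ip_sminus: "ip (nmodes L) (sminus L \<phi>) \<psi> = ip (nmodes L) \<phi> (splus L \<psi>)"
  by (metis ip_splus ip_cnj)

lemma lann_splus: "lann L w \<sigma> (splus L \<psi>) T =
    splus L (lann L w \<sigma> \<psi>) T + (if \<sigma> then lann L w False \<psi> T else 0)"
proof -
  have "lann L w \<sigma> (splus L \<psi>) T = (\<Sum>z<nsites L. complex_of_real (w z) * (splus L (cann (mode z \<sigma>) \<psi>) T + (if \<sigma> then cann (mode z False) \<psi> T else 0)))"
    unfolding lann_def by (intro sum.cong) (simp_all add: cann_splus)
  also have "\<dots> = splus L (lann L w \<sigma> \<psi>) T + (if \<sigma> then lann L w False \<psi> T else 0)"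
    unfolding lann_def by (simp add: spin_lin algebra_simps sum.distrib)
  finally show ?thesis .
qed

lemma lann_sminus: "lann L w \<sigma> (sminus L \<psi>) T =
    sminus L (lann L w \<sigma> \<psi>) T + (if \<sigma> then 0 else lann L w True \<psi> T)"
proof -
  have "lann L w \<sigma> (sminus L \<psi>) T = (\<Sum>z<nsites L. complex_of_real (w z) * (sminus L (cann (mode z \<sigma>) \<psi>) T + (if \<sigma> then 0 else cann (mode z True) \<psi> T)))"
    unfolding lann_def by (intro sum.cong) (simp_all add: cann_sminus)
  also have "\<dots> = sminus L (lann L w \<sigma> \<psi>) T + (if \<sigma> then 0 else lann L w True \<psi> T)"
    unfolding lann_def by (simp add: spin_lin algebra_simps sum.distrib)
  finally show ?thesis .
qed

lemma stot2_eq: "stot2 L \<psi> T = (splus L (sminus L \<psi>) T + sminus L (splus L \<psi>) T) / 2 + s3 L (s3 L \<psi>) T"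
proof -
  have e: "s1 L \<psi> = (\<lambda>T. (1/2) * (splus L \<psi> T + sminus L \<psi> T))"
     "s2 L \<psi> = (\<lambda>T. (-\<i>/2) * (splus L \<psi> T - sminus L \<psi> T))" for \<psi>
    by (rule ext, simp add: s1_def s2_def field_simps)+
  show ?thesis
    unfolding stot2_def e spin_lin by (simp add: field_simps)
qed

lemma s3_eq: "s3 L \<psi> T = (splus L (sminus L \<psi>) T - sminus L (splus L \<psi>) T) / 2"
  using splus_sminus[of L \<psi> T] by simp

lemma s3_eq_fun: "s3 L \<psi> = (\<lambda>T. (1/2) * (splus L (sminus L \<psi>) T - sminus L (splus L \<psi>) T))"
  using s3_eq by auto

lemma s3_lin: "s3 L (\<lambda>T. c * f T) T = c * s3 L f T"
  "s3 L (\<lambda>T. f T + g T) T = s3 L f T + s3 L g T"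
  "s3 L (\<lambda>T. f T - g T) T = s3 L f T - s3 L g T"
  unfolding s3_def by (simp_all add: fock_lin sum_distrib_left algebra_simps sum.distrib sum_subtractf)

lemma stot2_eq': "stot2 L \<psi> T = sminus L (splus L \<psi>) T + s3 L \<psi> T + s3 L (s3 L \<psi>) T"
  by (simp add: stot2_eq s3_eq[of L \<psi>] field_simps)

lemma stot2_lin: "stot2 L (\<lambda>T. c * f T) T = c * stot2 L f T"
  "stot2 L (\<lambda>T. f T + g T) T = stot2 L f T + stot2 L g T"
  "stot2 L (\<lambda>T. f T - g T) T = stot2 L f T - stot2 L g T"
proof -
  have 1: "s3 L (\<lambda>T. c * f T) = (\<lambda>T. c * s3 L f T)" "splus L (\<lambda>T. c * f T) = (\<lambda>T. c * splus L f T)"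
    "s3 L (\<lambda>T. f T + g T) = (\<lambda>T. s3 L f T + s3 L g T)" "splus L (\<lambda>T. f T + g T) = (\<lambda>T. splus L f T + splus L g T)"
    "s3 L (\<lambda>T. f T - g T) = (\<lambda>T. s3 L f T - s3 L g T)" "splus L (\<lambda>T. f T - g T) = (\<lambda>T. splus L f T - splus L g T)"
    by (auto simp: s3_lin spin_lin)
  show "stot2 L (\<lambda>T. c * f T) T = c * stot2 L f T"
    "stot2 L (\<lambda>T. f T + g T) T = stot2 L f T + stot2 L g T"
    "stot2 L (\<lambda>T. f T - g T) T = stot2 L f T - stot2 L g T"
    unfolding stot2_eq' 1 by (simp_all add: s3_lin spin_lin algebra_simps)
qed

lemma stot2_zero [simp]: "stot2 L (\<lambda>T. 0) = (\<lambda>T. 0)"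
  using stot2_lin(1)[of L 0 "\<lambda>T. 0"] by auto

lemma stot2_sum: "finite I \<Longrightarrow> stot2 L (\<lambda>T. \<Sum>i\<in>I. f i T) T = (\<Sum>i\<in>I. stot2 L (f i) T)"
  by (induction I arbitrary: T rule: finite_induct) (simp_all add: stot2_lin)

text \<open>The inner product and the hopping energy are both of this kind, so spin eigenspaces are
  orthogonal for both and the energy splits along them.\<close>

locale spin_form =
  fixes L :: nat and B :: "fstate \<Rightarrow> fstate \<Rightarrow> complex"
  assumes scale_left: "B (\<lambda>T. c * f T) \<psi> = cnj c * B f \<psi>"
    and scale_right: "B \<phi> (\<lambda>T. c * f T) = c * B \<phi> f"
    and add_left: "B (\<lambda>T. f T + g T) \<psi> = B f \<psi> + B g \<psi>"
    and add_right: "B \<phi> (\<lambda>T. f T + g T) = B \<phi> f + B \<phi> g"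
    and splus_left: "B (splus L \<phi>) \<psi> = B \<phi> (sminus L \<psi>)"
    and sminus_left: "B (sminus L \<phi>) \<psi> = B \<phi> (splus L \<psi>)"
begin

lemma minus_left: "B (\<lambda>T. - f T) \<psi> = - B f \<psi>"
  using scale_left[of "-1" f \<psi>] by simp
lemma minus_right: "B \<phi> (\<lambda>T. - f T) = - B \<phi> f"
  using scale_right[of \<phi> "-1" f] by simp
lemma diff_left: "B (\<lambda>T. f T - g T) \<psi> = B f \<psi> - B g \<psi>"
  using add_left[of f "\<lambda>T. - g T"] by (simp add: minus_left)
lemma diff_right: "B \<phi> (\<lambda>T. f T - g T) = B \<phi> f - B \<phi> g"
  using add_right[of \<phi> f "\<lambda>T. - g T"] by (simp add: minus_right)
lemma zero_left: "B (\<lambda>T. 0) \<psi> = 0" using scale_left[of 0] by simp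
lemma zero_right: "B \<phi> (\<lambda>T. 0) = 0" using scale_right[of _ 0] by simp
lemma sum_left: "finite I \<Longrightarrow> B (\<lambda>T. \<Sum>i\<in>I. f i T) \<psi> = (\<Sum>i\<in>I. B (f i) \<psi>)"
  by (induction I rule: finite_induct) (simp_all add: zero_left add_left)
lemma sum_right: "finite I \<Longrightarrow> B \<phi> (\<lambda>T. \<Sum>i\<in>I. f i T) = (\<Sum>i\<in>I. B \<phi> (f i))"
  by (induction I rule: finite_induct) (simp_all add: zero_right add_right)

lemma s3_left: "B (s3 L \<phi>) \<psi> = B \<phi> (s3 L \<psi>)"
  unfolding s3_eq_fun scale_left scale_right diff_left diff_right splus_left sminus_left by simp

lemma stot2_left: "B (stot2 L \<phi>) \<psi> = B \<phi> (stot2 L \<psi>)"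
proof -
  have e: "stot2 L \<psi> = (\<lambda>T. (sminus L (splus L \<psi>) T + s3 L \<psi> T) + s3 L (s3 L \<psi>) T)" for \<psi>
    using stot2_eq' by auto
  show ?thesis unfolding e add_left add_right splus_left sminus_left s3_left by simp
qed

lemma stot2_orthogonal:
  assumes "stot2 L \<phi> = (\<lambda>T. complex_of_real a * \<phi> T)" "stot2 L \<psi> = (\<lambda>T. complex_of_real b * \<psi> T)" "a \<noteq> b"
  shows "B \<phi> \<psi> = 0"
  using stot2_left[of \<phi> \<psi>] assms by (simp add: scale_left scale_right)

end

interpretation ip_form: spin_form L "ip (nmodes L)" for L
  by unfold_locales (simp_all add: ip_scale_left ip_scale_right ip_add_left ip_add_right ip_splus ip_sminus)

text \<open>The matrix element of \<open>lcre\<close> with weights \<open>w\<close> after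
  \<open>lann\<close> with weights \<open>w'\<close>, the creation operator being moved to the left
  argument. The sum over both spins makes it spin invariant: the extra term of
  \<open>lann_splus\<close> at spin up matches that of \<open>lann_sminus\<close> at spin
  down.\<close>

definition lform :: "nat \<Rightarrow> (nat \<Rightarrow> real) \<Rightarrow> (nat \<Rightarrow> real) \<Rightarrow> fstate \<Rightarrow> fstate \<Rightarrow> complex" where
  "lform L w w' \<phi> \<psi> = (\<Sum>\<sigma>\<in>UNIV. ip (nmodes L) (lann L w \<sigma> \<phi>) (lann L w' \<sigma> \<psi>))"

lemma lann_lin: "lann L w \<sigma> (\<lambda>T. c * f T) = (\<lambda>T. c * lann L w \<sigma> f T)"
  "lann L w \<sigma> (\<lambda>T. f T + g T) = (\<lambda>T. lann L w \<sigma> f T + lann L w \<sigma> g T)"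
  "lann L w \<sigma> (\<lambda>T. f T - g T) = (\<lambda>T. lann L w \<sigma> f T - lann L w \<sigma> g T)"
  unfolding lann_def by (simp_all add: fock_lin sum_distrib_left algebra_simps sum.distrib sum_subtractf)

interpretation lform: spin_form L "lform L w w'" for L w w'
proof unfold_locales
  have p: "lann L w \<sigma> (splus L \<psi>) = (\<lambda>T. splus L (lann L w \<sigma> \<psi>) T + (if \<sigma> then lann L w False \<psi> T else 0))" for w \<sigma> \<psi>
    by (rule ext, rule lann_splus)
  have m: "lann L w \<sigma> (sminus L \<psi>) = (\<lambda>T. sminus L (lann L w \<sigma> \<psi>) T + (if \<sigma> then 0 else lann L w True \<psi> T))" for w \<sigma> \<psi>
    by (rule ext, rule lann_sminus)
  show "lform L w w' (splus L \<phi>) \<psi> = lform L w w' \<phi> (sminus L \<psi>)" for \<phi> \<psi>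
    unfolding lform_def p m by (simp add: UNIV_bool ip_add_left ip_add_right ip_splus)
  show "lform L w w' (sminus L \<phi>) \<psi> = lform L w w' \<phi> (splus L \<psi>)" for \<phi> \<psi>
    unfolding lform_def p m by (simp add: UNIV_bool ip_add_left ip_add_right ip_sminus)
qed (simp_all add: lform_def lann_lin ip_scale_left ip_scale_right ip_add_left ip_add_right sum.distrib sum_distrib_left)

text \<open>Odd modes carry spin down, so \<open>q\<close> counts down spins and the third spin
  component equals \<open>N / 2 - q\<close>.\<close>

definition sector :: "nat \<Rightarrow> nat \<Rightarrow> nat \<Rightarrow> fstate \<Rightarrow> bool" where
  "sector L N q \<psi> \<longleftrightarrow> (\<forall>T. \<psi> T \<noteq> 0 \<longrightarrow> T \<subseteq> {..<nmodes L} \<and> card T = N \<and> card {j\<in>T. odd j} = q)"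

text \<open>No sign appears because the two modes of a site are consecutive in the ordering: the
  signs of the annihilation and of the creation count the same modes and cancel.\<close>

lemma splus_apply: "splus L \<psi> T = (\<Sum>z<nsites L. if mode z True \<in> T \<and> mode z False \<notin> T
    then \<psi> (insert (mode z False) (T - {mode z True})) else 0)"
proof -
  have e: "fsign T (2*z) = fsign T (Suc (2*z))" if "2*z \<notin> T" for z T
  proof -
    have "{i\<in>T. i < 2*z} = {i\<in>T. i < Suc (2*z)}" using that by (auto simp: less_Suc_eq)
    then show ?thesis by (simp add: fsign_def)
  qed
  show ?thesis unfolding splus_def
  proof (intro sum.cong refl)
    fix z
    have "fsign T (2*z) * fsign (T - {2*z}) (Suc (2*z)) = 1"
      using e[of z "T - {2*z}"] fsign_remove[of T "2*z" "2*z"] by (metis Diff_iff fsign_mult_self(1) less_irrefl singletonI)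
    then have *: "fsign T (2*z) * (fsign (T - {2*z}) (Suc (2*z)) * c) = c" for c
      by (metis mult.assoc mult_1)
    show "ccre (mode z True) (cann (mode z False) \<psi>) T = (if mode z True \<in> T \<and> mode z False \<notin> T
       then \<psi> (insert (mode z False) (T - {mode z True})) else 0)"
      by (auto simp: ccre_def cann_def mode_def *)
  qed
qed

lemma sminus_apply: "sminus L \<psi> T = (\<Sum>z<nsites L. if mode z False \<in> T \<and> mode z True \<notin> T
    then \<psi> (insert (mode z True) (T - {mode z False})) else 0)"
proof -
  have e: "fsign (T - {Suc (2*z)}) (2*z) = fsign T (Suc (2*z))" if "2*z \<notin> T" for z T
  proof -
    have "{i\<in>T. i < 2*z} = {i\<in>T. i < Suc (2*z)}" using that by (auto simp: less_Suc_eq)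
    then show ?thesis unfolding fsign_remove by (simp add: fsign_def)
  qed
  show ?thesis unfolding sminus_def
    by (intro sum.cong refl) (auto simp: ccre_def cann_def mode_def e)
qed

lemma odd_mode [simp]: "odd (mode z \<sigma>) \<longleftrightarrow> \<not> \<sigma>" "even (mode z \<sigma>) \<longleftrightarrow> \<sigma>"
  by (auto simp: mode_def)

lemma odd_flip:
  assumes "finite T"
  shows "mode z True \<in> T \<Longrightarrow> mode z False \<notin> T \<Longrightarrow> card (insert (mode z False) (T - {mode z True})) = card T"
    "mode z True \<in> T \<Longrightarrow> mode z False \<notin> T \<Longrightarrow> card {j \<in> insert (mode z False) (T - {mode z True}). odd j} = Suc (card {j\<in>T. odd j})"
    "mode z False \<in> T \<Longrightarrow> mode z True \<notin> T \<Longrightarrow> card (insert (mode z True) (T - {mode z False})) = card T"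
    "mode z False \<in> T \<Longrightarrow> mode z True \<notin> T \<Longrightarrow> Suc (card {j \<in> insert (mode z True) (T - {mode z False}). odd j}) = card {j\<in>T. odd j}"
proof -
  have c: "card (insert a (T - {b})) = card T" if "b \<in> T" "a \<notin> T" for a b
    using assms that card_Suc_Diff1[OF assms that(1)] by (simp add: card_insert_if)
  show "mode z True \<in> T \<Longrightarrow> mode z False \<notin> T \<Longrightarrow> card (insert (mode z False) (T - {mode z True})) = card T"
       "mode z False \<in> T \<Longrightarrow> mode z True \<notin> T \<Longrightarrow> card (insert (mode z True) (T - {mode z False})) = card T"
    by (auto intro!: c)
  have "{j \<in> insert (mode z False) (T - {mode z True}). odd j} = insert (mode z False) {j\<in>T. odd j}" by auto
  then show "mode z True \<in> T \<Longrightarrow> mode z False \<notin> T \<Longrightarrow> card {j \<in> insert (mode z False) (T - {mode z True}). odd j} = Suc (card {j\<in>T. odd j})"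
    using assms by simp
  have "{j \<in> insert (mode z True) (T - {mode z False}). odd j} = {j\<in>T. odd j} - {mode z False}" by auto
  then show "mode z False \<in> T \<Longrightarrow> mode z True \<notin> T \<Longrightarrow> Suc (card {j \<in> insert (mode z True) (T - {mode z False}). odd j}) = card {j\<in>T. odd j}"
    using assms card_Suc_Diff1[of "{j\<in>T. odd j}" "mode z False"] by simp
qed

lemma splus_support:
  assumes "splus L \<psi> T \<noteq> 0"
  obtains z where "z < nsites L" "mode z True \<in> T" "mode z False \<notin> T" "\<psi> (insert (mode z False) (T - {mode z True})) \<noteq> 0"
  by (rule sum.not_neutral_contains_not_neutral[OF assms[unfolded splus_apply]])
     (use that in \<open>auto split: if_splits\<close>)

lemma sminus_support:
  assumes "sminus L \<psi> T \<noteq> 0"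
  obtains z where "z < nsites L" "mode z False \<in> T" "mode z True \<notin> T" "\<psi> (insert (mode z True) (T - {mode z False})) \<noteq> 0"
  by (rule sum.not_neutral_contains_not_neutral[OF assms[unfolded sminus_apply]])
     (use that in \<open>auto split: if_splits\<close>)

lemma sector_splus:
  assumes "sector L N (Suc q) \<psi>"
  shows "sector L N q (splus L \<psi>)"
  unfolding sector_def
proof (intro allI impI)
  fix T assume "splus L \<psi> T \<noteq> 0"
  then obtain z where z: "z < nsites L" "mode z True \<in> T" "mode z False \<notin> T" "\<psi> (insert (mode z False) (T - {mode z True})) \<noteq> 0"
    by (rule splus_support)
  let ?T = "insert (mode z False) (T - {mode z True})"
  have s: "?T \<subseteq> {..<nmodes L}" "card ?T = N" "card {j\<in>?T. odd j} = Suc q"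
    using assms[unfolded sector_def, rule_format, OF z(4)] by simp_all
  then have sub: "T \<subseteq> {..<nmodes L}" using z(1) by (auto simp: nmodes_def)
  then have "finite T" by (rule finite_subset) simp
  from odd_flip(1,2)[OF this z(2,3)] s sub show "T \<subseteq> {..<nmodes L} \<and> card T = N \<and> card {j \<in> T. odd j} = q" by simp
qed

lemma sector_0_splus:
  assumes "sector L N 0 \<psi>"
  shows "splus L \<psi> = (\<lambda>T. 0)"
proof (rule ext, rule ccontr)
  fix T assume "splus L \<psi> T \<noteq> 0"
  then obtain z where z: "\<psi> (insert (mode z False) (T - {mode z True})) \<noteq> 0"
    by (rule splus_support)
  let ?T = "insert (mode z False) (T - {mode z True})"
  from assms[unfolded sector_def, rule_format, OF z] have sub: "?T \<subseteq> {..<nmodes L}" and *: "card {j\<in>?T. odd j} = 0" by simp_all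
  have "finite ?T" by (rule finite_subset[OF sub]) simp
  then have "finite {j\<in>?T. odd j}" by simp
  with * have "{j\<in>?T. odd j} = {}" by simp
  moreover have "mode z False \<in> {j\<in>?T. odd j}" by simp
  ultimately show False by blast
qed

lemma sector_sminus:
  assumes "sector L N q \<psi>"
  shows "sector L N (Suc q) (sminus L \<psi>)"
  unfolding sector_def
proof (intro allI impI)
  fix T assume "sminus L \<psi> T \<noteq> 0"
  then obtain z where z: "z < nsites L" "mode z False \<in> T" "mode z True \<notin> T" "\<psi> (insert (mode z True) (T - {mode z False})) \<noteq> 0"
    by (rule sminus_support)
  let ?T = "insert (mode z True) (T - {mode z False})"
  have s: "?T \<subseteq> {..<nmodes L}" "card ?T = N" "card {j\<in>?T. odd j} = q"
    using assms[unfolded sector_def, rule_format, OF z(4)] by simp_all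
  then have sub: "T \<subseteq> {..<nmodes L}" using z(1) by (auto simp: nmodes_def)
  then have "finite T" by (rule finite_subset) simp
  from odd_flip(3,4)[OF this z(2,3)] s sub show "T \<subseteq> {..<nmodes L} \<and> card T = N \<and> card {j \<in> T. odd j} = Suc q" by simp
qed

lemma sector_lin:
  assumes "sector L N q f"
  shows "sector L N q (\<lambda>T. c * f T)"
    "sector L N q g \<Longrightarrow> sector L N q (\<lambda>T. f T + g T)"
    "sector L N q g \<Longrightarrow> sector L N q (\<lambda>T. f T - g T)"
proof -
  show "sector L N q (\<lambda>T. c * f T)" using assms unfolding sector_def by auto
  show "sector L N q (\<lambda>T. f T + g T)" "sector L N q (\<lambda>T. f T - g T)" if "sector L N q g"
  proof -
    have "f T \<noteq> 0 \<or> g T \<noteq> 0" if "f T + g T \<noteq> 0 \<or> f T - g T \<noteq> 0" for T using that by auto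
    then show "sector L N q (\<lambda>T. f T + g T)" "sector L N q (\<lambda>T. f T - g T)"
      using assms that unfolding sector_def by meson+
  qed
qed

lemma s3_sector:
  assumes "sector L N q \<psi>"
  shows "s3 L \<psi> = (\<lambda>T. complex_of_real (real N / 2 - real q) * \<psi> T)"
proof
  fix T
  show "s3 L \<psi> T = complex_of_real (real N / 2 - real q) * \<psi> T"
  proof (cases "\<psi> T = 0")
    case True
    then show ?thesis unfolding s3_def number_apply by (auto intro!: sum.neutral)
  next
    case False
    then have T: "T \<subseteq> {..<nmodes L}" "card T = N" "card {j\<in>T. odd j} = q" using assms unfolding sector_def by auto
    have c: "(\<Sum>j<2*m. if P j \<and> j \<in> T then 1 else 0 :: complex) = of_nat (card {j\<in>T. P j})" if "T \<subseteq> {..<2*m}" for m P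
    proof -
      have "{j. j < 2*m \<and> P j \<and> j \<in> T} = {j\<in>T. P j}" using that by auto
      then show ?thesis by (simp add: sum.If_cases Int_def)
    qed
    have fin: "finite T" using T(1) finite_subset by blast
    have "{j\<in>T. even j} = T - {j\<in>T. odd j}" by auto
    then have ev: "card {j\<in>T. even j} = N - q" "q \<le> N" using T(2,3) fin by (auto simp: card_Diff_subset card_mono)
    have "2 * s3 L \<psi> T = (\<Sum>z<nsites L. (\<Sum>\<sigma>\<in>UNIV. (if even (mode z \<sigma>) \<and> mode z \<sigma> \<in> T then 1 else 0) - (if odd (mode z \<sigma>) \<and> mode z \<sigma> \<in> T then 1 else 0))) * \<psi> T"
      unfolding s3_def number_apply sum_distrib_left sum_distrib_right
      by (intro sum.cong refl) (auto simp: UNIV_bool)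
    also have "\<dots> = (of_nat (N - q) - of_nat q) * \<psi> T"
      using c[of "nsites L" even] c[of "nsites L" odd] T ev unfolding nmodes_def
      by (simp add: sum_mode sum_subtractf)
    also have "\<dots> = 2 * (complex_of_real (real N / 2 - real q) * \<psi> T)" using ev(2) by (simp add: algebra_simps of_nat_diff)
    finally show ?thesis by (simp only: mult_cancel_left) simp
  qed
qed

lemma stot2_sector:
  assumes "sector L N q \<psi>"
  shows "stot2 L \<psi> T = sminus L (splus L \<psi>) T + complex_of_real ((real N / 2 - real q) * (real N / 2 - real q + 1)) * \<psi> T"
proof -
  define m where "m = real N / 2 - real q"
  show ?thesis
    unfolding stot2_eq' s3_sector[OF assms] s3_lin(1) s3_sector[OF assms] m_def[symmetric]
    by (simp add: algebra_simps)
qed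

text \<open>Inside a sector the third component is a scalar \<open>m\<close>, and lowering turns it
  into \<open>m - 1\<close>. The commutator of raising and lowering contributes
  \<open>2 * m\<close>, and \<open>(m - 1) * m + 2 * m = m * (m + 1)\<close>.\<close>

lemma stot2_sminus_sector:
  assumes "sector L N q \<psi>"
  shows "stot2 L (sminus L \<psi>) T = sminus L (stot2 L \<psi>) T"
proof -
  define m where "m = real N / 2 - real q"
  have m': "real N / 2 - real (Suc q) = m - 1" by (simp add: m_def)
  have e: "splus L (sminus L \<psi>) = (\<lambda>T. sminus L (splus L \<psi>) T + complex_of_real (2 * m) * \<psi> T)"
    by (rule ext) (simp add: splus_sminus s3_sector[OF assms] m_def)
  have f: "stot2 L \<psi> = (\<lambda>T. sminus L (splus L \<psi>) T + complex_of_real (m * (m + 1)) * \<psi> T)"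
    unfolding m_def by (rule ext) (rule stot2_sector[OF assms])
  show ?thesis unfolding stot2_sector[OF sector_sminus[OF assms]] e f spin_lin m'
    by (simp add: algebra_simps)
qed

section \<open>Lattice geometry and finite-energy states\<close>

text \<open>Offsets are natural numbers; a step back by \<open>p\<close> is a shift by
  \<open>L - p\<close>.\<close>

definition shift :: "nat \<Rightarrow> nat \<Rightarrow> nat \<Rightarrow> nat \<Rightarrow> nat" where
  "shift L p q x = msite L (x div L + p) (x mod L + q)"

lemma msite_less: "L > 0 \<Longrightarrow> msite L i j < L\<^sup>2"
proof -
  assume L: "L > 0"
  have "(i mod L) * L + j mod L < (i mod L) * L + L" using L by simp
  also have "\<dots> = (i mod L + 1) * L" by simp
  also have "\<dots> \<le> L * L" using L by (intro mult_right_mono) (simp_all add: Suc_leI)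
  finally show ?thesis by (simp add: msite_def power2_eq_square)
qed

lemma msite_div_mod [simp]:
  assumes "L > 0"
  shows "msite L i j div L = i mod L" "msite L i j mod L = j mod L"
  using assms by (simp_all add: msite_def)

lemma msite_mod [simp]: "msite L (i mod L) j = msite L i j" "msite L i (j mod L) = msite L i j"
  by (simp_all add: msite_def)

lemma msite_self:
  assumes "x < L\<^sup>2"
  shows "msite L (x div L) (x mod L) = x"
proof -
  have "x div L < L" using assms by (simp add: less_mult_imp_div_less power2_eq_square)
  then show ?thesis by (simp add: msite_def)
qed

lemma shift_msite: "L > 0 \<Longrightarrow> shift L p q (msite L i j) = msite L (i + p) (j + q)"
  unfolding shift_def by (simp add: msite_def mod_add_left_eq)

lemma shift_less: "L > 0 \<Longrightarrow> shift L p q x < L\<^sup>2"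
  by (simp add: shift_def msite_less)

lemma shift_inverse:
  assumes "L > 0" "x < L\<^sup>2" "(p + p') mod L = 0" "(q + q') mod L = 0"
  shows "shift L p' q' (shift L p q x) = x"
proof -
  have 1: "(a + p + p') mod L = a mod L" for a
    using assms(3) mod_add_right_eq[of a "p + p'" L] by (simp add: add.assoc)
  have 2: "(a + q + q') mod L = a mod L" for a
    using assms(4) mod_add_right_eq[of a "q + q'" L] by (simp add: add.assoc)
  have "shift L p' q' (shift L p q x) = shift L p' q' (shift L p q (msite L (x div L) (x mod L)))"
    using msite_self[OF assms(2)] by simp
  also have "\<dots> = msite L (x div L + p + p') (x mod L + q + q')"
    by (simp only: shift_msite[OF assms(1)])
  also have "\<dots> = msite L (x div L) (x mod L)"
    unfolding msite_def 1 2 ..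
  finally show ?thesis using msite_self[OF assms(2)] by simp
qed

lemma sum_shift:
  assumes "L > 0" "(p + p') mod L = 0" "(q + q') mod L = 0"
  shows "(\<Sum>x<L\<^sup>2. g (shift L p q x) x) = (\<Sum>x<L\<^sup>2. g x (shift L p' q' x))"
  using assms
  by (intro sum.reindex_bij_witness[where i="shift L p' q'" and j="shift L p q"])
     (auto simp: shift_inverse shift_less add.commute)

text \<open>Components of the three bond directions modulo \<open>L\<close>; the \<open>-1\<close>
  of the third direction becomes \<open>L - 1\<close> in \<open>dirq\<close>.\<close>

definition dirp :: "nat \<Rightarrow> nat" where "dirp d = (if d = 1 then 0 else 1)"
definition dirq :: "nat \<Rightarrow> nat \<Rightarrow> nat" where "dirq L d = (if d = 0 then 0 else if d = 1 then 1 else L - 1)"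

lemma nbr_shift: "L > 0 \<Longrightarrow> nbr L x d = shift L (dirp d) (dirq L d) x"
  by (auto simp: nbr_def shift_def dirp_def dirq_def Let_def)

lemma sum_nbr:
  assumes "L > 0"
  shows "(\<Sum>x<L\<^sup>2. f (nbr L x d)) = (\<Sum>x<L\<^sup>2. f x)"
proof -
  have "(dirp d + (L - dirp d)) mod L = 0" "(dirq L d + (L - dirq L d)) mod L = 0"
    using assms by (auto simp: dirp_def dirq_def)
  from sum_shift[OF assms this, where g="\<lambda>x y. f x"] show ?thesis
    using assms by (simp add: nbr_shift)
qed

lemma nbr_less: "L > 0 \<Longrightarrow> nbr L x d < L\<^sup>2"
  by (simp add: nbr_shift shift_less)

lemma bond_less:
  assumes "L > 0" "b < nbonds L"
  shows "bfst L ori b < L\<^sup>2" "bsnd L ori b < L\<^sup>2"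
  using assms nbr_less by (auto simp: bfst_def bsnd_def nbonds_def)

lemma sum_bonds: "(\<Sum>b<nbonds L. g b) = (\<Sum>x<L\<^sup>2. \<Sum>d<3. g (3 * x + d) :: 'a::comm_monoid_add)"
proof -
  have "(\<Sum>b<3*n. g b) = (\<Sum>x<n. \<Sum>d<3. g (3 * x + d))" for n
    by (induction n) (simp_all add: eval_nat_numeral add_ac)
  then show ?thesis by (simp add: nbonds_def)
qed

text \<open>Symmetric summands do not see the arbitrary orientation, so the sum can be taken over
  base sites and directions.\<close>

lemma sum_bonds_sym:
  assumes "\<And>x y. f x y = f y x"
  shows "(\<Sum>b<nbonds L. f (bfst L ori b) (bsnd L ori b)) = (\<Sum>x<L\<^sup>2. \<Sum>d<3. f x (nbr L x d) :: 'a::comm_monoid_add)"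
proof -
  have "f (bfst L ori b) (bsnd L ori b) = f (b div 3) (nbr L (b div 3) (b mod 3))" for b
    using assms by (simp add: bfst_def bsnd_def)
  then show ?thesis unfolding sum_bonds by (intro sum.cong refl) simp
qed

text \<open>The coordination number six: for a fixed direction \<open>nbr\<close> permutes the
  sites, so each of the three directions reaches every site once as a base and once as a
  neighbour.\<close>

lemma sum_bond_ends:
  fixes f :: "nat \<Rightarrow> 'a::comm_semiring_1"
  assumes "L > 0"
  shows "(\<Sum>b<nbonds L. f (bfst L ori b) + f (bsnd L ori b)) = 6 * (\<Sum>x<L\<^sup>2. f x)"
proof -
  have "(\<Sum>b<nbonds L. f (bfst L ori b) + f (bsnd L ori b)) = (\<Sum>x<L\<^sup>2. \<Sum>d<3. f x + f (nbr L x d))"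
    by (rule sum_bonds_sym[of "\<lambda>x y. f x + f y"]) (rule add.commute)
  also have "\<dots> = (\<Sum>d<3. \<Sum>x<L\<^sup>2. f x + f (nbr L x d))"
    by (rule sum.swap)
  also have "\<dots> = 6 * (\<Sum>x<L\<^sup>2. f x)"
  proof -
    have "{..<3::nat} = {0, 1, 2}" by auto
    then show ?thesis using assms by (simp add: sum.distrib sum_nbr flip: distrib_right mult_2)
  qed
  finally show ?thesis .
qed

lemma site_less: "x < L\<^sup>2 \<Longrightarrow> x < nsites L"
  "b < nbonds L \<Longrightarrow> usite L b < nsites L"
  "b < nbonds L \<Longrightarrow> ubsite L b < nsites L"
  by (simp_all add: usite_def ubsite_def nsites_def nbonds_def)

section \<open>Normalization of the \<open>a\<close> operators and amplitudes annihilated by the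
  \<open>b\<close> operators\<close>

definition kappa :: "real \<Rightarrow> real" where "kappa \<mu> = sqrt (1 + 2 * zeta * \<mu>\<^sup>2)"

lemma kappa_pos: "kappa \<mu> > 0"
  unfolding kappa_def zeta_def by (simp add: add_pos_nonneg)

lemma kappa_sq: "(kappa \<mu>)\<^sup>2 = 1 + 12 * \<mu>\<^sup>2"
  unfolding kappa_def zeta_def by (simp add: add_nonneg_nonneg)

lemma sum_ind: "z' < n \<Longrightarrow> (\<Sum>z<n::nat. of_real (ind (z = z')) * f z) = (f z' :: complex)"
proof -
  assume "z' < n"
  have "(\<Sum>z<n. of_real (ind (z = z')) * f z) = (\<Sum>z<n. if z = z' then f z else 0)"
    by (intro sum.cong) (auto simp: ind_def)
  with \<open>z' < n\<close> show ?thesis by simp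
qed

text \<open>Meant for \<open>f z = cann (mode z \<sigma>) \<psi> T\<close> with
  \<open>\<sigma>\<close> and \<open>T\<close> fixed: annihilation by the \<open>b\<close> operators
  determines the values at the two auxiliary sites of a bond from those at its ends.\<close>

definition bkill :: "nat \<Rightarrow> real \<Rightarrow> (nat \<Rightarrow> bool) \<Rightarrow> (nat \<Rightarrow> complex) \<Rightarrow> bool" where
  "bkill L \<mu> ori f \<longleftrightarrow> (\<forall>b<nbonds L.
     f (usite L b) = of_real \<mu> * (f (bfst L ori b) + f (bsnd L ori b)) \<and>
     f (ubsite L b) = - of_real \<mu> * (f (bfst L ori b) - f (bsnd L ori b)))"

lemma sum_buvec:
  fixes f :: "nat \<Rightarrow> complex"
  assumes "L > 0" "b < nbonds L"
  shows "(\<Sum>z<nsites L. of_real (buvec L \<mu> ori b z) * f z) =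
      f (usite L b) - of_real \<mu> * (f (bfst L ori b) + f (bsnd L ori b))"
    "(\<Sum>z<nsites L. of_real (bubvec L \<mu> ori b z) * f z) =
      f (ubsite L b) + of_real \<mu> * (f (bfst L ori b) - f (bsnd L ori b))"
proof -
  have s: "(\<Sum>z<nsites L. of_real (ind (z = usite L b)) * f z) = f (usite L b)"
    "(\<Sum>z<nsites L. of_real (ind (z = ubsite L b)) * f z) = f (ubsite L b)"
    "(\<Sum>z<nsites L. of_real (ind (z = bfst L ori b)) * f z) = f (bfst L ori b)"
    "(\<Sum>z<nsites L. of_real (ind (z = bsnd L ori b)) * f z) = f (bsnd L ori b)"
    using assms by (simp_all add: sum_ind site_less bond_less)
  have "(\<Sum>z<nsites L. of_real (buvec L \<mu> ori b z) * f z) =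
    (\<Sum>z<nsites L. of_real (ind (z = usite L b)) * f z)
     - of_real \<mu> * ((\<Sum>z<nsites L. of_real (ind (z = bfst L ori b)) * f z) + (\<Sum>z<nsites L. of_real (ind (z = bsnd L ori b)) * f z))"
    unfolding buvec_def sum_distrib_left sum.distrib[symmetric] sum_subtractf[symmetric]
    by (intro sum.cong refl) (simp add: algebra_simps)
  then show "(\<Sum>z<nsites L. of_real (buvec L \<mu> ori b z) * f z) =
      f (usite L b) - of_real \<mu> * (f (bfst L ori b) + f (bsnd L ori b))" unfolding s .
  have "(\<Sum>z<nsites L. of_real (bubvec L \<mu> ori b z) * f z) =
    (\<Sum>z<nsites L. of_real (ind (z = ubsite L b)) * f z)
     + of_real \<mu> * ((\<Sum>z<nsites L. of_real (ind (z = bfst L ori b)) * f z) - (\<Sum>z<nsites L. of_real (ind (z = bsnd L ori b)) * f z))"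
    unfolding bubvec_def sum_distrib_left sum.distrib[symmetric] sum_subtractf[symmetric]
    by (intro sum.cong refl) (simp add: algebra_simps)
  then show "(\<Sum>z<nsites L. of_real (bubvec L \<mu> ori b z) * f z) =
      f (ubsite L b) + of_real \<mu> * (f (bfst L ori b) - f (bsnd L ori b))" unfolding s .
qed

lemma bkill_iff:
  assumes "L > 0"
  shows "bkill L \<mu> ori f \<longleftrightarrow> (\<forall>b<nbonds L.
     (\<Sum>z<nsites L. of_real (buvec L \<mu> ori b z) * f z) = 0 \<and>
     (\<Sum>z<nsites L. of_real (bubvec L \<mu> ori b z) * f z) = 0)"
  using assms unfolding bkill_def by (simp add: sum_buvec add_eq_0_iff2)

text \<open>After insertion of the values at the auxiliary sites, the contribution of the far end of
  each bond at \<open>x\<close> cancels between \<open>u\<close> and \<open>ubar\<close>, and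
  \<open>2 * \<mu>\<^sup>2 * f x\<close> remains. Six bonds give the factor
  \<open>1 + 12 * \<mu>\<^sup>2\<close>, the square of \<open>kappa \<mu>\<close>, against one power
  of \<open>kappa \<mu>\<close> in the denominator.\<close>

lemma sum_avec:
  assumes "L > 0" "x < L\<^sup>2" "bkill L \<mu> ori f"
  shows "(\<Sum>z<nsites L. of_real (avec L \<mu> ori x z) * f z) = of_real (kappa \<mu>) * f x"
proof -
  let ?x = "bfst L ori" and ?y = "bsnd L ori"
  have f: "f (usite L b) = of_real \<mu> * (f (?x b) + f (?y b))"
    "f (ubsite L b) = - of_real \<mu> * (f (?x b) - f (?y b))" if "b < nbonds L" for b
    using assms(3) that unfolding bkill_def by auto
  have "(\<Sum>z<nsites L. of_real (avec L \<mu> ori x z) * f z) = of_real (1 / kappa \<mu>) *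
    ((\<Sum>z<nsites L. of_real (ind (z = x)) * f z)
    + of_real \<mu> * (\<Sum>z<nsites L. \<Sum>b<nbonds L. if ?x b = x then of_real (ind (z = usite L b)) * f z - of_real (ind (z = ubsite L b)) * f z else 0)
    + of_real \<mu> * (\<Sum>z<nsites L. \<Sum>b<nbonds L. if ?y b = x then of_real (ind (z = usite L b)) * f z + of_real (ind (z = ubsite L b)) * f z else 0))"
    unfolding avec_def kappa_def[symmetric] sum_distrib_left sum.distrib[symmetric]
    by (intro sum.cong refl)
      (simp add: algebra_simps sum_distrib_left sum_distrib_right if_distrib[of complex_of_real] cong: if_cong,
       simp add: if_distrib algebra_simps cong: if_cong)
  also have "(\<Sum>z<nsites L. of_real (ind (z = x)) * f z) = f x"
    using assms(2) by (intro sum_ind site_less)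
  also have "(\<Sum>z<nsites L. \<Sum>b<nbonds L. if ?x b = x then of_real (ind (z = usite L b)) * f z - of_real (ind (z = ubsite L b)) * f z else 0)
    = (\<Sum>b<nbonds L. if ?x b = x then 2 * of_real \<mu> * f x else 0)"
  proof (subst sum.swap, intro sum.cong refl)
    fix b assume "b \<in> {..<nbonds L}"
    then have b: "b < nbonds L" by simp
    have "(\<Sum>z<nsites L. of_real (ind (z = usite L b)) * f z - of_real (ind (z = ubsite L b)) * f z) = f (usite L b) - f (ubsite L b)"
      unfolding sum_subtractf using site_less(2,3)[OF b] by (simp add: sum_ind)
    then show "(\<Sum>z<nsites L. if ?x b = x then of_real (ind (z = usite L b)) * f z - of_real (ind (z = ubsite L b)) * f z else 0) =
      (if ?x b = x then 2 * of_real \<mu> * f x else 0)" using f[OF b] by (auto simp: algebra_simps)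
  qed
  also have "(\<Sum>z<nsites L. \<Sum>b<nbonds L. if ?y b = x then of_real (ind (z = usite L b)) * f z + of_real (ind (z = ubsite L b)) * f z else 0)
    = (\<Sum>b<nbonds L. if ?y b = x then 2 * of_real \<mu> * f x else 0)"
  proof (subst sum.swap, intro sum.cong refl)
    fix b assume "b \<in> {..<nbonds L}"
    then have b: "b < nbonds L" by simp
    have "(\<Sum>z<nsites L. of_real (ind (z = usite L b)) * f z + of_real (ind (z = ubsite L b)) * f z) = f (usite L b) + f (ubsite L b)"
      unfolding sum.distrib using site_less(2,3)[OF b] by (simp add: sum_ind)
    then show "(\<Sum>z<nsites L. if ?y b = x then of_real (ind (z = usite L b)) * f z + of_real (ind (z = ubsite L b)) * f z else 0) =
      (if ?y b = x then 2 * of_real \<mu> * f x else 0)" using f[OF b] by (auto simp: algebra_simps)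
  qed
  also have "of_real (1 / kappa \<mu>) * (f x + of_real \<mu> * (\<Sum>b<nbonds L. if ?x b = x then 2 * of_real \<mu> * f x else 0)
     + of_real \<mu> * (\<Sum>b<nbonds L. if ?y b = x then 2 * of_real \<mu> * f x else 0)) =
    of_real (1 / kappa \<mu>) * (f x + 2 * (of_real \<mu>)\<^sup>2 * f x * (\<Sum>b<nbonds L. (if ?x b = x then 1 else 0) + (if ?y b = x then 1 else 0)))"
    by (simp add: sum_distrib_left sum.distrib[symmetric] power2_eq_square if_distrib[of "(*) _"] add.assoc cong: if_cong)
      (intro disjI2 sum.cong refl, simp)
  also have "(\<Sum>b<nbonds L. (if ?x b = x then 1 else 0) + (if ?y b = x then 1 else 0)) = (6::complex)"
    using sum_bond_ends[OF assms(1), of "\<lambda>y. if y = x then 1 else 0"] assms(2) by simp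
  also have "of_real (1 / kappa \<mu>) * (f x + 2 * (of_real \<mu>)\<^sup>2 * f x * 6) = of_real (1 / kappa \<mu>) * (of_real ((kappa \<mu>)\<^sup>2) * f x)"
    unfolding kappa_sq by (simp add: algebra_simps)
  also have "\<dots> = of_real (kappa \<mu>) * f x"
    using kappa_pos[of \<mu>] by (simp add: power2_eq_square)
  finally show ?thesis .
qed

section \<open>Finite-energy states and their amplitudes on the triangular lattice\<close>

definition finite_energy :: "nat \<Rightarrow> real \<Rightarrow> (nat \<Rightarrow> bool) \<Rightarrow> fstate \<Rightarrow> bool" where
  "finite_energy L \<mu> ori \<psi> \<longleftrightarrow>
    (\<forall>b<nbonds L. \<forall>\<sigma>. lann L (buvec L \<mu> ori b) \<sigma> \<psi> = (\<lambda>T. 0) \<and> lann L (bubvec L \<mu> ori b) \<sigma> \<psi> = (\<lambda>T. 0)) \<and>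
    (\<forall>z<nsites L. cann (mode z True) (cann (mode z False) \<psi>) = (\<lambda>T. 0))"

lemma finite_energy_bkill:
  assumes "L > 0" "finite_energy L \<mu> ori \<psi>"
  shows "bkill L \<mu> ori (\<lambda>z. cann (mode z \<sigma>) \<psi> T)"
  unfolding bkill_iff[OF assms(1)]
proof (intro allI impI)
  fix b assume "b < nbonds L"
  then have "lann L (buvec L \<mu> ori b) \<sigma> \<psi> T = 0" "lann L (bubvec L \<mu> ori b) \<sigma> \<psi> T = 0"
    using assms(2) unfolding finite_energy_def by auto
  then show "(\<Sum>z<nsites L. complex_of_real (buvec L \<mu> ori b z) * cann (mode z \<sigma>) \<psi> T) = 0 \<and>
           (\<Sum>z<nsites L. complex_of_real (bubvec L \<mu> ori b z) * cann (mode z \<sigma>) \<psi> T) = 0"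
    unfolding lann_def by simp
qed

lemma finite_energy_cu:
  assumes "L > 0" "finite_energy L \<mu> ori \<psi>" "b < nbonds L"
  shows "cann (mode (usite L b) \<sigma>) \<psi> = (\<lambda>T. complex_of_real \<mu> * (cann (mode (bfst L ori b) \<sigma>) \<psi> T + cann (mode (bsnd L ori b) \<sigma>) \<psi> T))"
    "cann (mode (ubsite L b) \<sigma>) \<psi> = (\<lambda>T. - complex_of_real \<mu> * (cann (mode (bfst L ori b) \<sigma>) \<psi> T - cann (mode (bsnd L ori b) \<sigma>) \<psi> T))"
  using finite_energy_bkill[OF assms(1,2)] assms(3) unfolding bkill_def by blast+

lemma finite_energy_lann_avec:
  assumes "L > 0" "finite_energy L \<mu> ori \<psi>" "x < L\<^sup>2"
  shows "lann L (avec L \<mu> ori x) \<sigma> \<psi> = (\<lambda>T. complex_of_real (kappa \<mu>) * cann (mode x \<sigma>) \<psi> T)"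
  unfolding lann_def
  by (rule ext) (rule sum_avec[OF assms(1,3) finite_energy_bkill[OF assms(1,2)]])

lemma finite_energy_lin:
  assumes "finite_energy L \<mu> ori f"
  shows "finite_energy L \<mu> ori (\<lambda>T. c * f T)"
    "finite_energy L \<mu> ori g \<Longrightarrow> finite_energy L \<mu> ori (\<lambda>T. f T + g T)"
    "finite_energy L \<mu> ori g \<Longrightarrow> finite_energy L \<mu> ori (\<lambda>T. f T - g T)"
  using assms unfolding finite_energy_def by (auto simp: lann_lin fock_lin fun_eq_iff)

lemma finite_energy_cann:
  assumes "finite_energy L \<mu> ori \<psi>"
  shows "finite_energy L \<mu> ori (cann j \<psi>)"
proof -
  have 1: "lann L w \<sigma> (cann j \<psi>) = (\<lambda>T. - cann j (lann L w \<sigma> \<psi>) T)" for w \<sigma>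
    using cann_lann[of j L w \<sigma> \<psi>] by auto
  have 2: "cann i (cann j \<psi>) = (\<lambda>T. - cann j (cann i \<psi>) T)" for i \<psi> by (rule ext) (rule cann_cann)
  have 3: "cann (mode z True) (cann (mode z False) (cann j \<psi>)) = (\<lambda>T. 0)" if "z < nsites L" for z
  proof -
    have "cann (mode z True) (cann (mode z False) (cann j \<psi>)) = (\<lambda>T. - cann (mode z True) (cann j (cann (mode z False) \<psi>)) T)"
      by (subst 2) (simp add: fock_lin)
    also have "\<dots> = cann j (cann (mode z True) (cann (mode z False) \<psi>))" by (subst 2) simp
    also have "\<dots> = (\<lambda>T. 0)" using assms that unfolding finite_energy_def by simp
    finally show ?thesis .
  qed
  show ?thesis using assms unfolding finite_energy_def 1 by (auto simp: 3)
qed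

lemma finite_energy_splus:
  assumes "finite_energy L \<mu> ori \<psi>"
  shows "finite_energy L \<mu> ori (splus L \<psi>)"
proof -
  have 1: "lann L w \<sigma> (splus L \<psi>) = (\<lambda>T. splus L (lann L w \<sigma> \<psi>) T + (if \<sigma> then lann L w False \<psi> T else 0))" for w \<sigma>
    by (rule ext) (rule lann_splus)
  have 3: "cann (mode z True) (cann (mode z False) (splus L \<psi>)) = (\<lambda>T. 0)" if z: "z < nsites L" for z
  proof -
    have "cann (mode z False) (splus L \<psi>) = splus L (cann (mode z False) \<psi>)"
      by (rule ext) (simp add: cann_splus z)
    then have "cann (mode z True) (cann (mode z False) (splus L \<psi>)) =
      (\<lambda>T. splus L (cann (mode z True) (cann (mode z False) \<psi>)) T + cann (mode z False) (cann (mode z False) \<psi>) T)"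
      using cann_splus[OF z, of True] by auto
    also have "\<dots> = (\<lambda>T. 0)" using assms z unfolding finite_energy_def by (simp add: cann_cann_same)
    finally show ?thesis .
  qed
  show ?thesis using assms unfolding finite_energy_def 1 by (auto simp: 3)
qed

lemma finite_energy_sminus:
  assumes "finite_energy L \<mu> ori \<psi>"
  shows "finite_energy L \<mu> ori (sminus L \<psi>)"
proof -
  have 1: "lann L w \<sigma> (sminus L \<psi>) = (\<lambda>T. sminus L (lann L w \<sigma> \<psi>) T + (if \<sigma> then 0 else lann L w True \<psi> T))" for w \<sigma>
    by (rule ext) (rule lann_sminus)
  have 3: "cann (mode z True) (cann (mode z False) (sminus L \<psi>)) = (\<lambda>T. 0)" if z: "z < nsites L" for z
  proof -
    have "cann (mode z False) (sminus L \<psi>) = (\<lambda>T. sminus L (cann (mode z False) \<psi>) T + cann (mode z True) \<psi> T)"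
      by (rule ext) (simp add: cann_sminus z)
    then have "cann (mode z True) (cann (mode z False) (sminus L \<psi>)) =
      (\<lambda>T. sminus L (cann (mode z True) (cann (mode z False) \<psi>)) T + cann (mode z True) (cann (mode z True) \<psi>) T)"
      using cann_sminus[OF z, of True] by (auto simp: fock_lin)
    also have "\<dots> = (\<lambda>T. 0)" using assms z unfolding finite_energy_def by (simp add: cann_cann_same)
    finally show ?thesis .
  qed
  show ?thesis using assms unfolding finite_energy_def 1 by (auto simp: 3)
qed

lemma finite_energy_no_double:
  assumes "finite_energy L \<mu> ori \<psi>" "z < nsites L" "mode z True \<in> T" "mode z False \<in> T"
  shows "\<psi> T = 0"
proof -
  let ?R = "T - {mode z True, mode z False}"
  have "cann (mode z True) (cann (mode z False) \<psi>) ?R = 0"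
    using assms unfolding finite_energy_def by simp
  moreover have "insert (mode z False) (insert (mode z True) ?R) = T" using assms by auto
  ultimately show ?thesis by (simp add: cann_def fsign_def)
qed

text \<open>Double occupancy is also forbidden at the auxiliary site \<open>u\<close>. Both
  operators at \<open>u\<close> are combinations of those at the ends of the bond; when the product
  is expanded, the diagonal terms vanish as double occupancies of the ends, and the mixed terms
  remain with the factor \<open>\<mu>\<^sup>2\<close>.\<close>

lemma finite_energy_triplet:
  assumes "L > 0" "finite_energy L \<mu> ori \<psi>" "b < nbonds L" "\<mu> \<noteq> 0"
  shows "cann (mode (bfst L ori b) True) (cann (mode (bsnd L ori b) False) \<psi>) T
    + cann (mode (bsnd L ori b) True) (cann (mode (bfst L ori b) False) \<psi>) T = 0"
proof -
  let ?x = "bfst L ori b" and ?y = "bsnd L ori b" and ?u = "usite L b"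
  have d: "cann (mode ?x True) (cann (mode ?x False) \<psi>) = (\<lambda>T. 0)"
     "cann (mode ?y True) (cann (mode ?y False) \<psi>) = (\<lambda>T. 0)"
     "cann (mode ?u True) (cann (mode ?u False) \<psi>) = (\<lambda>T. 0)"
    using assms(2) site_less(2)[OF assms(3)] site_less(1)[OF bond_less(1)[OF assms(1,3)]] site_less(1)[OF bond_less(2)[OF assms(1,3)]]
    unfolding finite_energy_def by auto
  have "0 = cann (mode ?u True) (cann (mode ?u False) \<psi>) T" by (simp add: d(3))
  also have "\<dots> = of_real \<mu> * (cann (mode ?x True) (cann (mode ?u False) \<psi>) T + cann (mode ?y True) (cann (mode ?u False) \<psi>) T)"
    using finite_energy_cu(1)[OF assms(1) finite_energy_cann[OF assms(2)] assms(3)] by simp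
  also have "\<dots> = of_real \<mu> * of_real \<mu> * (cann (mode ?x True) (cann (mode ?y False) \<psi>) T + cann (mode ?y True) (cann (mode ?x False) \<psi>) T)"
    unfolding finite_energy_cu(1)[OF assms(1-3)] fock_lin d by (simp add: algebra_simps)
  finally show ?thesis using assms(4) by simp
qed

lemma fsign_mode:
  assumes "mode z True \<notin> R"
  shows "fsign R (mode z \<sigma>) = fsign R (mode z \<sigma>')"
proof -
  have "fsign R (mode z False) = fsign R (mode z True)"
  proof -
    have "{i\<in>R. i < 2*z} = {i\<in>R. i < Suc (2*z)}" using assms by (auto simp: less_Suc_eq mode_def)
    then show ?thesis by (simp add: fsign_def mode_def)
  qed
  then show ?thesis by (cases \<sigma>; cases \<sigma>') simp_all
qed

lemma finite_energy_swap_bond: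
  assumes "L > 0" "finite_energy L \<mu> ori \<psi>" "b < nbonds L" "\<mu> \<noteq> 0"
  defines "x \<equiv> bfst L ori b" and "y \<equiv> bsnd L ori b"
  assumes "x \<noteq> y" "mode x True \<notin> R" "mode x False \<notin> R" "mode y True \<notin> R" "mode y False \<notin> R"
  shows "\<psi> (insert (mode x True) (insert (mode y False) R)) = \<psi> (insert (mode y True) (insert (mode x False) R))"
proof -
  have "cann (mode x True) (cann (mode y False) \<psi>) R + cann (mode y True) (cann (mode x False) \<psi>) R = 0"
    unfolding x_def y_def by (rule finite_energy_triplet[OF assms(1-4)])
  \<comment> \<open>Modes of different sites are ordered like the sites, whatever the spins, so
    exactly one of the two products acquires a minus sign. This turns the vanishing sum into an
    equality of amplitudes.\<close>
  moreover have "mode x True < mode y False \<longleftrightarrow> x < y" "mode y True < mode x False \<longleftrightarrow> y < x"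
    using \<open>x \<noteq> y\<close> by (auto simp: mode_def)
  ultimately have "fsign R (mode x True) * (fsign R (mode y True) *
     ((if x < y then -1 else 1) * \<psi> (insert (mode y False) (insert (mode x True) R)) + (if y < x then -1 else 1) * \<psi> (insert (mode x False) (insert (mode y True) R)))) = 0"
    using assms(7-) fsign_mode[of x R False True] fsign_mode[of y R False True]
    by (auto simp: cann_def fsign_insert algebra_simps split: if_splits)
  moreover have "fsign R j \<noteq> 0" for j using fsign_mult_self(1)[of R j] by (metis mult_zero_left zero_neq_one)
  ultimately show ?thesis using \<open>x \<noteq> y\<close> by (cases "x < y") (auto simp: insert_commute)
qed

lemma ne_state_cann:
  assumes "ne_state L (Suc N) \<psi>"
  shows "ne_state L N (cann j \<psi>)"
  unfolding ne_state_def
proof (intro allI impI)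
  fix T assume "cann j \<psi> T \<noteq> 0"
  then have T: "j \<notin> T" "\<psi> (insert j T) \<noteq> 0" by (auto simp: cann_def split: if_splits)
  then have s: "insert j T \<subseteq> {..<nmodes L}" "card (insert j T) = Suc N" using assms unfolding ne_state_def by blast+
  from s(1) have "finite (insert j T)" by (rule finite_subset) simp
  with s T(1) show "T \<subseteq> {..<nmodes L} \<and> card T = N" by auto
qed

lemma nsites_split: "(\<Sum>z<nsites L. f z) = (\<Sum>x<L\<^sup>2. f x) + (\<Sum>b<nbonds L. f (usite L b) + f (ubsite L b) :: 'a::comm_monoid_add)"
proof -
  let ?n = "L\<^sup>2"
  have "(\<Sum>z<nsites L. f z) = (\<Sum>x<?n. f x) + ((\<Sum>z\<in>{?n..<4*?n}. f z) + (\<Sum>z\<in>{4*?n..<7*?n}. f z))"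
    unfolding nsites_def lessThan_atLeast0 by (simp add: sum.atLeastLessThan_concat)
  also have "(\<Sum>z\<in>{?n..<4*?n}. f z) = (\<Sum>b<nbonds L. f (usite L b))"
    by (rule sum.reindex_bij_witness[where i="usite L" and j="\<lambda>z. z - ?n"]) (auto simp: usite_def nbonds_def)
  also have "(\<Sum>z\<in>{4*?n..<7*?n}. f z) = (\<Sum>b<nbonds L. f (ubsite L b))"
    by (rule sum.reindex_bij_witness[where i="ubsite L" and j="\<lambda>z. z - 4*?n"]) (auto simp: ubsite_def nbonds_def)
  finally show ?thesis by (simp add: sum.distrib)
qed

text \<open>Each pair of auxiliary sites contributes \<open>2 \<mu>\<^sup>2\<close> times the weights of the two end points of its
  bond, so restricting to the sites of the triangular lattice is an isometry up to a constant.\<close>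

lemma finite_energy_ip:
  assumes "L > 0" "finite_energy L \<mu> ori \<phi>" "finite_energy L \<mu> ori \<psi>" "ne_state L N \<phi>" "ne_state L N \<psi>"
  shows "ip (nmodes L) \<phi> \<psi> = of_real (kappa \<mu> ^ (2 * N)) * ip (2 * L\<^sup>2) \<phi> \<psi>"
  using assms(2-)
proof (induction N arbitrary: \<phi> \<psi>)
  case 0
  have *: "\<phi> T = 0" if "T \<noteq> {}" for T
  proof (rule ccontr)
    assume "\<phi> T \<noteq> 0"
    with 0 have T: "T \<subseteq> {..<nmodes L}" "card T = 0" unfolding ne_state_def by blast+
    have "finite T" by (rule finite_subset[OF T(1)]) simp
    with T that show False by simp
  qed
  have "ip m \<phi> \<psi> = cnj (\<phi> {}) * \<psi> {}" for m
    unfolding ip_def by (subst sum.mono_neutral_right[of _ "{{}}"]) (auto simp: *)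
  then show ?case by simp
next
  case (Suc N)
  let ?k = "kappa \<mu>" and ?I = "ip (nmodes L)"
  have pn: "card T = Suc N" if "\<phi> T \<noteq> 0" for T using Suc.prems that unfolding ne_state_def by blast
  have IH: "?I (cann j \<phi>) (cann j \<psi>) = of_real (?k ^ (2 * N)) * ip (2 * L\<^sup>2) (cann j \<phi>) (cann j \<psi>)" for j
    using Suc.prems by (intro Suc.IH finite_energy_cann ne_state_cann)
  have bond: "?I (cann (mode (usite L b) \<sigma>) \<phi>) (cann (mode (usite L b) \<sigma>) \<psi>)
      + ?I (cann (mode (ubsite L b) \<sigma>) \<phi>) (cann (mode (ubsite L b) \<sigma>) \<psi>)
    = 2 * (of_real \<mu>)\<^sup>2 * (?I (cann (mode (bfst L ori b) \<sigma>) \<phi>) (cann (mode (bfst L ori b) \<sigma>) \<psi>)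
       + ?I (cann (mode (bsnd L ori b) \<sigma>) \<phi>) (cann (mode (bsnd L ori b) \<sigma>) \<psi>))" if "b < nbonds L" for b \<sigma>
    unfolding finite_energy_cu[OF assms(1) Suc.prems(1) that] finite_energy_cu[OF assms(1) Suc.prems(2) that]
      ip_scale_left ip_scale_right ip_add_left ip_add_right ip_diff_left ip_diff_right
    by (simp add: algebra_simps power2_eq_square)
  \<comment> \<open>Both inner products are recovered from states with one electron removed, here by
    summing over all modes and at the end over the lattice modes only. The bonds turn the first sum
    into \<open>kappa \<mu> ^ 2\<close> times its lattice part, and the induction hypothesis
    supplies the other factors.\<close>
  have "of_nat (Suc N) * ?I \<phi> \<psi> = (\<Sum>j<nmodes L. ?I (cann j \<phi>) (cann j \<psi>))"
    by (rule ip_number[symmetric]) (rule pn)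
  also have "\<dots> = (\<Sum>z<nsites L. \<Sum>\<sigma>\<in>UNIV. ?I (cann (mode z \<sigma>) \<phi>) (cann (mode z \<sigma>) \<psi>))"
    unfolding nmodes_def by (rule sum_mode)
  also have "\<dots> = (\<Sum>\<sigma>\<in>UNIV. (\<Sum>z<nsites L. ?I (cann (mode z \<sigma>) \<phi>) (cann (mode z \<sigma>) \<psi>)))"
    by (rule sum.swap)
  also have "\<dots> = (\<Sum>\<sigma>\<in>UNIV. (\<Sum>x<L\<^sup>2. of_real (?k\<^sup>2) * ?I (cann (mode x \<sigma>) \<phi>) (cann (mode x \<sigma>) \<psi>)))"
  proof (rule sum.cong[OF refl])
    fix \<sigma>
    let ?f = "\<lambda>x. ?I (cann (mode x \<sigma>) \<phi>) (cann (mode x \<sigma>) \<psi>)"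
    have "(\<Sum>z<nsites L. ?f z) = (\<Sum>x<L\<^sup>2. ?f x) + (\<Sum>b<nbonds L. 2 * (of_real \<mu>)\<^sup>2 * (?f (bfst L ori b) + ?f (bsnd L ori b)))"
      unfolding nsites_split by (simp add: bond)
    also have "(\<Sum>b<nbonds L. 2 * (of_real \<mu>)\<^sup>2 * (?f (bfst L ori b) + ?f (bsnd L ori b))) = 12 * (of_real \<mu>)\<^sup>2 * (\<Sum>x<L\<^sup>2. ?f x)"
      unfolding sum_distrib_left[symmetric] sum_bond_ends[OF assms(1), of ?f ori] by simp
    finally show "(\<Sum>z<nsites L. ?f z) = (\<Sum>x<L\<^sup>2. of_real (?k\<^sup>2) * ?f x)"
      unfolding kappa_sq sum_distrib_left[symmetric] by (simp add: algebra_simps)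
  qed
  also have "\<dots> = of_real (?k ^ (2 * Suc N)) * (\<Sum>x<L\<^sup>2. \<Sum>\<sigma>\<in>UNIV. ip (2 * L\<^sup>2) (cann (mode x \<sigma>) \<phi>) (cann (mode x \<sigma>) \<psi>))"
    unfolding IH by (subst sum.swap) (simp add: sum_distrib_left power2_eq_square mult_ac)
  also have "(\<Sum>x<L\<^sup>2. \<Sum>\<sigma>\<in>UNIV. ip (2 * L\<^sup>2) (cann (mode x \<sigma>) \<phi>) (cann (mode x \<sigma>) \<psi>)) = of_nat (Suc N) * ip (2 * L\<^sup>2) \<phi> \<psi>"
    using ip_number[of "2 * L\<^sup>2" \<phi> "Suc N" \<psi>] pn unfolding sum_mode by blast
  finally have "of_nat (Suc N) * ?I \<phi> \<psi> = of_nat (Suc N) * (of_real (?k ^ (2 * Suc N)) * ip (2 * L\<^sup>2) \<phi> \<psi>)"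
    by (simp only: mult_ac)
  then show ?case by (simp only: mult_cancel_left of_nat_eq_0_iff) simp
qed

lemma finite_energy_lform:
  assumes "L > 0" "finite_energy L \<mu> ori \<phi>" "finite_energy L \<mu> ori \<psi>" "ne_state L (Suc N) \<phi>" "ne_state L (Suc N) \<psi>"
    and "x < L\<^sup>2" "y < L\<^sup>2"
  shows "lform L (avec L \<mu> ori x) (avec L \<mu> ori y) \<phi> \<psi> =
    of_real (kappa \<mu> ^ (2 * Suc N)) * (\<Sum>\<sigma>\<in>UNIV. ip (2 * L\<^sup>2) (cann (mode x \<sigma>) \<phi>) (cann (mode y \<sigma>) \<psi>))"
  unfolding lform_def finite_energy_lann_avec[OF assms(1,2,6)] finite_energy_lann_avec[OF assms(1,3,7)] ip_scale_left ip_scale_right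
    finite_energy_ip[OF assms(1) finite_energy_cann[OF assms(2)] finite_energy_cann[OF assms(3)] ne_state_cann[OF assms(4)] ne_state_cann[OF assms(5)]]
  by (simp add: sum_distrib_left power2_eq_square mult_ac)

section \<open>Isoperimetry on the triangular lattice\<close>

lemma card_sum_if: "card {k::nat. k < n \<and> P k} = (\<Sum>k<n. if P k then 1 else 0)"
  by (simp add: sum.If_cases Int_def)

lemma sum_card_swap: "(\<Sum>i<m::nat. card {j::nat. j < n \<and> P i j}) = (\<Sum>j<n. card {i. i < m \<and> P i j})"
  unfolding card_sum_if by (rule sum.swap)

lemma card_even_odd: "card {k::nat. k < 2 * n \<and> P k} = card {j. j < n \<and> P (2 * j)} + card {j. j < n \<and> P (2 * j + 1)}"
  unfolding card_sum_if by (induction n) simp_all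

text \<open>After the last \<open>b\<close> before \<open>q\<close> the next \<open>c\<close> is at
  distance at least three, so the two positions following that \<open>b\<close> belong to neither
  phase.\<close>

lemma chain_gap:
  fixes b c :: "nat \<Rightarrow> bool"
  assumes "\<And>k. b k \<Longrightarrow> \<not> c k \<and> \<not> c (k + 1) \<and> \<not> c (k + 2)" "b p" "c q" "p < q"
  shows "\<exists>k>p. k + 1 < q \<and> \<not> b k \<and> \<not> c k \<and> \<not> b (k + 1) \<and> \<not> c (k + 1)"
proof -
  define p' where "p' = Max {k. k < q \<and> b k}"
  have fin: "finite {k. k < q \<and> b k}" "{k. k < q \<and> b k} \<noteq> {}" using assms(2,4) by auto
  have p': "p' < q" "b p'" using Max_in[OF fin] unfolding p'_def by auto
  have "p \<le> p'" unfolding p'_def by (rule Max_ge[OF fin(1)]) (use assms in auto)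
  have nb: "\<not> b k" if "p' < k" "k < q" for k
  proof
    assume "b k"
    with that have "k \<le> p'" unfolding p'_def by (intro Max_ge[OF fin(1)]) simp
    with that show False by simp
  qed
  have "\<not> c p'" "\<not> c (p' + 1)" "\<not> c (p' + 2)" using assms(1)[OF p'(2)] by auto
  then have "q \<noteq> p' + 1" "q \<noteq> p' + 2" using assms(3) by auto
  then have "p' + 2 < q" using p'(1) by auto
  then show ?thesis using \<open>p \<le> p'\<close> \<open>\<not> c (p' + 1)\<close> \<open>\<not> c (p' + 2)\<close> nb[of "p' + 1"] nb[of "p' + 2"]
    by (intro exI[of _ "p' + 1"]) auto
qed

text \<open>There is one gap on the way from \<open>p\<close> to \<open>q\<close> and another on the
  way from \<open>q\<close> round to \<open>p + P\<close>.\<close>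

lemma cycle_gaps_aux:
  fixes b c :: "nat \<Rightarrow> bool"
  assumes b: "\<And>k. b k \<Longrightarrow> \<not> c k \<and> \<not> c (k + 1) \<and> \<not> c (k + 2)"
    and c: "\<And>k. c k \<Longrightarrow> \<not> b k \<and> \<not> b (k + 1) \<and> \<not> b (k + 2)"
    and per: "\<And>k. b (k + P) = b k" "\<And>k. c (k + P) = c k"
    and pq: "b p" "c q" "p < q" "q < P"
  defines "h \<equiv> \<lambda>k. \<not> b k \<and> \<not> c k"
  shows "2 \<le> card {k. k < P \<and> h k \<and> h (k + 1)}" "3 \<le> card {k. k < P \<and> h k}"
proof -
  obtain k1 where k1: "p < k1" "k1 + 1 < q" "h k1" "h (k1 + 1)"
    using chain_gap[of b c p q, OF b pq(1-3)] unfolding h_def by blast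
  have "b (p + P)" using per pq by simp
  from chain_gap[of c b q "p + P", OF c pq(2) this] pq obtain k2 where k2: "q < k2" "k2 + 1 < p + P" "h k2" "h (k2 + 1)"
    unfolding h_def by auto
  have hper: "h (k + P) = h k" for k using per by (simp add: h_def)
  \<comment> \<open>The second gap may start beyond the end of the period; its start is moved back
    into \<open>{..<P}\<close>, where it lies before \<open>p\<close> or after \<open>q\<close> and
    so differs from both positions of the first gap.\<close>
  define k3 where "k3 = (if k2 < P then k2 else k2 - P)"
  have k3: "k3 < P" "h k3" "h (k3 + 1)" "k3 < p \<or> q < k3"
    using k2 pq hper[of "k2 - P"] hper[of "k2 - P + 1"] by (auto simp: k3_def)
  have "card {k1, k3} \<le> card {k. k < P \<and> h k \<and> h (k + 1)}"
    using k1 k3 pq by (intro card_mono) auto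
  then show "2 \<le> card {k. k < P \<and> h k \<and> h (k + 1)}" using k1 k3 by auto
  have "card {k1, k1 + 1, k3} \<le> card {k. k < P \<and> h k}"
    using k1 k3 pq by (intro card_mono) auto
  then show "3 \<le> card {k. k < P \<and> h k}" using k1 k3 by auto
qed

lemma cycle_gaps:
  fixes b c :: "nat \<Rightarrow> bool"
  assumes b: "\<And>k. b k \<Longrightarrow> \<not> c k \<and> \<not> c (k + 1) \<and> \<not> c (k + 2)"
    and c: "\<And>k. c k \<Longrightarrow> \<not> b k \<and> \<not> b (k + 1) \<and> \<not> b (k + 2)"
    and per: "\<And>k. b (k + P) = b k" "\<And>k. c (k + P) = c k"
    and pq: "b p" "c q" "p < P" "q < P"
  defines "h \<equiv> \<lambda>k. \<not> b k \<and> \<not> c k"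
  shows "2 \<le> card {k. k < P \<and> h k \<and> h (k + 1)}" "3 \<le> card {k. k < P \<and> h k}"
proof -
  consider "p < q" | "q < p" | "p = q" by linarith
  then have "2 \<le> card {k. k < P \<and> h k \<and> h (k + 1)} \<and> 3 \<le> card {k. k < P \<and> h k}"
  proof cases
    case 1
    then show ?thesis using cycle_gaps_aux[of b c P p q, OF b c per] pq unfolding h_def by blast
  next
    case 2
    have "h = (\<lambda>k. \<not> c k \<and> \<not> b k)" by (auto simp: h_def)
    then show ?thesis using 2 cycle_gaps_aux[of c b P q p, OF c b per(2,1)] pq by auto
  qed (use b pq in auto)
  then show "2 \<le> card {k. k < P \<and> h k \<and> h (k + 1)}" "3 \<le> card {k. k < P \<and> h k}" by auto
qed

text \<open>The site \<open>(i, j)\<close> has the neighbours \<open>(i \<plusminus> 1, j)\<close>, \<open>(i, j \<plusminus> 1)\<close> and \<open>(i \<plusminus> 1, j \<mp> 1)\<close>; indices are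
  periodic rather than bounded.\<close>

locale two_phase =
  fixes L :: nat and B C :: "nat \<Rightarrow> nat \<Rightarrow> bool"
  assumes L3: "L \<ge> 3"
    and per: "B (i + L) j = B i j" "B i (j + L) = B i j" "C (i + L) j = C i j" "C i (j + L) = C i j"
    and disj: "\<not> (B i j \<and> C i j)"
    and sep: "\<not> (B i j \<and> C (Suc i) j)" "\<not> (C i j \<and> B (Suc i) j)"
      "\<not> (B i j \<and> C i (Suc j))" "\<not> (C i j \<and> B i (Suc j))"
      "\<not> (B i (Suc j) \<and> C (Suc i) j)" "\<not> (C i (Suc j) \<and> B (Suc i) j)"
begin

definition "hole i j \<longleftrightarrow> \<not> B i j \<and> \<not> C i j"
definition "nhole = (\<Sum>i<L. card {j. j < L \<and> hole i j})"
definition "edges0 = (\<Sum>i<L. card {j. j < L \<and> hole i j \<and> hole (Suc i) j})"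
definition "edges1 = (\<Sum>i<L. card {j. j < L \<and> hole i j \<and> hole i (Suc j)})"
text \<open>The third direction is based at \<open>(i, Suc j)\<close>, so that its other end
  \<open>(Suc i, j)\<close> is reached without subtraction and the bond lies in the strip between
  rows \<open>i\<close> and \<open>Suc i\<close>.\<close>

definition "edges2 = (\<Sum>i<L. card {j. j < L \<and> hole i (Suc j) \<and> hole (Suc i) j})"
definition "nhh = edges0 + edges1 + edges2"
definition "rowB i \<longleftrightarrow> (\<exists>j<L. B i j)"
definition "rowC i \<longleftrightarrow> (\<exists>j<L. C i j)"
definition "rowholes i = card {j. j < L \<and> hole i j}"
definition "mixed_rows = card {i. i < L \<and> rowB i \<and> rowC i}"

text \<open>Exchanging the coordinates swaps the first two bond directions and reverses the third,
  so every statement on rows holds for columns.\<close>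

lemma transpose: "two_phase L (\<lambda>i j. B j i) (\<lambda>i j. C j i)"
proof -
  have c: "\<not> (C i j \<and> B i j)" "\<not> (B (Suc i) j \<and> C i (Suc j))" "\<not> (C (Suc i) j \<and> B i (Suc j))" for i j
    using disj[of i j] sep(5,6)[of i j] by blast+
  show ?thesis by (rule two_phase.intro) (rule L3 per disj sep c)+
qed

lemma swap: "two_phase L C B"
proof -
  have c: "\<not> (C i j \<and> B i j)" "\<not> (B (Suc i) j \<and> C i (Suc j))" "\<not> (C (Suc i) j \<and> B i (Suc j))" for i j
    using disj[of i j] sep(5,6)[of i j] by blast+
  show ?thesis by (rule two_phase.intro) (rule L3 per disj sep c)+
qed

text \<open>Along the zigzag through two adjacent rows, consecutive and second consecutive sites are
  neighbours, so each change of phase needs two consecutive holes.\<close>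

lemma strip:
  assumes "rowB i \<or> rowB (Suc i)" "rowC i \<or> rowC (Suc i)"
  shows "2 \<le> card {j. j < L \<and> hole i j \<and> hole (Suc i) j} + card {j. j < L \<and> hole i (Suc j) \<and> hole (Suc i) j}"
    "3 \<le> rowholes i + rowholes (Suc i)"
proof -
  \<comment> \<open>Even positions of the zigzag lie in row \<open>i\<close>, odd ones in row
    \<open>Suc i\<close>. Single steps are bonds between the rows, double steps are bonds within a
    row.\<close>
  define b where "b k = B (i + k mod 2) (k div 2)" for k
  define c where "c k = C (i + k mod 2) (k div 2)" for k
  have ev: "b (2 * j) = B i j" "c (2 * j) = C i j" "b (2 * j + 1) = B (Suc i) j" "c (2 * j + 1) = C (Suc i) j" for j
    by (simp_all add: b_def c_def)
  have ev2: "b (2 * j + 2) = B i (Suc j)" "c (2 * j + 2) = C i (Suc j)" "b (2 * j + 3) = B (Suc i) (Suc j)" "c (2 * j + 3) = C (Suc i) (Suc j)" for j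
    using ev[of "Suc j"] by (simp_all add: numeral_eq_Suc)
  have split: "(\<exists>j. k = 2 * j) \<or> (\<exists>j. k = 2 * j + 1)" for k :: nat by presburger
  have e: "2 * j + 1 + 1 = 2 * j + 2" "2 * j + 1 + 2 = 2 * j + 3" for j :: nat by simp_all
  have 1: "\<not> c k \<and> \<not> c (k + 1) \<and> \<not> c (k + 2)" if "b k" for k
    using split[of k] that
  proof (elim disjE exE)
    fix j assume "k = 2 * j"
    then show ?thesis using that disj[of i j] sep(1)[of i j] sep(3)[of i j] unfolding \<open>k = 2 * j\<close> ev ev2 by blast
  next
    fix j assume "k = 2 * j + 1"
    then show ?thesis using that disj[of "Suc i" j] sep(6)[of i j] sep(3)[of "Suc i" j] unfolding \<open>k = 2 * j + 1\<close> e ev ev2 by blast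
  qed
  have 2: "\<not> b k \<and> \<not> b (k + 1) \<and> \<not> b (k + 2)" if "c k" for k
    using split[of k] that
  proof (elim disjE exE)
    fix j assume "k = 2 * j"
    then show ?thesis using that disj[of i j] sep(2)[of i j] sep(4)[of i j] unfolding \<open>k = 2 * j\<close> ev ev2 by blast
  next
    fix j assume "k = 2 * j + 1"
    then show ?thesis using that disj[of "Suc i" j] sep(5)[of i j] sep(4)[of "Suc i" j] unfolding \<open>k = 2 * j + 1\<close> e ev ev2 by blast
  qed
  have 3: "b (k + 2 * L) = b k" "c (k + 2 * L) = c k" for k
  proof -
    have "(k + 2 * L) mod 2 = k mod 2" "(k + 2 * L) div 2 = k div 2 + L" by simp_all
    then show "b (k + 2 * L) = b k" "c (k + 2 * L) = c k" unfolding b_def c_def by (simp_all only: per)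
  qed
  have "\<exists>p<2*L. b p"
  proof -
    from assms(1) obtain j where "j < L" "B i j \<or> B (Suc i) j" unfolding rowB_def by blast
    then have "2*j<2*L" "2*j+1<2*L" "b (2*j) \<or> b (2*j+1)" unfolding ev by auto
    then show ?thesis by blast
  qed
  then obtain p where p: "b p" "p < 2 * L" by blast
  have "\<exists>q<2*L. c q"
  proof -
    from assms(2) obtain j where "j < L" "C i j \<or> C (Suc i) j" unfolding rowC_def by blast
    then have "2*j<2*L" "2*j+1<2*L" "c (2*j) \<or> c (2*j+1)" unfolding ev by auto
    then show ?thesis by blast
  qed
  then obtain q where q: "c q" "q < 2 * L" by blast
  note cg = cycle_gaps[of b c "2*L" p q, OF 1 2 3 p(1) q(1) p(2) q(2)]
  have s: "hole i j \<longleftrightarrow> \<not> b (2 * j) \<and> \<not> c (2 * j)" "hole (Suc i) j \<longleftrightarrow> \<not> b (2 * j + 1) \<and> \<not> c (2 * j + 1)"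
    "hole i (Suc j) \<longleftrightarrow> \<not> b (2 * j + 2) \<and> \<not> c (2 * j + 2)" for j
    unfolding ev ev2 hole_def by auto
  have "{j. j < L \<and> hole i (Suc j) \<and> hole (Suc i) j} = {j. j < L \<and> hole (Suc i) j \<and> hole i (Suc j)}" by blast
  then show "2 \<le> card {j. j < L \<and> hole i j \<and> hole (Suc i) j} + card {j. j < L \<and> hole i (Suc j) \<and> hole (Suc i) j}"
    using cg(1) unfolding card_even_odd s e by simp
  show "3 \<le> rowholes i + rowholes (Suc i)"
    using cg(2) unfolding card_even_odd rowholes_def s by simp
qed

lemma rowholes_per: "rowholes (i + L) = rowholes i"
  unfolding rowholes_def hole_def per ..

lemma row_per: "rowB (i + L) = rowB i" "rowC (i + L) = rowC i"
  unfolding rowB_def rowC_def per by auto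

lemma two_rows: "i < L \<Longrightarrow> rowholes i + rowholes (Suc i) \<le> nhole"
proof -
  assume i: "i < L"
  define i' where "i' = (if Suc i < L then Suc i else 0)"
  have "rowholes (Suc i) = rowholes i'"
  proof (cases "Suc i < L")
    case False
    then have "Suc i = 0 + L" using i by simp
    then show ?thesis using False unfolding i'_def by (simp only: rowholes_per if_False)
  qed (simp add: i'_def)
  moreover have "i \<noteq> i'" "i' < L" using i L3 by (auto simp: i'_def)
  moreover have "(\<Sum>k\<in>{i, i'}. rowholes k) \<le> nhole"
    unfolding nhole_def rowholes_def[symmetric] using i \<open>i' < L\<close> by (intro sum_mono2) auto
  ultimately show ?thesis by simp
qed

lemma one_strip: "i < L \<Longrightarrow> card {j. j < L \<and> hole i j \<and> hole (Suc i) j} + card {j. j < L \<and> hole i (Suc j) \<and> hole (Suc i) j} \<le> nhh"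
proof -
  assume i: "i < L"
  have "card {j. j < L \<and> hole i j \<and> hole (Suc i) j} \<le> edges0" unfolding edges0_def using i by (intro member_le_sum) auto
  moreover have "card {j. j < L \<and> hole i (Suc j) \<and> hole (Suc i) j} \<le> edges2" unfolding edges2_def using i
    by (intro member_le_sum[where f="\<lambda>i. card {j. j < L \<and> hole i (Suc j) \<and> hole (Suc i) j}"]) auto
  ultimately show ?thesis by (simp add: nhh_def)
qed

text \<open>If two adjacent rows contain both phases, their strip suffices. Otherwise a row
  consisting of holes has \<open>L \<ge> 3\<close> holes and as many bonds between them. Without
  such a row the phase could not change from one row to the next, so going once around the torus
  excludes the second phase.\<close>

lemma nontrivial:
  assumes "i0 < L" "j0 < L" "B i0 j0" "i1 < L" "j1 < L" "C i1 j1"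
  shows "2 \<le> nhh" "3 \<le> nhole"
proof -
  have "2 \<le> nhh \<and> 3 \<le> nhole"
  proof (cases "\<exists>i<L. (rowB i \<or> rowB (Suc i)) \<and> (rowC i \<or> rowC (Suc i))")
    case True
    then obtain i where i: "i < L" "rowB i \<or> rowB (Suc i)" "rowC i \<or> rowC (Suc i)" by blast
    show ?thesis using strip[OF i(2,3)] one_strip[OF i(1)] two_rows[OF i(1)] by linarith
  next
    case False
    show ?thesis
    proof (cases "\<exists>i<L. \<not> rowB i \<and> \<not> rowC i")
      case True
      then obtain i where i: "i < L" "\<And>j. j < L \<Longrightarrow> hole i j" unfolding rowB_def rowC_def hole_def by blast
      have all: "hole i (Suc j)" if "j < L" for j
      proof (cases "Suc j < L")
        case True then show ?thesis using i by blast
      next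
        case False
        then have "Suc j = 0 + L" using that by simp
        then have "hole i (Suc j) = hole i 0" unfolding hole_def by (simp only: per)
        then show ?thesis using i that by auto
      qed
      have s1: "{j. j < L \<and> hole i j} = {..<L}" "{j. j < L \<and> hole i j \<and> hole i (Suc j)} = {..<L}"
        using i all by auto
      have "card {j. j < L \<and> hole i j} \<le> nhole" unfolding nhole_def using i by (intro member_le_sum) auto
      moreover have "card {j. j < L \<and> hole i j \<and> hole i (Suc j)} \<le> edges1" unfolding edges1_def using i
        by (intro member_le_sum[where f="\<lambda>i. card {j. j < L \<and> hole i j \<and> hole i (Suc j)}"]) auto
      ultimately show ?thesis unfolding s1 using L3 by (simp add: nhh_def)
    next
      case F2: False
      have step: "rowB (Suc i)" if "rowB i" "i < L" for i
      proof (rule ccontr)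
        assume nB: "\<not> rowB (Suc i)"
        have "rowB (Suc i) \<or> rowC (Suc i)"
        proof (cases "Suc i < L")
          case True then show ?thesis using F2 by blast
        next
          case False
          then have "Suc i = 0 + L" using that by simp
          then show ?thesis using F2 L3 row_per[of 0] by auto
        qed
        then show False using nB that False by blast
      qed
      have "rowB i0" using assms unfolding rowB_def by blast
      have up: "rowB i" if "i0 \<le> i" "i \<le> L" for i
        using that
      proof (induction rule: dec_induct)
        case base show ?case by fact
      next
        case (step n) then show ?case using \<open>\<And>i. rowB i \<Longrightarrow> i < L \<Longrightarrow> rowB (Suc i)\<close> by simp
      qed
      have "rowB (0 + L)" using up[of L] assms(1) by simp
      then have "rowB 0" unfolding row_per .
      have "rowB i" if "i < L" for i using that
        by (induction i) (use \<open>rowB 0\<close> step in auto)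
      then have "rowB i1" using assms by blast
      moreover have "rowC i1" using assms unfolding rowC_def by blast
      ultimately show ?thesis using False assms by blast
    qed
  qed
  then show "2 \<le> nhh" "3 \<le> nhole" by auto
qed

text \<open>Each mixed row is charged with the strip above it, and different strips contain
  different bonds.\<close>

lemma mixed_rows_le: "2 * mixed_rows \<le> nhh"
proof -
  let ?M = "{i. i < L \<and> rowB i \<and> rowC i}"
  let ?f = "\<lambda>i. card {j. j < L \<and> hole i j \<and> hole (Suc i) j} + card {j. j < L \<and> hole i (Suc j) \<and> hole (Suc i) j}"
  have "2 * mixed_rows = (\<Sum>i\<in>?M. 2)" by (simp add: mixed_rows_def)
  also have "\<dots> \<le> (\<Sum>i\<in>?M. ?f i)" by (rule sum_mono) (use strip(1) in blast)
  also have "\<dots> \<le> (\<Sum>i<L. ?f i)" by (rule sum_mono2) auto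
  also have "\<dots> \<le> nhh" by (simp add: sum.distrib nhh_def edges0_def edges2_def)
  finally show ?thesis .
qed

text \<open>With the threshold \<open>L / 3\<close>, two rows that are not bad leave at least a
  third of the columns free of holes in both rows.\<close>

definition "bad_rows = {i. i < L \<and> L < 3 * rowholes i}"

lemma bad_rows_le: "real (card bad_rows) \<le> 3 * real nhole / real L"
proof -
  have "L * card bad_rows = (\<Sum>i\<in>bad_rows. L)" by simp
  also have "\<dots> \<le> (\<Sum>i\<in>bad_rows. 3 * rowholes i)" by (rule sum_mono) (auto simp: bad_rows_def)
  also have "\<dots> \<le> (\<Sum>i<L. 3 * rowholes i)" by (rule sum_mono2) (auto simp: bad_rows_def)
  also have "\<dots> = 3 * nhole" by (simp add: nhole_def rowholes_def sum_distrib_left)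
  finally have "real (L * card bad_rows) \<le> real (3 * nhole)" by (rule of_nat_mono)
  then show ?thesis using L3 by (simp add: field_simps)
qed

lemma fin_rows [simp]: "finite bad_rows" by (simp add: bad_rows_def)

end

section \<open>Area bound for one of the two phases\<close>

lemma card_three_cover:
  assumes "\<And>j. j < L \<Longrightarrow> P j \<or> Q j \<or> R j"
  shows "L \<le> card {j. j < L \<and> P j} + card {j. j < L \<and> Q j} + card {j. j < (L::nat) \<and> R j}"
proof -
  have "card {..<L} \<le> card (({j. j < L \<and> P j} \<union> {j. j < L \<and> Q j}) \<union> {j. j < L \<and> R j})"
    using assms by (intro card_mono) auto
  also have "\<dots> \<le> card {j. j < L \<and> P j} + card {j. j < L \<and> Q j} + card {j. j < L \<and> R j}"
    by (rule order_trans[OF card_Un_le]) (intro add_mono card_Un_le order_refl)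
  finally show ?thesis by simp
qed

lemma pairs_le_product:
  assumes "\<And>i j. i < L \<Longrightarrow> j < L \<Longrightarrow> P i j \<Longrightarrow> i \<in> R \<and> j \<in> K" "finite R" "finite K"
  shows "(\<Sum>i<L. card {j. j < (L::nat) \<and> P i j}) \<le> card R * card K"
proof -
  have "(\<Sum>i<L. card {j. j < L \<and> P i j}) = (\<Sum>i\<in>{..<L} \<inter> R. card {j. j < L \<and> P i j})"
    using assms by (intro sum.mono_neutral_right) auto
  also have "\<dots> \<le> (\<Sum>i\<in>{..<L} \<inter> R. card K)"
    using assms by (intro sum_mono card_mono) auto
  also have "\<dots> \<le> card R * card K"
    using assms(2) by (simp add: card_mono)
  finally show ?thesis .
qed

context two_phase
begin

interpretation T: two_phase L "\<lambda>i j. B j i" "\<lambda>i j. C j i" by (rule transpose)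

lemma T_hole: "T.hole i j = hole j i" by (simp add: T.hole_def hole_def)

lemma T_nhole: "T.nhole = nhole" unfolding T.nhole_def nhole_def T_hole by (rule sum_card_swap)

lemma T_nhh: "T.nhh = nhh"
proof -
  have "T.edges0 = edges1" unfolding T.edges0_def edges1_def T_hole by (rule sum_card_swap)
  moreover have "T.edges1 = edges0" unfolding T.edges1_def edges0_def T_hole by (rule sum_card_swap)
  moreover have "T.edges2 = edges2" unfolding T.edges2_def edges2_def T_hole
    by (subst sum_card_swap) (simp add: conj_commute)
  ultimately show ?thesis by (simp add: T.nhh_def nhh_def)
qed

text \<open>A row with few holes that meets only one phase and a row with few holes that meets only
  the other one produce many mixed columns.\<close>

lemma isoperimetric_aux:
  assumes m: "real nhh / 2 \<le> m" and r: "3 * real nhole / real L \<le> r"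
    and less: "m < real L / 3" "m + r < 2 * real L / 3"
    and C: "\<And>i. i < L \<Longrightarrow> i \<notin> bad_rows \<Longrightarrow> rowC i"
  shows "real (\<Sum>i<L. card {j. j < L \<and> B i j}) \<le> (m + r)\<^sup>2"
proof -
  have bad: "real (card bad_rows) \<le> r" "real (card T.bad_rows) \<le> r"
    using bad_rows_le T.bad_rows_le r unfolding T_nhole by linarith+
  have mix: "real mixed_rows \<le> m" "real T.mixed_rows \<le> m"
    using mixed_rows_le T.mixed_rows_le m unfolding T_nhh by linarith+
  \<comment> \<open>Otherwise all rows would be mixed or bad, which gives
    \<open>L \<le> m + r\<close>.\<close>
  have "\<exists>q<L. q \<notin> bad_rows \<and> \<not> rowB q"
  proof (rule ccontr)
    assume "\<not> ?thesis"
    then have "L \<le> card {i. i < L \<and> (rowB i \<and> rowC i)} + card {i. i < L \<and> i \<in> bad_rows} + card {i. i < L \<and> False}"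
      using C by (intro card_three_cover) blast
    also have "{i. i < L \<and> i \<in> bad_rows} = bad_rows" by (auto simp: bad_rows_def)
    finally have "real L \<le> real mixed_rows + real (card bad_rows)" unfolding mixed_rows_def by simp
    with mix bad less show False by linarith
  qed
  then obtain q where q: "q < L" "q \<notin> bad_rows" "\<not> rowB q" by blast
  have qh: "3 * rowholes q \<le> L" using q by (auto simp: bad_rows_def)
  have colC: "T.rowC j" if "j < L" "\<not> hole q j" for j
    using that q unfolding T.rowC_def rowB_def hole_def by blast
  \<comment> \<open>Suppose column \<open>j\<close> misses \<open>C\<close>. If every good column
    meets \<open>B\<close>, then each column is mixed, bad, or has a hole in row \<open>q\<close>,
    since row \<open>q\<close> misses \<open>B\<close>. If a good column \<open>p\<close> misses
    \<open>B\<close>, then each row is mixed or has a hole in column \<open>j\<close> or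
    \<open>p\<close>. Both covers are too small.\<close>
  have Tgood: "T.rowC j" if "j < L" "j \<notin> T.bad_rows" for j
  proof (rule ccontr)
    assume nC: "\<not> T.rowC j"
    have jh: "3 * T.rowholes j \<le> L" using that by (auto simp: T.bad_rows_def)
    show False
    proof (cases "\<exists>p<L. p \<notin> T.bad_rows \<and> \<not> T.rowB p")
      case False
      have "L \<le> card {k. k < L \<and> (T.rowB k \<and> T.rowC k)} + card {k. k < L \<and> k \<in> T.bad_rows} + card {k. k < L \<and> hole q k}"
        using False colC by (intro card_three_cover) blast
      also have "{i. i < L \<and> i \<in> T.bad_rows} = T.bad_rows" by (auto simp: T.bad_rows_def)
      finally have "real L \<le> real T.mixed_rows + real (card T.bad_rows) + real (rowholes q)"
        unfolding T.mixed_rows_def rowholes_def by simp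
      with qh mix bad less show False by linarith
    next
      case True
      then obtain p where p: "p < L" "p \<notin> T.bad_rows" "\<not> T.rowB p" by blast
      have ph: "3 * T.rowholes p \<le> L" using p by (auto simp: T.bad_rows_def)
      have "rowB k \<and> rowC k \<or> T.hole j k \<or> T.hole p k" if "k < L" for k
        using that p nC \<open>j < L\<close> unfolding rowB_def rowC_def T.rowB_def T.rowC_def T.hole_def by blast
      then have "L \<le> card {k. k < L \<and> (rowB k \<and> rowC k)} + card {k. k < L \<and> T.hole j k} + card {k. k < L \<and> T.hole p k}"
        by (intro card_three_cover)
      then have "real L \<le> real mixed_rows + real (T.rowholes j) + real (T.rowholes p)"
        unfolding mixed_rows_def T.rowholes_def by simp
      with ph jh mix less show False by linarith
    qed
  qed
  \<comment> \<open>A site of \<open>B\<close> in a good row lies in a mixed row, because good rows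
    meet \<open>C\<close>; the same holds for columns. Hence \<open>B\<close> lies in a product of
    two small sets.\<close>
  have "(\<Sum>i<L. card {j. j < L \<and> B i j}) \<le> card ({i. i < L \<and> rowB i \<and> rowC i} \<union> bad_rows) * card ({i. i < L \<and> T.rowB i \<and> T.rowC i} \<union> T.bad_rows)"
  proof (rule pairs_le_product)
    fix i j assume "i < L" "j < L" "B i j"
    then have "rowB i" "T.rowB j" unfolding rowB_def T.rowB_def by blast+
    then show "i \<in> {i. i < L \<and> rowB i \<and> rowC i} \<union> bad_rows \<and> j \<in> {i. i < L \<and> T.rowB i \<and> T.rowC i} \<union> T.bad_rows"
      using C Tgood \<open>i < L\<close> \<open>j < L\<close> by blast
  qed auto
  also have "\<dots> \<le> (mixed_rows + card bad_rows) * (T.mixed_rows + card T.bad_rows)"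
    unfolding mixed_rows_def T.mixed_rows_def by (intro mult_mono card_Un_le) auto
  finally have "real (\<Sum>i<L. card {j. j < L \<and> B i j}) \<le> (real mixed_rows + real (card bad_rows)) * (real T.mixed_rows + real (card T.bad_rows))"
    unfolding of_nat_add[symmetric] of_nat_mult[symmetric] of_nat_le_iff .
  also have "\<dots> \<le> (m + r) * (m + r)"
    using mix bad by (intro mult_mono add_mono) auto
  finally show ?thesis by (simp add: power2_eq_square)
qed

text \<open>A good row without \<open>C\<close> and a good row without \<open>B\<close> would force
  at least \<open>L / 3\<close> mixed columns. Hence one phase meets all good rows, and the area of
  the other one is bounded.\<close>

lemma isoperimetric:
  assumes m: "real nhh / 2 \<le> m" and r: "3 * real nhole / real L \<le> r"
    and less: "m < real L / 3" "m + r < 2 * real L / 3"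
  shows "real (\<Sum>i<L. card {j. j < L \<and> B i j}) \<le> (m + r)\<^sup>2 \<or> real (\<Sum>i<L. card {j. j < L \<and> C i j}) \<le> (m + r)\<^sup>2"
proof (cases "\<forall>i<L. i \<notin> bad_rows \<longrightarrow> rowC i")
  case True
  then show ?thesis using isoperimetric_aux[OF m r less] by blast
next
  case False
  then obtain p where p: "p < L" "p \<notin> bad_rows" "\<not> rowC p" by blast
  interpret S: two_phase L C B by (rule swap)
  have h: "S.hole = hole" by (intro ext) (auto simp: S.hole_def hole_def)
  have rh: "S.rowholes = rowholes" unfolding S.rowholes_def rowholes_def h ..
  have bad: "S.bad_rows = bad_rows" unfolding S.bad_rows_def bad_rows_def rh ..
  have n: "S.nhh = nhh" "S.nhole = nhole"
    unfolding S.nhh_def nhh_def S.nhole_def nhole_def S.edges0_def edges0_def S.edges1_def edges1_def S.edges2_def edges2_def h by simp_all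
  have "rowB q" if q: "q < L" "q \<notin> bad_rows" for q
  proof (rule ccontr)
    assume nB: "\<not> rowB q"
    have ph: "3 * rowholes p \<le> L" "3 * rowholes q \<le> L" using p q by (auto simp: bad_rows_def)
    have "T.rowB k \<and> T.rowC k \<or> hole p k \<or> hole q k" if "k < L" for k
      using that p q nB unfolding rowB_def rowC_def T.rowB_def T.rowC_def hole_def by blast
    then have "L \<le> card {k. k < L \<and> (T.rowB k \<and> T.rowC k)} + card {k. k < L \<and> hole p k} + card {k. k < L \<and> hole q k}"
      by (intro card_three_cover)
    then have "real L \<le> real T.mixed_rows + real (rowholes p) + real (rowholes q)"
      unfolding T.mixed_rows_def rowholes_def by simp
    moreover have "real T.mixed_rows \<le> m" using T.mixed_rows_le m unfolding T_nhh by linarith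
    ultimately show False using ph less by linarith
  qed
  then show ?thesis using S.isoperimetric_aux[of m r] m r less unfolding n bad
    by (simp add: S.rowC_def rowB_def)
qed

end

section \<open>Clusters of occupied sites as phases on the torus\<close>

definition adj :: "nat \<Rightarrow> nat \<Rightarrow> nat \<Rightarrow> bool" where
  "adj L x y \<longleftrightarrow> x < L\<^sup>2 \<and> (\<exists>d<3. y = nbr L x d) \<or> y < L\<^sup>2 \<and> (\<exists>d<3. x = nbr L y d)"

lemma adj_sym: "adj L x y \<longleftrightarrow> adj L y x"
  by (auto simp: adj_def)

definition closed_in :: "nat \<Rightarrow> nat set \<Rightarrow> nat set \<Rightarrow> bool" where
  "closed_in L A D \<longleftrightarrow> D \<subseteq> A \<and> (\<forall>x\<in>D. \<forall>y\<in>A. adj L x y \<longrightarrow> y \<in> D)"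

text \<open>Connectedness is expressed as minimality among nonempty closed sets, which avoids
  paths.\<close>

definition component :: "nat \<Rightarrow> nat set \<Rightarrow> nat set \<Rightarrow> bool" where
  "component L A D \<longleftrightarrow> D \<noteq> {} \<and> closed_in L A D \<and> (\<forall>D'\<subseteq>D. D' \<noteq> {} \<and> closed_in L A D' \<longrightarrow> D' = D)"

definition hole_bonds :: "nat \<Rightarrow> nat set \<Rightarrow> nat" where
  "hole_bonds L A = (\<Sum>x<L\<^sup>2. \<Sum>d<3. if x \<notin> A \<and> nbr L x d \<notin> A then 1 else 0)"

lemma closed_in_diff:
  assumes "closed_in L A B" "closed_in L A D"
  shows "closed_in L A (B - D)"
  using assms adj_sym unfolding closed_in_def by blast

text \<open>Take a smallest closed set \<open>B\<close> with at least the fraction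
  \<open>\<tau>\<close> of the sites. If it is a component, it has at most the fraction
  \<open>\<kappa>\<close>, and \<open>1 - \<kappa>\<close> remains. Otherwise it splits into two
  closed parts, each below the fraction \<open>\<tau>\<close> by minimality, so more than
  \<open>1 - 2 * \<tau> \<ge> \<tau>\<close> remains.\<close>

lemma balanced_closed_set:
  fixes \<tau> \<kappa> :: real
  assumes "finite A" "card A > 0" "\<tau> > 0" "3 * \<tau> \<le> 1" "\<tau> + \<kappa> \<le> 1"
    and comp: "\<And>D. component L A D \<Longrightarrow> real (card D) \<le> \<kappa> * real (card A)"
  obtains B where "closed_in L A B" "\<tau> * card A \<le> card B" "\<tau> * card A \<le> card (A - B)"
proof -
  let ?N = "real (card A)"
  let ?P = "\<lambda>D. closed_in L A D \<and> \<tau> * ?N \<le> real (card D)"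
  have "\<tau> * ?N \<le> 1 * ?N" using assms by (intro mult_right_mono) auto
  then have "?P A" unfolding closed_in_def by simp
  then obtain B where B: "?P B" and min: "\<And>D. ?P D \<Longrightarrow> card B \<le> card D"
    using ex_has_least_nat[of ?P A card] by blast
  have BA: "B \<subseteq> A" using B unfolding closed_in_def by blast
  have fB: "finite B" using BA assms(1) by (rule finite_subset)
  have cd: "real (card (A - B)) = ?N - real (card B)"
    using card_Diff_subset[OF fB BA] card_mono[OF assms(1) BA] by (simp add: of_nat_diff)
  have pos: "\<tau> * ?N > 0" using assms by simp
  have Bne: "B \<noteq> {}" using B pos by auto
  have "\<tau> * ?N \<le> real (card (A - B))"
  proof (cases "component L A B")
    case True
    have "\<tau> * ?N + \<kappa> * ?N \<le> 1 * ?N" unfolding distrib_right[symmetric] using assms by (intro mult_right_mono) auto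
    then show ?thesis using comp[OF True] cd by linarith
  next
    case False
    then obtain D where D: "D \<subseteq> B" "D \<noteq> {}" "closed_in L A D" "D \<noteq> B"
      using B Bne unfolding component_def by blast
    have c: "card D + card (B - D) = card B"
      using card_Diff_subset[of D B] card_mono[of B D] D fB finite_subset by fastforce
    have "card D > 0" "card (B - D) > 0" using D fB finite_subset by (auto simp: card_gt_0_iff)
    then have "\<not> ?P D" "\<not> ?P (B - D)" using min[of D] min[of "B - D"] c by linarith+
    then have "real (card D) < \<tau> * ?N" "real (card (B - D)) < \<tau> * ?N" using D B closed_in_diff by auto
    then have "real (card B) < 2 * (\<tau> * ?N)" using c by linarith
    moreover have "3 * \<tau> * ?N \<le> 1 * ?N" using assms by (intro mult_right_mono) auto
    ultimately show ?thesis unfolding cd by linarith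
  qed
  then show ?thesis using that B by blast
qed

lemma site_div_less: "(x::nat) < L\<^sup>2 \<Longrightarrow> x div L < L"
  unfolding power2_eq_square by (rule less_mult_imp_div_less)

lemma sum_msite:
  assumes "L > 0"
  shows "(\<Sum>x<L\<^sup>2. f x) = (\<Sum>i<L. \<Sum>j<L. f (msite L i j))"
proof -
  have "(\<Sum>i<L. \<Sum>j<L. f (msite L i j)) = (\<Sum>(i, j)\<in>{..<L} \<times> {..<L}. f (msite L i j))"
    by (simp add: sum.cartesian_product)
  also have "\<dots> = (\<Sum>x<L\<^sup>2. f x)"
    using assms msite_less[OF assms]
    by (intro sum.reindex_bij_witness[where i="\<lambda>x. (x div L, x mod L)" and j="\<lambda>(i, j). msite L i j"])
       (auto simp: msite_self site_div_less simp del: msite_mod)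
  finally show ?thesis ..
qed

lemma sum_msite_card:
  assumes "L > 0" "X \<subseteq> {..<L\<^sup>2}"
  shows "(\<Sum>i<L. card {j. j < L \<and> msite L i j \<in> X}) = card X"
proof -
  have "card X = (\<Sum>x<L\<^sup>2. if x \<in> X then 1 else 0)"
    using assms(2) by (simp add: sum.If_cases Int_absorb1)
  then show ?thesis unfolding card_sum_if sum_msite[OF assms(1)] by simp
qed

lemma msite_per: "msite L (i + L) j = msite L i j" "msite L i (j + L) = msite L i j"
  by (simp_all add: msite_def)

lemma nbr_msite:
  assumes "L > 0"
  shows "nbr L (msite L i j) 0 = msite L (Suc i) j" "nbr L (msite L i j) 1 = msite L i (Suc j)"
    "nbr L (msite L i (Suc j)) 2 = msite L (Suc i) j"
proof -
  have "msite L (Suc i) (Suc j + (L - 1)) = msite L (Suc i) (j + L)" using assms by simp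
  then show "nbr L (msite L i (Suc j)) 2 = msite L (Suc i) j"
    using assms by (simp add: nbr_shift shift_msite dirp_def dirq_def msite_per del: add_Suc)
qed (use assms in \<open>simp_all add: nbr_shift shift_msite dirp_def dirq_def\<close>)

lemma adj_msite:
  assumes "L > 0"
  shows "adj L (msite L i j) (msite L (Suc i) j)" "adj L (msite L i j) (msite L i (Suc j))"
    "adj L (msite L i (Suc j)) (msite L (Suc i) j)"
proof -
  have a: "adj L x (nbr L x d)" if "x < L\<^sup>2" "d < 3" for x d using that unfolding adj_def by blast
  show "adj L (msite L i j) (msite L (Suc i) j)"
    using a[OF msite_less[OF assms], of 0 i j] unfolding nbr_msite[OF assms] by simp
  show "adj L (msite L i j) (msite L i (Suc j))"
    using a[OF msite_less[OF assms], of 1 i j] unfolding nbr_msite[OF assms] by simp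
  show "adj L (msite L i (Suc j)) (msite L (Suc i) j)"
    using a[OF msite_less[OF assms], of 2 i "Suc j"] unfolding nbr_msite[OF assms] by simp
qed

lemma two_phase_closed:
  assumes L: "L \<ge> 3" and A: "A \<subseteq> {..<L\<^sup>2}" and B: "closed_in L A B"
  shows "two_phase L (\<lambda>i j. msite L i j \<in> B) (\<lambda>i j. msite L i j \<in> A - B)"
proof -
  have L0: "L > 0" using L by simp
  have *: "\<not> (x \<in> B \<and> y \<in> A - B)" "\<not> (x \<in> A - B \<and> y \<in> B)" if "adj L x y" for x y
    using B that adj_sym unfolding closed_in_def by blast+
  show ?thesis
    by (rule two_phase.intro) (simp_all only: msite_per L, ((rule *, rule adj_msite[OF L0]) | blast)+)
qed

lemma two_phase_counts:
  assumes L: "L \<ge> 3" and A: "A \<subseteq> {..<L\<^sup>2}" and B: "closed_in L A B"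
  defines "P \<equiv> \<lambda>i j. msite L i j \<in> B" and "Q \<equiv> \<lambda>i j. msite L i j \<in> A - B"
  shows "two_phase.nhole L P Q = L\<^sup>2 - card A" "two_phase.nhh L P Q = hole_bonds L A"
proof -
  interpret two_phase L P Q unfolding P_def Q_def by (rule two_phase_closed[OF L A B])
  have L0: "L > 0" using L by simp
  have hole: "hole i j \<longleftrightarrow> msite L i j \<notin> A" for i j
  proof -
    have "hole i j \<longleftrightarrow> \<not> P i j \<and> \<not> Q i j" by (rule hole_def)
    then show ?thesis using B unfolding P_def Q_def closed_in_def by blast
  qed
  have "nhole = (\<Sum>i<L. card {j. j < L \<and> msite L i j \<in> {..<L\<^sup>2} - A})"
    unfolding nhole_def hole using msite_less[OF L0] by simp
  also have "\<dots> = card ({..<L\<^sup>2} - A)" by (rule sum_msite_card[OF L0]) auto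
  also have "\<dots> = L\<^sup>2 - card A" using A by (simp add: card_Diff_subset finite_subset)
  finally show "nhole = L\<^sup>2 - card A" .
  let ?f = "\<lambda>d x. if x \<notin> A \<and> nbr L x d \<notin> A then 1 else 0 :: nat"
  have e0: "edges0 = (\<Sum>x<L\<^sup>2. ?f 0 x)"
    unfolding edges0_def hole card_sum_if sum_msite[OF L0] nbr_msite[OF L0] ..
  have e1: "edges1 = (\<Sum>x<L\<^sup>2. ?f 1 x)"
    unfolding edges1_def hole card_sum_if sum_msite[OF L0] nbr_msite[OF L0] ..
  \<comment> \<open>The translation by one column matches the base points \<open>(i, Suc j)\<close>
    used in \<open>edges2\<close>.\<close>
  have "(\<Sum>x<L\<^sup>2. ?f 2 x) = (\<Sum>x<L\<^sup>2. ?f 2 (shift L 0 1 x))"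
    using sum_shift[OF L0, of 0 0 1 "L - 1" "\<lambda>x y. ?f 2 x"] L by simp
  also have "\<dots> = (\<Sum>i<L. \<Sum>j<L. ?f 2 (msite L i (Suc j)))"
    unfolding sum_msite[OF L0] shift_msite[OF L0] by simp
  also have "\<dots> = edges2"
    unfolding edges2_def hole card_sum_if nbr_msite[OF L0] ..
  finally have e2: "edges2 = (\<Sum>x<L\<^sup>2. ?f 2 x)" ..
  have "{..<3::nat} = {0, 1, 2}" by auto
  then show "nhh = hole_bonds L A"
    unfolding nhh_def e0 e1 e2 hole_bonds_def by (simp add: sum.distrib)
qed

text \<open>In units of \<open>X\<close> the bounds on \<open>V / 2\<close> and
  \<open>3 * h / l\<close> are \<open>0.237\<close> and \<open>0.3\<close>. Their sum
  \<open>0.537\<close> has a square below \<open>1 / 3\<close>, so neither phase can have a third of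
  \<open>(1 - \<nu>) * l\<^sup>2\<close> sites. The small difference between \<open>N\<close> and
  \<open>l\<^sup>2\<close> is absorbed at the end.\<close>

lemma numeric_contradiction:
  fixes l \<nu> h V N b c :: real
  assumes l: "l \<ge> 3" and \<nu>: "0 < \<nu>" "\<nu> < 1"
    and h: "h \<ge> 3" "h \<le> (1 - \<nu>) powr (1/4) / 5 * (l\<^sup>2) powr (3/4)"
    and V: "V \<ge> 2" "2 * V \<le> 12 / 5 * pi\<^sup>2 * h\<^sup>2 / l\<^sup>2"
    and N: "N = l\<^sup>2 - h"
    and iso: "\<lbrakk>V / 2 < l / 3; V / 2 + 3 * h / l < 2 * l / 3\<rbrakk> \<Longrightarrow> b \<le> (V / 2 + 3 * h / l)\<^sup>2 \<or> c \<le> (V / 2 + 3 * h / l)\<^sup>2"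
    and bc: "(1 - \<nu>) / 3 * N \<le> b" "(1 - \<nu>) / 3 * N \<le> c"
  shows False
proof -
  define X where "X = sqrt (1 - \<nu>) * l"
  have X2: "X\<^sup>2 = (1 - \<nu>) * l\<^sup>2" using \<nu> by (simp add: X_def power_mult_distrib)
  have Xpos: "X > 0" using l \<nu> by (simp add: X_def)
  have Xl: "X \<le> l"
  proof -
    have "sqrt (1 - \<nu>) \<le> 1" using \<nu> by simp
    then show ?thesis unfolding X_def using l by (simp add: mult_left_le_one_le \<nu> less_imp_le)
  qed
  have "h\<^sup>2 \<le> ((1 - \<nu>) powr (1/4) / 5 * (l\<^sup>2) powr (3/4))\<^sup>2"
    using h by (intro power_mono) auto
  also have "\<dots> = ((1 - \<nu>) powr (1/4))\<^sup>2 / 25 * ((l\<^sup>2) powr (3/4))\<^sup>2"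
    by (simp add: power_mult_distrib power_divide)
  also have "((1 - \<nu>) powr (1/4))\<^sup>2 = sqrt (1 - \<nu>)"
    using \<nu> by (simp add: powr_power powr_half_sqrt)
  also have "((l\<^sup>2) powr (3/4))\<^sup>2 = l ^ 3"
  proof -
    have "(l\<^sup>2) powr (3/4) = l powr (3/2)"
      using l powr_powr[of l 2 "3/4"] by simp
    then show ?thesis using l powr_realpow[of l 3] by (simp add: powr_power)
  qed
  finally have h2: "h\<^sup>2 \<le> X * l\<^sup>2 / 25" by (simp add: X_def power3_eq_cube power2_eq_square)
  then have hl: "h\<^sup>2 / l\<^sup>2 \<le> X / 25" using l by (simp add: field_simps)
  have "pi \<le> 3.1416" using pi_approx(2) by simp
  then have "pi\<^sup>2 \<le> 3.1416\<^sup>2" by (intro power_mono) auto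
  then have "12 / 5 * pi\<^sup>2 \<le> 23.7" by (simp add: power2_eq_square)
  then have "12 / 5 * pi\<^sup>2 * (h\<^sup>2 / l\<^sup>2) \<le> 23.7 * (X / 25)"
    using hl by (intro mult_mono) auto
  then have V2: "V / 2 \<le> 237 / 1000 * X" using V(2) by simp
  \<comment> \<open>A single pair of holes would be too weak here: \<open>V \<ge> 2\<close> makes
    \<open>X\<close> exceed \<open>4\<close>, as is necessary for
    \<open>9 * X / 25 \<le> (3 / 10 * X)\<^sup>2\<close> below.\<close>
  have X4: "X \<ge> 4.2" using V(1) V2 by simp
  have "(3 * h / l)\<^sup>2 = 9 * (h\<^sup>2 / l\<^sup>2)" by (simp add: power2_eq_square)
  also have "\<dots> \<le> 9 * (X / 25)" using hl by simp
  also have "\<dots> \<le> (3 / 10 * X)\<^sup>2" using X4 Xpos by (simp add: power2_eq_square)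
  finally have r: "3 * h / l \<le> 3 / 10 * X" by (rule power2_le_imp_le) (use Xpos in simp)
  have s: "V / 2 + 3 * h / l \<le> 537 / 1000 * X" "0 \<le> V / 2 + 3 * h / l" using r V2 V(1) h l by auto
  have s2: "(V / 2 + 3 * h / l)\<^sup>2 \<le> (537 / 1000 * X)\<^sup>2" using s by (intro power_mono)
  have "b \<le> (V / 2 + 3 * h / l)\<^sup>2 \<or> c \<le> (V / 2 + 3 * h / l)\<^sup>2"
    using V2 s Xl Xpos by (intro iso) linarith+
  then have "(1 - \<nu>) / 3 * N \<le> (537 / 1000 * X)\<^sup>2" using bc s2 by linarith
  also have "\<dots> = 288369 / 1000000 * ((1 - \<nu>) * l\<^sup>2)" unfolding X2[symmetric] by (simp add: power2_eq_square)
  finally have "(1 - \<nu>) * (N / 3) \<le> (1 - \<nu>) * (288369 / 1000000 * l\<^sup>2)" by simp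
  then have "N / 3 \<le> 288369 / 1000000 * l\<^sup>2" using \<nu> by (simp only: mult_le_cancel_left_pos diff_gt_0_iff_gt)
  \<comment> \<open>What is left is a lower bound on \<open>h\<close> of order
    \<open>l\<^sup>2\<close>. Together with \<open>h\<^sup>2 \<le> l ^ 3 / 25\<close> it would force
    \<open>l < 3\<close>, whereas \<open>l \<ge> X \<ge> 4.2\<close>.\<close>
  then have "134893 * l\<^sup>2 \<le> h * 1000000" unfolding N by simp
  then have "13 / 100 * l\<^sup>2 \<le> h" using zero_le_power2[of l] by linarith
  then have "(13 / 100 * l\<^sup>2)\<^sup>2 \<le> h\<^sup>2" by (intro power_mono) auto
  also have "\<dots> \<le> l * l\<^sup>2 / 25" using h2 Xl l by (smt (verit) divide_right_mono mult_right_mono zero_le_power2)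
  finally have "169 / 10000 * l * (l * l\<^sup>2) \<le> 1/25 * (l * l\<^sup>2)" by (simp add: power2_eq_square)
  then have "169 / 10000 * l \<le> 1/25" by (rule mult_right_le_imp_le) (use l in simp)
  then show False using X4 Xl by simp
qed

text \<open>The constant \<open>12 / 5 * pi\<^sup>2\<close> is the one that \<open>sum_quad_le\<close> yields for the excess energy of
  the trial state.\<close>

lemma hole_bonds_large:
  assumes L: "L \<ge> 3" and \<nu>: "0 < \<nu>" "\<nu> < 1" and A: "A \<subseteq> {..<L\<^sup>2}"
    and N: "real (card A) \<ge> real (L\<^sup>2) - (1 - \<nu>) powr (1/4) / 5 * real (L\<^sup>2) powr (3/4)"
    and comp: "\<And>D. component L A D \<Longrightarrow> real (card D) \<le> (1 + \<nu>) / 2 * real (card A)"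
  shows "2 * real (hole_bonds L A) > 12 / 5 * pi\<^sup>2 * (real (L\<^sup>2 - card A))\<^sup>2 / (real L)\<^sup>2"
    "L\<^sup>2 - card A \<ge> 3"
proof -
  have cA: "card A \<le> L\<^sup>2" using card_mono[OF _ A] by simp
  define h where "h = real (L\<^sup>2 - card A)"
  have h: "h = real (L\<^sup>2) - real (card A)" using cA by (simp add: h_def of_nat_diff)
  have hle: "h \<le> (1 - \<nu>) powr (1/4) / 5 * real (L\<^sup>2) powr (3/4)" using N h by linarith
  have fA: "finite A" using A finite_subset by blast
  have cpos: "card A > 0"
  proof (rule ccontr)
    assume "\<not> ?thesis"
    then have "real (L\<^sup>2) \<le> (1 - \<nu>) powr (1/4) / 5 * real (L\<^sup>2) powr (3/4)" using N by simp
    also have "\<dots> \<le> 1 / 5 * real (L\<^sup>2) powr 1"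
      using \<nu> L by (intro mult_mono divide_right_mono powr_mono powr_le1) auto
    finally show False using L by simp
  qed
  \<comment> \<open>The largest cluster alone would allow the fraction
    \<open>(1 - \<nu>) / 2\<close> on the other side, but splitting small clusters evenly requires
    \<open>\<tau> \<le> 1 / 3\<close>. The value \<open>(1 - \<nu>) / 3\<close> satisfies both
    restrictions.\<close>
  have "\<exists>B. closed_in L A B \<and> (1 - \<nu>) / 3 * card A \<le> card B \<and> (1 - \<nu>) / 3 * card A \<le> card (A - B)"
    by (rule balanced_closed_set[OF fA cpos, of "(1 - \<nu>) / 3" "(1 + \<nu>) / 2" L]) (use \<nu> comp in \<open>auto simp: field_simps\<close>)
  then obtain B where B: "closed_in L A B" "(1 - \<nu>) / 3 * card A \<le> card B" "(1 - \<nu>) / 3 * card A \<le> card (A - B)"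
    by blast
  define P where "P = (\<lambda>i j. msite L i j \<in> B)"
  define Q where "Q = (\<lambda>i j. msite L i j \<in> A - B)"
  interpret two_phase L P Q unfolding P_def Q_def by (rule two_phase_closed[OF L A B(1)])
  note cnt = two_phase_counts[OF L A B(1), folded P_def Q_def]
  have BA: "B \<subseteq> {..<L\<^sup>2}" "A - B \<subseteq> {..<L\<^sup>2}" using B A unfolding closed_in_def by auto
  have L0: "L > 0" using L by simp
  have nB: "(\<Sum>i<L. card {j. j < L \<and> P i j}) = card B" "(\<Sum>i<L. card {j. j < L \<and> Q i j}) = card (A - B)"
    unfolding P_def Q_def using sum_msite_card[OF L0] BA by blast+
  have pos: "0 < (1 - \<nu>) / 3 * card A" using \<nu> cpos by simp
  have "\<exists>i<L. \<exists>j<L. R i j" if "(\<Sum>i<L. card {j. j < L \<and> R i j}) > 0" for R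
  proof (rule ccontr)
    assume "\<not> ?thesis"
    then have "{j. j < L \<and> R i j} = {}" if "i < L" for i using that by auto
    then have "(\<Sum>i<L. card {j. j < L \<and> R i j}) = 0" by simp
    with that show False by simp
  qed
  from this[of P] this[of Q] obtain i0 j0 i1 j1 where ij: "i0 < L" "j0 < L" "P i0 j0" "i1 < L" "j1 < L" "Q i1 j1"
    using nB B pos by fastforce
  note nt = nontrivial[OF ij, unfolded cnt]
  show "L\<^sup>2 - card A \<ge> 3" by (rule nt)
  show "2 * real (hole_bonds L A) > 12 / 5 * pi\<^sup>2 * (real (L\<^sup>2 - card A))\<^sup>2 / (real L)\<^sup>2"
  proof (rule ccontr)
    assume "\<not> ?thesis"
    then have V: "2 * real (hole_bonds L A) \<le> 12 / 5 * pi\<^sup>2 * h\<^sup>2 / (real L)\<^sup>2" unfolding h_def by simp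
    show False
    proof (rule numeric_contradiction[of "real L" \<nu> h "real (hole_bonds L A)" "real (card A)" "real (card B)" "real (card (A - B))"])
      have "real 3 \<le> h" unfolding h_def of_nat_le_iff by (rule nt(2))
      then show "h \<ge> 3" by simp
      show "2 \<le> real (hole_bonds L A)" using nt(1) by simp
      show "h \<le> (1 - \<nu>) powr (1/4) / 5 * (real L)\<^sup>2 powr (3/4)" using hle by simp
      show "real (card B) \<le> (real (hole_bonds L A) / 2 + 3 * h / real L)\<^sup>2 \<or> real (card (A - B)) \<le> (real (hole_bonds L A) / 2 + 3 * h / real L)\<^sup>2"
        if "real (hole_bonds L A) / 2 < real L / 3" "real (hole_bonds L A) / 2 + 3 * h / real L < 2 * real L / 3"
        using isoperimetric[of "real (hole_bonds L A) / 2" "3 * h / real L"] that unfolding cnt nB h_def by simp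
    qed (use L \<nu> V h B in auto)
  qed
qed

section \<open>Spin and cluster sizes\<close>

text \<open>The basis states without double occupancy: \<open>A\<close> is the set of occupied
  sites, and those in \<open>Y\<close> carry spin down.\<close>

definition config :: "nat set \<Rightarrow> nat set \<Rightarrow> nat set" where
  "config A Y = (\<lambda>x. mode x (x \<notin> Y)) ` A"

definition occupied :: "nat set \<Rightarrow> nat set" where
  "occupied T = (\<lambda>j. j div 2) ` T"

lemma mode_div_2 [simp]: "mode z \<sigma> div 2 = z"
  by (simp add: mode_def)

lemma mode_cases: obtains z \<sigma> where "j = mode z \<sigma>"
proof
  show "j = mode (j div 2) (even j)" by (auto simp: mode_def)
qed

lemma occupied_iff: "x \<in> occupied T \<longleftrightarrow> mode x True \<in> T \<or> mode x False \<in> T"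
proof
  assume "x \<in> occupied T"
  then obtain j where "j \<in> T" "x = j div 2" unfolding occupied_def by blast
  then show "mode x True \<in> T \<or> mode x False \<in> T" by (cases j rule: mode_cases) (metis (full_types) mode_div_2)
next
  assume "mode x True \<in> T \<or> mode x False \<in> T"
  then show "x \<in> occupied T" unfolding occupied_def by (metis imageI mode_div_2)
qed

lemma mode_in_config: "mode z \<sigma> \<in> config A Y \<longleftrightarrow> z \<in> A \<and> (\<sigma> \<longleftrightarrow> z \<notin> Y)"
  unfolding config_def by auto

lemma set_eq_modes: "(\<And>z \<sigma>. mode z \<sigma> \<in> S \<longleftrightarrow> mode z \<sigma> \<in> T) \<Longrightarrow> S = T"
  by (metis mode_cases subsetI subset_antisym)

lemma occupied_config [simp]: "occupied (config A Y) = A"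
  by (auto simp: occupied_iff mode_in_config)

lemma config_occupied:
  assumes "\<And>z. \<not> (mode z True \<in> T \<and> mode z False \<in> T)"
  shows "T = config (occupied T) {z. mode z False \<in> T}"
proof (rule set_eq_modes)
  fix z \<sigma>
  show "mode z \<sigma> \<in> T \<longleftrightarrow> mode z \<sigma> \<in> config (occupied T) {z. mode z False \<in> T}"
    using assms[of z] by (cases \<sigma>) (auto simp: mode_in_config occupied_iff)
qed

lemma inj_on_config: "inj_on (\<lambda>x. mode x (x \<notin> Y)) A"
  by (auto simp: inj_on_def)

lemma card_config: "card (config A Y) = card A"
  unfolding config_def by (rule card_image) (rule inj_on_config)

lemma card_odd_config:
  assumes "Y \<subseteq> A"
  shows "card {j \<in> config A Y. odd j} = card Y"
proof -
  have "{j \<in> config A Y. odd j} = (\<lambda>x. mode x (x \<notin> Y)) ` Y"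
    using assms unfolding config_def by auto
  then show ?thesis by (simp add: card_image inj_on_def)
qed

lemma splus_config:
  assumes "A \<subseteq> {..<nsites L}" "Y \<subseteq> A"
  shows "splus L \<psi> (config A Y) = (\<Sum>z\<in>A - Y. \<psi> (config A (insert z Y)))"
proof -
  have "splus L \<psi> (config A Y) = (\<Sum>z<nsites L. if z \<in> A - Y then \<psi> (config A (insert z Y)) else 0)"
    unfolding splus_apply
  proof (intro sum.cong refl)
    fix z
    have "insert (mode z False) (config A Y - {mode z True}) = config A (insert z Y)" if "z \<in> A - Y"
      using that by (intro set_eq_modes) (auto simp: mode_in_config)
    then show "(if mode z True \<in> config A Y \<and> mode z False \<notin> config A Y
        then \<psi> (insert (mode z False) (config A Y - {mode z True})) else 0) =
      (if z \<in> A - Y then \<psi> (config A (insert z Y)) else 0)"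
      by (auto simp: mode_in_config)
  qed
  also have "\<dots> = (\<Sum>z\<in>{..<nsites L} \<inter> (A - Y). \<psi> (config A (insert z Y)))"
    by (simp add: sum.inter_restrict)
  also have "{..<nsites L} \<inter> (A - Y) = A - Y" using assms by auto
  finally show ?thesis .
qed

text \<open>The amplitude \<open>g Y\<close> belongs to the configuration with down spins at \<open>Y\<close>. The highest weight
  equation expresses amplitudes with one more down spin in \<open>D\<close> through amplitudes with fewer,
  and with too few sites outside \<open>D\<close> the recursion starts at zero.\<close>

lemma highest_weight_vanish:
  fixes g :: "nat set \<Rightarrow> complex"
  assumes A: "finite A"
    and q: "\<And>Y. Y \<subseteq> A \<Longrightarrow> g Y \<noteq> 0 \<Longrightarrow> card Y = q"
    and hw: "\<And>Y. Y \<subseteq> A \<Longrightarrow> (\<Sum>z\<in>A - Y. g (insert z Y)) = 0"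
    and swap: "\<And>Y x y. Y \<subseteq> A \<Longrightarrow> x \<in> Y \<Longrightarrow> y \<in> A - Y \<Longrightarrow> adj L x y \<Longrightarrow> g Y = g (insert y (Y - {x}))"
    and D: "component L A D" "card (A - D) < q"
    and Y: "Y \<subseteq> A"
  shows "g Y = 0"
proof -
  \<comment> \<open>A down spin may be moved from \<open>x\<close> to \<open>y\<close> without
    changing the amplitude. For adjacent sites this is the hypothesis \<open>swap\<close>.\<close>
  define E where "E x y \<longleftrightarrow> (\<forall>Y\<subseteq>A. x \<in> Y \<longrightarrow> y \<notin> Y \<longrightarrow> g Y = g (insert y (Y - {x})))" for x y
  have DA: "D \<subseteq> A" and Dcl: "\<And>x y. x \<in> D \<Longrightarrow> y \<in> A \<Longrightarrow> adj L x y \<Longrightarrow> y \<in> D"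
    using D unfolding component_def closed_in_def by blast+
  \<comment> \<open>The move from \<open>x\<close> to \<open>z\<close> goes through
    \<open>y\<close>. If \<open>y\<close> already carries a down spin, that spin is moved to
    \<open>z\<close> first and then replaced by the one from \<open>x\<close>.\<close>
  have trans: "E x z" if "E x y" "E y z" "x \<noteq> z" "y \<in> A" "z \<in> A" for x y z
    unfolding E_def
  proof (intro allI impI)
    fix Y assume Y: "Y \<subseteq> A" "x \<in> Y" "z \<notin> Y"
    show "g Y = g (insert z (Y - {x}))"
    proof (cases "y \<in> Y")
      case True
      have "g Y = g (insert z (Y - {y}))" using \<open>E y z\<close> Y True unfolding E_def by blast
      also have "\<dots> = (if x = y then g (insert z (Y - {y})) else g (insert y (insert z (Y - {y}) - {x})))"
        using \<open>E x y\<close>[unfolded E_def, rule_format, of "insert z (Y - {y})"] Y True that by auto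
      also have "\<dots> = g (insert z (Y - {x}))"
      proof (cases "x = y")
        case False
        then have "insert y (insert z (Y - {y}) - {x}) = insert z (Y - {x})" using True that Y by auto
        then show ?thesis using False by simp
      qed simp
      finally show ?thesis .
    next
      case False
      have "g Y = g (insert y (Y - {x}))" using \<open>E x y\<close> Y False unfolding E_def by blast
      also have "\<dots> = (if y = z then g (insert y (Y - {x})) else g (insert z (insert y (Y - {x}) - {y})))"
        using \<open>E y z\<close>[unfolded E_def, rule_format, of "insert y (Y - {x})"] Y False that by auto
      also have "\<dots> = g (insert z (Y - {x}))"
      proof (cases "y = z")
        case F2: False
        then have "insert z (insert y (Y - {x}) - {y}) = insert z (Y - {x})" using False Y by auto
        then show ?thesis using F2 by simp
      qed simp
      finally show ?thesis .
    qed
  qed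
  have adjE: "E x y" if "adj L x y" "y \<in> A" for x y
    using swap that unfolding E_def by blast
  \<comment> \<open>The sites of \<open>D\<close> that \<open>y\<close> can exchange with, together
    with \<open>y\<close>, form a closed set, which is all of \<open>D\<close> by
    minimality.\<close>
  have all: "E y z" if "y \<in> D" "z \<in> D" "y \<noteq> z" for y z
  proof -
    let ?D = "{w \<in> D. w = y \<or> E y w}"
    have "closed_in L A ?D"
      unfolding closed_in_def
    proof (intro conjI ballI impI)
      show "?D \<subseteq> A" using DA by auto
      fix v w assume v: "v \<in> ?D" and w: "w \<in> A" "adj L v w"
      have "w \<in> D" using v w Dcl by blast
      moreover have "w = y \<or> E y w"
        using adjE[OF w(2,1)] v trans[of y v w] DA w by blast
      ultimately show "w \<in> ?D" by blast
    qed
    moreover have "\<forall>D'\<subseteq>D. D' \<noteq> {} \<and> closed_in L A D' \<longrightarrow> D' = D"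
      using D(1) unfolding component_def by (elim conjE)
    ultimately have "?D = D" using that(1) by (elim allE[where x="?D"]) auto
    then have "z \<in> ?D" using that(2) by simp
    then show ?thesis using that(3) by auto
  qed
  have "\<forall>Y\<subseteq>A. card (Y \<inter> D) = d \<longrightarrow> g Y = 0" for d
  proof (induction d)
    case 0
    show ?case
    proof (intro allI impI)
      fix Y assume Y: "Y \<subseteq> A" "card (Y \<inter> D) = 0"
      then have "finite (Y \<inter> D)" using A by (meson finite_Int finite_subset)
      then have "Y \<inter> D = {}" using Y by simp
      then have "Y \<subseteq> A - D" using Y by blast
      then have "card Y \<le> card (A - D)" using A by (intro card_mono) auto
      then show "g Y = 0" using q[OF Y(1)] D(2) by fastforce
    qed
  next
    case (Suc d)
    show ?case
    proof (intro allI impI)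
      fix Y assume Y: "Y \<subseteq> A" "card (Y \<inter> D) = Suc d"
      then obtain y where y: "y \<in> Y" "y \<in> D" by (metis Int_iff card.empty equals0I nat.distinct(1))
      define Y' where "Y' = Y - {y}"
      have fY: "finite (Y \<inter> D)" using A Y finite_subset[of "Y \<inter> D" A] by auto
      have "Y' \<inter> D = (Y \<inter> D) - {y}" by (auto simp: Y'_def)
      then have cY': "card (Y' \<inter> D) = d" using Y y fY by simp
      have in0: "g (insert z Y') = g Y" if "z \<in> (A - Y') \<inter> D" for z
      proof (cases "z = y")
        case True then show ?thesis using y by (simp add: Y'_def insert_absorb)
      next
        case False
        then have "z \<notin> Y" using that by (auto simp: Y'_def)
        then show ?thesis using all[of y z] y that False Y unfolding E_def Y'_def by auto
      qed
      have out0: "g (insert z Y') = 0" if "z \<in> (A - Y') - D" for z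
      proof -
        have "(insert z Y') \<inter> D = Y' \<inter> D" using that by auto
        then have "card ((insert z Y') \<inter> D) = d" using cY' by simp
        moreover have "insert z Y' \<subseteq> A" using that Y by (auto simp: Y'_def)
        ultimately show ?thesis using Suc.IH by blast
      qed
      \<comment> \<open>In the highest weight equation at \<open>Y\<close> without \<open>y\<close>,
        all terms with \<open>z\<close> in \<open>D\<close> equal \<open>g Y\<close> by exchange
        symmetry. The terms with \<open>z\<close> outside \<open>D\<close> have one down spin less
        in \<open>D\<close> and vanish by induction.\<close>
      have "0 = (\<Sum>z\<in>A - Y'. g (insert z Y'))" using hw[of Y'] Y unfolding Y'_def by auto
      also have "\<dots> = (\<Sum>z\<in>(A - Y') \<inter> D. g (insert z Y')) + (\<Sum>z\<in>(A - Y') - D. g (insert z Y'))"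
        using A by (intro sum.Int_Diff) auto
      also have "\<dots> = of_nat (card ((A - Y') \<inter> D)) * g Y" by (simp add: in0 out0)
      finally have "card ((A - Y') \<inter> D) = 0 \<or> g Y = 0" by auto
      moreover have "card ((A - Y') \<inter> D) \<noteq> 0" using A y Y by (auto simp: Y'_def card_eq_0_iff)
      ultimately show "g Y = 0" by blast
    qed
  qed
  with Y show ?thesis by blast
qed

lemma adj_bond:
  assumes "L > 0" "adj L x y"
  obtains b where "b < nbonds L" "bfst L ori b = x \<and> bsnd L ori b = y \<or> bfst L ori b = y \<and> bsnd L ori b = x"
proof -
  have *: "\<exists>b<nbonds L. {bfst L ori b, bsnd L ori b} = {x, nbr L x d}" if "x < L\<^sup>2" "d < 3" for x d
    using that by (intro exI[of _ "3 * x + d"]) (auto simp: nbonds_def bfst_def bsnd_def)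
  then show ?thesis using assms(2) that unfolding adj_def by (metis doubleton_eq_iff)
qed

lemma finite_energy_swap:
  assumes "L > 0" "finite_energy L \<mu> ori \<psi>" "\<mu> \<noteq> 0" "Y \<subseteq> A" "x \<in> Y" "y \<in> A - Y" "adj L x y"
  shows "\<psi> (config A Y) = \<psi> (config A (insert y (Y - {x})))"
proof -
  obtain b where b: "b < nbonds L" "bfst L ori b = x \<and> bsnd L ori b = y \<or> bfst L ori b = y \<and> bsnd L ori b = x"
    using adj_bond[OF assms(1,7)] by blast
  define R where "R = config (A - {x, y}) Y"
  have R: "mode x \<sigma> \<notin> R" "mode y \<sigma> \<notin> R" for \<sigma> by (auto simp: R_def mode_in_config)
  have ne: "x \<noteq> y" using assms by auto
  have 1: "config A Y = insert (mode y True) (insert (mode x False) R)"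
    using assms(4-6) by (intro set_eq_modes) (auto simp: mode_in_config R_def)
  have 2: "config A (insert y (Y - {x})) = insert (mode x True) (insert (mode y False) R)"
    using assms(4-6) ne by (intro set_eq_modes) (auto simp: mode_in_config R_def)
  show ?thesis using b(2) finite_energy_swap_bond[OF assms(1,2) b(1) assms(3), of R] R ne unfolding 1 2 by metis
qed

text \<open>A highest weight vector with \<open>q\<close> down spins has spin
  \<open>S = N / 2 - q\<close>, so the bound is \<open>N / 2 + S\<close> on the size of each
  cluster.\<close>

lemma highest_weight_clusters:
  assumes L: "L > 0" and fe: "finite_energy L \<mu> ori \<psi>" and \<mu>: "\<mu> \<noteq> 0" and sec: "sector L N q \<psi>"
    and hw: "splus L \<psi> = (\<lambda>T. 0)" and T: "\<psi> T \<noteq> 0" and D: "component L (occupied T) D"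
  shows "card D + q \<le> N"
proof (rule ccontr)
  assume "\<not> ?thesis"
  then have gt: "N < card D + q" by simp
  have Tm: "T \<subseteq> {..<nmodes L}" "card T = N" using sec T unfolding sector_def by blast+
  let ?A = "occupied T"
  have A: "?A \<subseteq> {..<nsites L}" using Tm(1) unfolding occupied_def nmodes_def by auto
  then have fA: "finite ?A" using finite_subset by blast
  have nd: "\<not> (mode z True \<in> T \<and> mode z False \<in> T)" for z
  proof (cases "z < nsites L")
    case True then show ?thesis using finite_energy_no_double[OF fe True] T by blast
  next
    case False then show ?thesis using A by (auto simp: occupied_iff)
  qed
  define Y where "Y = {z. mode z False \<in> T}"
  have TY: "T = config ?A Y" unfolding Y_def by (rule config_occupied[OF nd])
  have YA: "Y \<subseteq> ?A" by (auto simp: Y_def occupied_iff)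
  have DA: "D \<subseteq> ?A" using D unfolding component_def closed_in_def by blast
  have "card ?A = N" using card_config[of ?A Y] TY Tm(2) by simp
  then have cD: "card (?A - D) < q"
    using gt card_Diff_subset[OF finite_subset[OF DA fA] DA] card_mono[OF fA DA] by linarith
  have "\<psi> (config ?A Y) = 0"
  proof (rule highest_weight_vanish[OF fA _ _ _ D cD YA, where g="\<lambda>Y. \<psi> (config ?A Y)"])
    fix Y assume "Y \<subseteq> ?A" "\<psi> (config ?A Y) \<noteq> 0"
    then show "card Y = q" using sec card_odd_config unfolding sector_def by metis
  next
    fix Y assume "Y \<subseteq> ?A"
    then show "(\<Sum>z\<in>?A - Y. \<psi> (config ?A (insert z Y))) = 0" using splus_config[OF A, of Y \<psi>] hw by simp
  qed (rule finite_energy_swap[OF L fe \<mu>])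
  then show False using T TY by simp
qed

section \<open>Eigenvectors of the total spin\<close>

lemma sector_ne_state: "sector L N q \<psi> \<Longrightarrow> ne_state L N \<psi>"
  unfolding sector_def ne_state_def by blast

lemma ne_state_ip_pos:
  assumes "ne_state L N \<psi>" "\<psi> \<noteq> (\<lambda>T. 0)"
  shows "Re (ip (nmodes L) \<psi> \<psi>) > 0"
proof -
  obtain T where "\<psi> T \<noteq> 0" using assms(2) by auto
  moreover have "T \<in> Pow {..<nmodes L}" using assms(1) \<open>\<psi> T \<noteq> 0\<close> unfolding ne_state_def by blast
  ultimately have "Re (ip (nmodes L) \<psi> \<psi>) \<noteq> 0" using ip_self_eq_0 by blast
  then show ?thesis using ip_self_nonneg[of "nmodes L" \<psi>] by linarith
qed

lemma ne_state_ip_zero: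
  assumes "ne_state L N \<psi>" "ip (nmodes L) \<psi> \<psi> = 0"
  shows "\<psi> = (\<lambda>T. 0)"
  using ne_state_ip_pos[OF assms(1)] assms(2) by fastforce

lemma occupied_flip:
  assumes "mode z False \<in> T" "mode z True \<notin> T"
  shows "occupied (insert (mode z True) (T - {mode z False})) = occupied T"
  using assms by (auto simp: occupied_iff)

text \<open>Raising removes down spins without moving electrons and keeps the eigenvalue. Unless
  \<open>\<psi>\<close> is itself of highest weight, it is recovered by lowering the raised vector,
  so every occupied set in its support already occurs there and inherits the bound.\<close>

lemma eigenvector_clusters:
  assumes L: "L > 0" and \<mu>: "\<mu> \<noteq> 0"
    and "finite_energy L \<mu> ori \<psi>" "sector L N q \<psi>" "\<psi> \<noteq> (\<lambda>T. 0)"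
    and "stot2 L \<psi> = (\<lambda>T. complex_of_real ev * \<psi> T)"
  shows "\<exists>S\<ge>0. ev = S * (S + 1) \<and> (\<forall>T D. \<psi> T \<noteq> 0 \<longrightarrow> component L (occupied T) D \<longrightarrow> real (card D) \<le> real N / 2 + S)"
  using assms(3-)
proof (induction q arbitrary: \<psi>)
  case (0 \<psi>)
  note \<psi> = 0
  have hw: "splus L \<psi> = (\<lambda>T. 0)" by (rule sector_0_splus[OF \<psi>(2)])
  obtain T where T: "\<psi> T \<noteq> 0" using \<psi>(3) by auto
  define M where "M = real N / 2"
  have "complex_of_real ev * \<psi> T = complex_of_real (M * (M + 1)) * \<psi> T"
    using stot2_sector[OF \<psi>(2), of T] \<psi>(4) unfolding hw M_def by simp
  then have "ev = M * (M + 1)" using T by (simp only: mult_cancel_right of_real_eq_iff) simp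
  moreover have "real (card D) \<le> real N / 2 + M" if "\<psi> T \<noteq> 0" "component L (occupied T) D" for T D
    using highest_weight_clusters[OF L \<psi>(1) \<mu> \<psi>(2) hw that] by (simp add: M_def)
  ultimately show ?case by (intro exI[of _ M]) (auto simp: M_def)
next
  case (Suc q \<psi>)
  note \<psi> = Suc.prems
  define M where "M = real N / 2 - real (Suc q)"
  have st: "complex_of_real ev * \<psi> T = sminus L (splus L \<psi>) T + complex_of_real (M * (M + 1)) * \<psi> T" for T
    using stot2_sector[OF \<psi>(2), of T] \<psi>(4) unfolding M_def by simp
  show ?case
  proof (cases "splus L \<psi> = (\<lambda>T. 0)")
    case hw: True
    obtain T where T: "\<psi> T \<noteq> 0" using \<psi>(3) by auto
    have ev: "ev = M * (M + 1)" using st[of T] T unfolding hw by (simp only: sminus_zero add_0 mult_cancel_right of_real_eq_iff) simp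
    \<comment> \<open>The squared norm of the lowered vector is \<open>2 * M\<close> times that of
      \<open>\<psi>\<close>, hence \<open>M \<ge> 0\<close>. This selects the nonnegative solution
      of \<open>ev = S * (S + 1)\<close>.\<close>
    have "splus L (sminus L \<psi>) = (\<lambda>T. complex_of_real (2 * M) * \<psi> T)"
      by (rule ext) (simp add: splus_sminus hw s3_sector[OF \<psi>(2)] M_def)
    then have "ip (nmodes L) (sminus L \<psi>) (sminus L \<psi>) = complex_of_real (2 * M) * ip (nmodes L) \<psi> \<psi>"
      unfolding ip_sminus by (simp only: ip_scale_right)
    then have "2 * M * Re (ip (nmodes L) \<psi> \<psi>) \<ge> 0"
      using ip_self_nonneg[of "nmodes L" "sminus L \<psi>"] by simp
    then have "M \<ge> 0"
      using ne_state_ip_pos[OF sector_ne_state[OF \<psi>(2)] \<psi>(3)] by (simp add: zero_le_mult_iff)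
    moreover have "real (card D) \<le> real N / 2 + M" if "\<psi> T \<noteq> 0" "component L (occupied T) D" for T D
    proof -
      have "real (card D + Suc q) \<le> real N" using highest_weight_clusters[OF L \<psi>(1) \<mu> \<psi>(2) hw that] by (simp only: of_nat_le_iff)
      then show ?thesis by (simp add: M_def)
    qed
    ultimately show ?thesis using ev by blast
  next
    case False
    let ?\<chi> = "splus L \<psi>"
    have "stot2 L ?\<chi> = (\<lambda>T. complex_of_real ev * ?\<chi> T)"
    proof
      fix T
      have e: "splus L (sminus L ?\<chi>) = (\<lambda>T. complex_of_real (ev - M * (M + 1)) * ?\<chi> T)"
      proof -
        have "sminus L ?\<chi> = (\<lambda>T. complex_of_real (ev - M * (M + 1)) * \<psi> T)"
          using st by (simp add: fun_eq_iff algebra_simps)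
        then show ?thesis by (simp only: splus_scale)
      qed
      have "stot2 L ?\<chi> T = splus L (sminus L ?\<chi>) T - s3 L ?\<chi> T + s3 L (s3 L ?\<chi>) T"
        unfolding stot2_eq' splus_sminus by simp
      moreover have "real N / 2 - real q = M + 1" by (simp add: M_def)
      ultimately show "stot2 L ?\<chi> T = complex_of_real ev * ?\<chi> T"
        unfolding s3_sector[OF sector_splus[OF \<psi>(2)]] s3_lin e by (simp add: algebra_simps)
    qed
    from Suc.IH[OF finite_energy_splus[OF \<psi>(1)] sector_splus[OF \<psi>(2)] False this]
    obtain S where S: "S \<ge> 0" "ev = S * (S + 1)"
      "\<And>T D. ?\<chi> T \<noteq> 0 \<Longrightarrow> component L (occupied T) D \<Longrightarrow> real (card D) \<le> real N / 2 + S" by blast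
    \<comment> \<open>If the two numbers were equal, the raised vector would be annihilated by
      lowering and would have norm zero.\<close>
    have ne: "ev \<noteq> M * (M + 1)"
    proof
      assume "ev = M * (M + 1)"
      then have "sminus L ?\<chi> = (\<lambda>T. 0)" using st by (simp add: fun_eq_iff)
      then have "ip (nmodes L) ?\<chi> ?\<chi> = 0" using ip_sminus[of L ?\<chi> \<psi>] by (simp add: ip_splus)
      then show False using ne_state_ip_zero[OF sector_ne_state[OF sector_splus[OF \<psi>(2)]]] False by blast
    qed
    have "real (card D) \<le> real N / 2 + S" if T: "\<psi> T \<noteq> 0" "component L (occupied T) D" for T D
    proof -
      have "complex_of_real (ev - M * (M + 1)) * \<psi> T = sminus L ?\<chi> T" using st[of T] by (simp add: algebra_simps)
      moreover have "complex_of_real (ev - M * (M + 1)) * \<psi> T \<noteq> 0"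
        using ne T by (simp only: mult_eq_0_iff of_real_eq_0_iff) simp
      ultimately have "sminus L ?\<chi> T \<noteq> 0" by simp
      then obtain z where z: "mode z False \<in> T" "mode z True \<notin> T" "?\<chi> (insert (mode z True) (T - {mode z False})) \<noteq> 0"
        by (rule sminus_support)
      show ?thesis using S(3)[OF z(3)] T(2) unfolding occupied_flip[OF z(1,2)] by blast
    qed
    then show ?thesis using S by blast
  qed
qed

text \<open>Induction along the ladder: lowering the components of the raised vector yields
  eigenvectors in the present sector. Suitable multiples of them, subtracted from
  \<open>\<psi>\<close>, leave a vector with the one eigenvalue \<open>M * (M + 1)\<close> that
  highest weight vectors of this sector have.\<close>

lemma spin_decomposition:
  assumes "finite_energy L \<mu> ori \<psi>" "sector L N q \<psi>"
  shows "\<exists>R \<phi>. finite R \<and> \<psi> = (\<lambda>T. \<Sum>ev\<in>R. \<phi> ev T) \<and>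
    (\<forall>ev\<in>R. finite_energy L \<mu> ori (\<phi> ev) \<and> sector L N q (\<phi> ev) \<and> stot2 L (\<phi> ev) = (\<lambda>T. complex_of_real ev * \<phi> ev T))"
  using assms
proof (induction q arbitrary: \<psi>)
  case (0 \<psi>)
  have "stot2 L \<psi> = (\<lambda>T. complex_of_real (real N / 2 * (real N / 2 + 1)) * \<psi> T)"
    using stot2_sector[OF 0(2)] sector_0_splus[OF 0(2)] by (auto simp: fun_eq_iff)
  then show ?case using 0 by (intro exI[of _ "{real N / 2 * (real N / 2 + 1)}"] exI[of _ "\<lambda>_. \<psi>"]) simp
next
  case (Suc q \<psi>)
  define M where "M = real N / 2 - real (Suc q)"
  define l0 where "l0 = M * (M + 1)"
  from Suc.IH[OF finite_energy_splus[OF Suc.prems(1)] sector_splus[OF Suc.prems(2)]]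
  obtain R \<phi> where R: "finite R" "splus L \<psi> = (\<lambda>T. \<Sum>ev\<in>R. \<phi> ev T)"
    "\<And>ev. ev \<in> R \<Longrightarrow> finite_energy L \<mu> ori (\<phi> ev)" "\<And>ev. ev \<in> R \<Longrightarrow> sector L N q (\<phi> ev)"
    "\<And>ev. ev \<in> R \<Longrightarrow> stot2 L (\<phi> ev) = (\<lambda>T. complex_of_real ev * \<phi> ev T)" by blast
  define \<eta> where "\<eta> ev = sminus L (\<phi> ev)" for ev
  have \<eta>: "finite_energy L \<mu> ori (\<eta> ev)" "sector L N (Suc q) (\<eta> ev)" "stot2 L (\<eta> ev) = (\<lambda>T. complex_of_real ev * \<eta> ev T)"
    if "ev \<in> R" for ev
  proof -
    show "finite_energy L \<mu> ori (\<eta> ev)" "sector L N (Suc q) (\<eta> ev)"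
      using R(3,4)[OF that] unfolding \<eta>_def by (simp_all add: finite_energy_sminus sector_sminus)
    show "stot2 L (\<eta> ev) = (\<lambda>T. complex_of_real ev * \<eta> ev T)"
      unfolding \<eta>_def by (rule ext) (simp only: stot2_sminus_sector[OF R(4)[OF that]] R(5)[OF that] sminus_scale)
  qed
  have st: "stot2 L \<psi> T - complex_of_real l0 * \<psi> T = (\<Sum>ev\<in>R. \<eta> ev T)" for T
    using stot2_sector[OF Suc.prems(2), of T] unfolding l0_def M_def R(2) sminus_sum \<eta>_def by simp
  \<comment> \<open>The factor makes \<open>stot2 - l0\<close> map \<open>\<omega> ev\<close> to
    \<open>\<eta> ev\<close>. It is meaningful only for \<open>ev \<noteq> l0\<close>, hence the
    sums over \<open>R - {l0}\<close>.\<close>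
  define \<omega> where "\<omega> ev = (\<lambda>T. complex_of_real (1 / (ev - l0)) * \<eta> ev T)" for ev
  let ?R = "R - {l0}"
  have \<omega>: "finite_energy L \<mu> ori (\<omega> ev)" "sector L N (Suc q) (\<omega> ev)" "stot2 L (\<omega> ev) = (\<lambda>T. complex_of_real ev * \<omega> ev T)"
    if "ev \<in> R" for ev
  proof -
    show "finite_energy L \<mu> ori (\<omega> ev)" "sector L N (Suc q) (\<omega> ev)"
      unfolding \<omega>_def by (rule finite_energy_lin(1)[OF \<eta>(1)[OF that]] sector_lin(1)[OF \<eta>(2)[OF that]])+
    show "stot2 L (\<omega> ev) = (\<lambda>T. complex_of_real ev * \<omega> ev T)"
      unfolding \<omega>_def by (rule ext) (simp only: stot2_lin \<eta>(3)[OF that], simp only: mult_ac)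
  qed
  define \<zeta> where "\<zeta> = (\<lambda>T. \<psi> T - (\<Sum>ev\<in>?R. \<omega> ev T))"
  have z0: "finite_energy L \<mu> ori (\<lambda>T. 0)" "sector L N (Suc q) (\<lambda>T. 0)"
    using finite_energy_lin(1)[OF Suc.prems(1), of 0] sector_lin(1)[OF Suc.prems(2), of 0] by simp_all
  have fin: "finite ?R" using R(1) by simp
  have sums: "finite_energy L \<mu> ori (\<lambda>T. \<Sum>ev\<in>?R. \<omega> ev T) \<and> sector L N (Suc q) (\<lambda>T. \<Sum>ev\<in>?R. \<omega> ev T)"
  proof -
    have "finite_energy L \<mu> ori (\<lambda>T. \<Sum>ev\<in>F. \<omega> ev T) \<and> sector L N (Suc q) (\<lambda>T. \<Sum>ev\<in>F. \<omega> ev T)" if "finite F" "F \<subseteq> R" for F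
      using that
    proof (induction F rule: finite_induct)
      case empty then show ?case using z0 by simp
    next
      case (insert x F)
      then show ?case using \<omega>[of x] finite_energy_lin(2)[of L \<mu> ori "\<omega> x"] sector_lin(2)[of L N "Suc q" "\<omega> x"] by simp
    qed
    then show ?thesis using fin by auto
  qed
  have \<zeta>: "finite_energy L \<mu> ori \<zeta>" "sector L N (Suc q) \<zeta>"
    unfolding \<zeta>_def using sums Suc.prems by (auto intro: finite_energy_lin(3) sector_lin(3))
  have "(\<Sum>ev\<in>?R. stot2 L (\<omega> ev) T - complex_of_real l0 * \<omega> ev T) = (\<Sum>ev\<in>?R. \<eta> ev T)" for T
  proof (intro sum.cong refl)
    fix ev assume l: "ev \<in> ?R"
    have "stot2 L (\<omega> ev) T - complex_of_real l0 * \<omega> ev T = complex_of_real (ev - l0) * complex_of_real (1 / (ev - l0)) * \<eta> ev T"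
      unfolding \<omega>(3)[OF DiffD1[OF l]] by (simp only: of_real_diff left_diff_distrib \<omega>_def mult.assoc)
    also have "complex_of_real (ev - l0) * complex_of_real (1 / (ev - l0)) = 1"
      using l unfolding of_real_mult[symmetric] by simp
    finally show "stot2 L (\<omega> ev) T - complex_of_real l0 * \<omega> ev T = \<eta> ev T" by simp
  qed
  then have \<zeta>st: "stot2 L \<zeta> T - complex_of_real l0 * \<zeta> T = (if l0 \<in> R then \<eta> l0 T else 0)" for T
    using st[of T] R(1) unfolding \<zeta>_def stot2_lin stot2_sum[OF fin]
    by (simp add: sum_subtractf sum_distrib_left algebra_simps sum.remove[of R l0] split: if_splits)
  define \<xi> where "\<xi> = (\<lambda>T. stot2 L \<zeta> T - complex_of_real l0 * \<zeta> T)"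
  have \<xi>: "\<xi> = (if l0 \<in> R then \<eta> l0 else (\<lambda>T. 0))" unfolding \<xi>_def using \<zeta>st by auto
  have \<xi>p: "sector L N (Suc q) \<xi>" "stot2 L \<xi> = (\<lambda>T. complex_of_real l0 * \<xi> T)"
    using \<eta>[of l0] z0 unfolding \<xi> by auto
  \<comment> \<open>A Jordan block is excluded by symmetry: \<open>\<xi>\<close> is both the image
    of \<open>\<zeta>\<close> under \<open>stot2 - l0\<close> and annihilated by
    \<open>stot2 - l0\<close>, hence orthogonal to itself.\<close>
  have "ip (nmodes L) \<xi> \<xi> = 0"
  proof -
    have "ip (nmodes L) \<xi> \<xi> = ip (nmodes L) \<xi> (stot2 L \<zeta>) - complex_of_real l0 * ip (nmodes L) \<xi> \<zeta>"
      using \<xi>_def by (metis (no_types) ip_diff_right ip_scale_right)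
    also have "\<dots> = 0" unfolding ip_form.stot2_left[symmetric] \<xi>p(2) ip_scale_left by simp
    finally show ?thesis .
  qed
  then have "\<xi> = (\<lambda>T. 0)" using ne_state_ip_zero[OF sector_ne_state[OF \<xi>p(1)]] by blast
  then have \<zeta>e: "stot2 L \<zeta> = (\<lambda>T. complex_of_real l0 * \<zeta> T)" unfolding \<xi>_def by (simp add: fun_eq_iff)
  have dec: "\<psi> = (\<lambda>T. \<Sum>ev\<in>insert l0 ?R. (fun_upd \<omega> l0 \<zeta>) ev T)"
  proof
    fix T
    have "(\<Sum>ev\<in>insert l0 ?R. (fun_upd \<omega> l0 \<zeta>) ev T) = \<zeta> T + (\<Sum>ev\<in>?R. (fun_upd \<omega> l0 \<zeta>) ev T)"
      using fin by (subst sum.insert) simp_all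
    also have "(\<Sum>ev\<in>?R. (fun_upd \<omega> l0 \<zeta>) ev T) = (\<Sum>ev\<in>?R. \<omega> ev T)" by (intro sum.cong) auto
    finally show "\<psi> T = (\<Sum>ev\<in>insert l0 ?R. (fun_upd \<omega> l0 \<zeta>) ev T)" by (simp add: \<zeta>_def)
  qed
  show ?case
  proof (intro exI conjI ballI)
    show "finite (insert l0 ?R)" using fin by simp
    show "\<psi> = (\<lambda>T. \<Sum>ev\<in>insert l0 ?R. (fun_upd \<omega> l0 \<zeta>) ev T)" by (rule dec)
    fix ev assume "ev \<in> insert l0 ?R"
    then show "finite_energy L \<mu> ori ((fun_upd \<omega> l0 \<zeta>) ev)" "sector L N (Suc q) ((fun_upd \<omega> l0 \<zeta>) ev)"
      "stot2 L ((fun_upd \<omega> l0 \<zeta>) ev) = (\<lambda>T. complex_of_real ev * (fun_upd \<omega> l0 \<zeta>) ev T)"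
      using \<zeta> \<zeta>e \<omega> by auto
  qed
qed

section \<open>Energy bounds\<close>

definition hform :: "nat \<Rightarrow> real \<Rightarrow> (nat \<Rightarrow> bool) \<Rightarrow> fstate \<Rightarrow> fstate \<Rightarrow> complex" where
  "hform L \<mu> ori \<phi> \<psi> = (\<Sum>b<nbonds L.
     lform L (avec L \<mu> ori (bfst L ori b)) (avec L \<mu> ori (bsnd L ori b)) \<phi> \<psi>
   + lform L (avec L \<mu> ori (bsnd L ori b)) (avec L \<mu> ori (bfst L ori b)) \<phi> \<psi>)"

interpretation hform: spin_form L "hform L \<mu> ori" for L \<mu> ori
  by unfold_locales
    (simp_all add: hform_def lform.scale_left lform.scale_right lform.add_left lform.add_right
      lform.splus_left lform.sminus_left sum.distrib sum_distrib_left distrib_left)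

definition bweight :: "nat \<Rightarrow> real \<Rightarrow> (nat \<Rightarrow> bool) \<Rightarrow> fstate \<Rightarrow> real" where
  "bweight L \<mu> ori \<psi> = (\<Sum>b<nbonds L. \<Sum>\<sigma>\<in>UNIV.
      Re (ip (nmodes L) (lann L (buvec L \<mu> ori b) \<sigma> \<psi>) (lann L (buvec L \<mu> ori b) \<sigma> \<psi>))
    + Re (ip (nmodes L) (lann L (bubvec L \<mu> ori b) \<sigma> \<psi>) (lann L (bubvec L \<mu> ori b) \<sigma> \<psi>)))"

definition double_weight :: "nat \<Rightarrow> fstate \<Rightarrow> real" where
  "double_weight L \<psi> = (\<Sum>z<nsites L. \<Sum>T\<in>Pow {..<nmodes L}.
     if mode z True \<in> T \<and> mode z False \<in> T then (cmod (\<psi> T))\<^sup>2 else 0)"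

lemma ip_lcre_right: "ip (nmodes L) \<phi> (lcre L w \<sigma> \<psi>) = ip (nmodes L) (lann L w \<sigma> \<phi>) \<psi>"
  by (metis ip_lcre ip_cnj)

lemma energy_eq:
  "energy L \<mu> ori t s U \<psi> = t * Re (hform L \<mu> ori \<psi> \<psi>) + s * bweight L \<mu> ori \<psi> + U * double_weight L \<psi>"
proof -
  let ?x = "bfst L ori" and ?y = "bsnd L ori"
  let ?I = "ip (nmodes L)"
  have D: "?I \<psi> (\<lambda>T. \<Sum>z<nsites L. ccre (mode z True) (cann (mode z True) (ccre (mode z False) (cann (mode z False) \<psi>))) T)
    = of_real (double_weight L \<psi>)"
  proof -
    have "?I \<psi> (\<lambda>T. ccre (mode z True) (cann (mode z True) (ccre (mode z False) (cann (mode z False) \<psi>))) T)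
      = of_real (\<Sum>T\<in>Pow {..<nmodes L}. if mode z True \<in> T \<and> mode z False \<in> T then (cmod (\<psi> T))\<^sup>2 else 0)" for z
      unfolding ip_def number_apply of_real_sum
      by (intro sum.cong refl) (simp add: complex_norm_square mult.commute del: of_real_power)
    then show ?thesis unfolding ip_sum_right double_weight_def by simp
  qed
  have h: "hub L \<mu> ori t s U \<psi> = (\<lambda>T. complex_of_real t * (\<Sum>b<nbonds L. \<Sum>\<sigma>\<in>UNIV.
         lcre L (avec L \<mu> ori (?x b)) \<sigma> (lann L (avec L \<mu> ori (?y b)) \<sigma> \<psi>) T
       + lcre L (avec L \<mu> ori (?y b)) \<sigma> (lann L (avec L \<mu> ori (?x b)) \<sigma> \<psi>) T)
   + complex_of_real s * (\<Sum>b<nbonds L. \<Sum>\<sigma>\<in>UNIV.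
         lcre L (buvec L \<mu> ori b) \<sigma> (lann L (buvec L \<mu> ori b) \<sigma> \<psi>) T
       + lcre L (bubvec L \<mu> ori b) \<sigma> (lann L (bubvec L \<mu> ori b) \<sigma> \<psi>) T)
   + complex_of_real U * (\<Sum>z<nsites L. ccre (mode z True) (cann (mode z True) (ccre (mode z False) (cann (mode z False) \<psi>))) T))"
    unfolding hub_def ..
  have "energy L \<mu> ori t s U \<psi> = Re (?I \<psi> (hub L \<mu> ori t s U \<psi>))"
    by (simp add: energy_def ip_def)
  also have "?I \<psi> (hub L \<mu> ori t s U \<psi>) = of_real t * hform L \<mu> ori \<psi> \<psi>
     + of_real s * (\<Sum>b<nbonds L. \<Sum>\<sigma>\<in>UNIV. ?I (lann L (buvec L \<mu> ori b) \<sigma> \<psi>) (lann L (buvec L \<mu> ori b) \<sigma> \<psi>)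
        + ?I (lann L (bubvec L \<mu> ori b) \<sigma> \<psi>) (lann L (bubvec L \<mu> ori b) \<sigma> \<psi>))
     + of_real U * of_real (double_weight L \<psi>)"
    unfolding h ip_add_right ip_scale_right D
    unfolding ip_sum_right ip_add_right ip_lcre_right hform_def lform_def
    by (simp only: sum.distrib)
  finally show ?thesis unfolding bweight_def by simp
qed

lemma bweight_nonneg: "bweight L \<mu> ori \<psi> \<ge> 0"
  unfolding bweight_def by (intro sum_nonneg add_nonneg_nonneg ip_self_nonneg)

lemma double_weight_nonneg: "double_weight L \<psi> \<ge> 0"
  unfolding double_weight_def by (intro sum_nonneg) auto

lemma lann_outside:
  assumes "ne_state L N \<psi>" "\<not> T \<subseteq> {..<nmodes L}"
  shows "lann L w \<sigma> \<psi> T = 0"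
proof -
  have z: "\<psi> (insert j T) = 0" for j using assms unfolding ne_state_def by blast
  show ?thesis by (simp add: lann_def cann_def z cong: if_cong)
qed

lemma finite_energy_iff:
  assumes "ne_state L N \<psi>"
  shows "finite_energy L \<mu> ori \<psi> \<longleftrightarrow> bweight L \<mu> ori \<psi> = 0 \<and> double_weight L \<psi> = 0"
proof
  assume fe: "finite_energy L \<mu> ori \<psi>"
  then have "bweight L \<mu> ori \<psi> = 0" unfolding bweight_def finite_energy_def by simp
  moreover have "double_weight L \<psi> = 0"
    unfolding double_weight_def by (intro sum.neutral ballI) (use finite_energy_no_double[OF fe] in auto)
  ultimately show "bweight L \<mu> ori \<psi> = 0 \<and> double_weight L \<psi> = 0" ..
next
  assume a: "bweight L \<mu> ori \<psi> = 0 \<and> double_weight L \<psi> = 0"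
  have z: "lann L w \<sigma> \<psi> = (\<lambda>T. 0)" if "Re (ip (nmodes L) (lann L w \<sigma> \<psi>) (lann L w \<sigma> \<psi>)) = 0" for w \<sigma>
  proof
    fix T
    show "lann L w \<sigma> \<psi> T = 0"
      using that lann_outside[OF assms] unfolding ip_self_eq_0 by (cases "T \<subseteq> {..<nmodes L}") auto
  qed
  have 1: "lann L (buvec L \<mu> ori b) \<sigma> \<psi> = (\<lambda>T. 0) \<and> lann L (bubvec L \<mu> ori b) \<sigma> \<psi> = (\<lambda>T. 0)" if b: "b < nbonds L" for b \<sigma>
  proof -
    let ?f = "\<lambda>b \<sigma>. Re (ip (nmodes L) (lann L (buvec L \<mu> ori b) \<sigma> \<psi>) (lann L (buvec L \<mu> ori b) \<sigma> \<psi>))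
      + Re (ip (nmodes L) (lann L (bubvec L \<mu> ori b) \<sigma> \<psi>) (lann L (bubvec L \<mu> ori b) \<sigma> \<psi>))"
    have nn: "0 \<le> ?f b \<sigma>" for b \<sigma> by (intro add_nonneg_nonneg ip_self_nonneg)
    have "(\<Sum>b<nbonds L. \<Sum>\<sigma>\<in>UNIV. ?f b \<sigma>) = 0" using a unfolding bweight_def by blast
    then have "\<forall>b\<in>{..<nbonds L}. (\<Sum>\<sigma>\<in>UNIV. ?f b \<sigma>) = 0"
      by (subst (asm) sum_nonneg_eq_0_iff) (auto intro!: sum_nonneg nn)
    then have "(\<Sum>\<sigma>\<in>UNIV. ?f b \<sigma>) = 0" using b by blast
    then have "\<forall>\<sigma>\<in>UNIV. ?f b \<sigma> = 0" by (subst (asm) sum_nonneg_eq_0_iff) (auto intro!: nn)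
    then have "?f b \<sigma> = 0" by blast
    then have "Re (ip (nmodes L) (lann L (buvec L \<mu> ori b) \<sigma> \<psi>) (lann L (buvec L \<mu> ori b) \<sigma> \<psi>)) = 0"
      "Re (ip (nmodes L) (lann L (bubvec L \<mu> ori b) \<sigma> \<psi>) (lann L (bubvec L \<mu> ori b) \<sigma> \<psi>)) = 0"
      using ip_self_nonneg[of "nmodes L" "lann L (buvec L \<mu> ori b) \<sigma> \<psi>"] ip_self_nonneg[of "nmodes L" "lann L (bubvec L \<mu> ori b) \<sigma> \<psi>"]
      by linarith+
    then show ?thesis using z by blast
  qed
  have 2: "cann (mode x True) (cann (mode x False) \<psi>) = (\<lambda>T. 0)" if x: "x < nsites L" for x
  proof
    fix R
    let ?T = "insert (mode x False) (insert (mode x True) R)"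
    have "\<psi> ?T = 0"
    proof (cases "?T \<subseteq> {..<nmodes L}")
      case False then show ?thesis using assms unfolding ne_state_def by blast
    next
      case True
      let ?g = "\<lambda>z T. if mode z True \<in> T \<and> mode z False \<in> T then (cmod (\<psi> T))\<^sup>2 else 0"
      have "\<forall>z\<in>{..<nsites L}. (\<Sum>T\<in>Pow {..<nmodes L}. ?g z T) = 0"
        using a unfolding double_weight_def by (subst (asm) sum_nonneg_eq_0_iff) (auto intro!: sum_nonneg)
      then have "(\<Sum>T\<in>Pow {..<nmodes L}. ?g x T) = 0" using x by blast
      then have "\<forall>T\<in>Pow {..<nmodes L}. ?g x T = 0" by (subst (asm) sum_nonneg_eq_0_iff) auto
      then have "?g x ?T = 0" using True by blast
      then show ?thesis by simp
    qed
    then show "cann (mode x True) (cann (mode x False) \<psi>) R = 0" by (simp add: cann_def)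
  qed
  show "finite_energy L \<mu> ori \<psi>" unfolding finite_energy_def using 1 2 by blast
qed

lemma linear_limit_zero:
  fixes a D l :: real
  assumes "((\<lambda>U. a + U * D) \<longlongrightarrow> l) at_top" "D \<ge> 0"
  shows "D = 0"
proof (rule ccontr)
  assume "D \<noteq> 0"
  then have "D > 0" using assms by simp
  then have "filterlim (\<lambda>U. U * D) at_top at_top"
    by (intro filterlim_at_top_mult_tendsto_pos[OF tendsto_const] filterlim_ident)
  then have "filterlim (\<lambda>U. a + U * D) at_top at_top"
    by (rule filterlim_tendsto_add_at_top[OF tendsto_const])
  then have "filterlim (\<lambda>U. a + U * D) at_infinity at_top"
    by (rule filterlim_at_top_imp_at_infinity)
  then show False using not_tendsto_and_filterlim_at_infinity[OF _ assms(1)] by simp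
qed

text \<open>The energy is affine in \<open>U\<close> and in \<open>s\<close> with nonnegative
  slopes, so the limits are finite only if both slopes vanish, and then the hopping term
  remains.\<close>

lemma lim_energy_iff:
  assumes "ne_state L N \<psi>"
  shows "lim_energy L \<mu> ori t \<psi> E \<longleftrightarrow> finite_energy L \<mu> ori \<psi> \<and> E = t * Re (hform L \<mu> ori \<psi> \<psi>)"
proof
  let ?a = "t * Re (hform L \<mu> ori \<psi> \<psi>)"
  assume "lim_energy L \<mu> ori t \<psi> E"
  then obtain f where f: "\<And>s. s > 0 \<Longrightarrow> ((\<lambda>U. energy L \<mu> ori t s U \<psi>) \<longlongrightarrow> f s) at_top" and fE: "(f \<longlongrightarrow> E) at_top"
    unfolding lim_energy_def by blast
  have D: "double_weight L \<psi> = 0"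
    using f[of 1] unfolding energy_eq by (intro linear_limit_zero[OF _ double_weight_nonneg]) simp
  have fs: "f s = ?a + s * bweight L \<mu> ori \<psi>" if "s > 0" for s
    using f[OF that] unfolding energy_eq D by (simp add: tendsto_const_iff)
  have "((\<lambda>s. ?a + s * bweight L \<mu> ori \<psi>) \<longlongrightarrow> E) at_top"
    by (rule Lim_transform_eventually[OF fE]) (use fs in \<open>auto intro: eventually_mono[OF eventually_gt_at_top[of 0]]\<close>)
  then have B: "bweight L \<mu> ori \<psi> = 0" and "((\<lambda>s. ?a + s * bweight L \<mu> ori \<psi>) \<longlongrightarrow> E) at_top"
    using linear_limit_zero[OF _ bweight_nonneg] by blast+
  then have "E = ?a" by (simp add: tendsto_const_iff)
  then show "finite_energy L \<mu> ori \<psi> \<and> E = ?a" using B D finite_energy_iff[OF assms] by blast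
next
  assume "finite_energy L \<mu> ori \<psi> \<and> E = t * Re (hform L \<mu> ori \<psi> \<psi>)"
  then show "lim_energy L \<mu> ori t \<psi> E"
    unfolding lim_energy_def energy_eq using finite_energy_iff[OF assms, of \<mu> ori]
    by (intro exI[of _ "\<lambda>s. E"]) simp
qed

section \<open>Lower bound on the hopping energy\<close>

lemma two_re_ge: "2 * Re (cnj a * b) \<ge> - ((cmod a)\<^sup>2 + (cmod b)\<^sup>2)"
proof -
  have "0 \<le> (cmod (a + b))\<^sup>2" by simp
  also have "(cmod (a + b))\<^sup>2 = (cmod a)\<^sup>2 + (cmod b)\<^sup>2 + 2 * Re (cnj a * b)"
    unfolding cmod_power2 by (simp add: power2_eq_square algebra_simps)
  finally show ?thesis by simp
qed

text \<open>For each configuration \<open>R\<close> of the other electrons,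
  \<open>2 * Re (cnj a * b)\<close> is at least minus the sum of the two squares. If
  \<open>R\<close> occupies \<open>x\<close> or \<open>y\<close>, one factor vanishes because double
  occupancy is excluded. So each weight is charged only when exactly one end of the bond is
  occupied.\<close>

lemma hop_bound:
  assumes x: "x < n" and y: "y < n" and xy: "x \<noteq> y"
    and nd: "\<And>T z. z < n \<Longrightarrow> mode z True \<in> T \<Longrightarrow> mode z False \<in> T \<Longrightarrow> \<psi> T = 0"
  shows "(\<Sum>\<sigma>\<in>UNIV. 2 * Re (ip (2 * n) (cann (mode x \<sigma>) \<psi>) (cann (mode y \<sigma>) \<psi>)))
    \<ge> - (\<Sum>T\<in>Pow {..<2 * n}. (cmod (\<psi> T))\<^sup>2 * ((if x \<in> occupied T \<and> y \<notin> occupied T then 1 else 0) + (if y \<in> occupied T \<and> x \<notin> occupied T then 1 else 0)))"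
proof -
  let ?P = "{R \<in> Pow {..<2 * n}. x \<notin> occupied R \<and> y \<notin> occupied R}"
  let ?g = "\<lambda>T. (cmod (\<psi> T))\<^sup>2"
  have zero: "cann (mode z \<sigma>) \<psi> R = 0" if "z \<in> occupied R" "z < n" for z \<sigma> R
  proof (cases "mode z \<sigma> \<in> R")
    case False
    then have "mode z True \<in> insert (mode z \<sigma>) R" "mode z False \<in> insert (mode z \<sigma>) R"
      using that(1) by (cases \<sigma>; auto simp: occupied_iff)+
    then show ?thesis using nd[OF that(2)] by (simp add: cann_def)
  qed (simp add: cann_def)
  have sq: "(cmod (cann j \<psi> R))\<^sup>2 \<le> ?g (insert j R)" for j R
  proof -
    have "cmod (fsign R j) = 1" by (simp add: fsign_def norm_power)
    then show ?thesis by (simp add: cann_def norm_mult)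
  qed
  have main: "- (\<Sum>R\<in>?P. ?g (insert (mode x \<sigma>) R) + ?g (insert (mode y \<sigma>) R))
    \<le> 2 * Re (ip (2 * n) (cann (mode x \<sigma>) \<psi>) (cann (mode y \<sigma>) \<psi>))" for \<sigma>
  proof -
    have "2 * Re (ip (2 * n) (cann (mode x \<sigma>) \<psi>) (cann (mode y \<sigma>) \<psi>)) =
      (\<Sum>R\<in>Pow {..<2 * n}. 2 * Re (cnj (cann (mode x \<sigma>) \<psi> R) * cann (mode y \<sigma>) \<psi> R))"
      unfolding ip_def by (simp only: Re_sum sum_distrib_left)
    also have "\<dots> = (\<Sum>R\<in>?P. 2 * Re (cnj (cann (mode x \<sigma>) \<psi> R) * cann (mode y \<sigma>) \<psi> R))"
      using zero x y by (intro sum.mono_neutral_right) auto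
    also have "\<dots> \<ge> (\<Sum>R\<in>?P. - (?g (insert (mode x \<sigma>) R) + ?g (insert (mode y \<sigma>) R)))"
    proof (rule sum_mono)
      fix R
      show "- (?g (insert (mode x \<sigma>) R) + ?g (insert (mode y \<sigma>) R)) \<le> 2 * Re (cnj (cann (mode x \<sigma>) \<psi> R) * cann (mode y \<sigma>) \<psi> R)"
        using two_re_ge[of "cann (mode x \<sigma>) \<psi> R" "cann (mode y \<sigma>) \<psi> R"] sq[of "mode x \<sigma>" R] sq[of "mode y \<sigma>" R] by linarith
    qed
    finally show ?thesis unfolding sum_negf .
  qed
  \<comment> \<open>Adding an electron at the empty site \<open>z\<close> is injective, and the
    results for the two spins differ at \<open>z\<close>; hence no configuration is counted
    twice.\<close>
  have push: "(\<Sum>\<sigma>\<in>UNIV. \<Sum>R\<in>{R \<in> Pow {..<2 * n}. z \<notin> occupied R \<and> w \<notin> occupied R}. ?g (insert (mode z \<sigma>) R))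
    \<le> (\<Sum>T\<in>Pow {..<2 * n}. ?g T * (if z \<in> occupied T \<and> w \<notin> occupied T then 1 else 0))"
    if "z < n" "z \<noteq> w" for z w
  proof -
    let ?Q = "{R \<in> Pow {..<2 * n}. z \<notin> occupied R \<and> w \<notin> occupied R}"
    have fQ: "finite ?Q" by simp
    have inj: "inj_on (insert (mode z \<sigma>)) ?Q" for \<sigma>
    proof (rule inj_onI)
      fix R S assume "R \<in> ?Q" "S \<in> ?Q" "insert (mode z \<sigma>) R = insert (mode z \<sigma>) S"
      moreover from this have "mode z \<sigma> \<notin> R" "mode z \<sigma> \<notin> S" by (cases \<sigma>; auto simp: occupied_iff)+
      ultimately show "R = S" by (metis insert_ident)
    qed
    have reidx: "(\<Sum>T\<in>insert (mode z \<sigma>) ` ?Q. ?g T) = (\<Sum>R\<in>?Q. ?g (insert (mode z \<sigma>) R))" for \<sigma>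
      by (rule sum.reindex[OF inj, unfolded o_def])
    have disj: "insert (mode z True) ` ?Q \<inter> insert (mode z False) ` ?Q = {}"
    proof -
      have "mode z False \<notin> T" if "T \<in> insert (mode z True) ` ?Q" for T using that by (auto simp: occupied_iff)
      moreover have "mode z False \<in> T" if "T \<in> insert (mode z False) ` ?Q" for T using that by auto
      ultimately show ?thesis by blast
    qed
    have sub: "insert (mode z True) ` ?Q \<union> insert (mode z False) ` ?Q \<subseteq> {T \<in> Pow {..<2 * n}. z \<in> occupied T \<and> w \<notin> occupied T}"
      using that by (auto simp: occupied_iff)
    have "(\<Sum>\<sigma>\<in>UNIV. \<Sum>R\<in>?Q. ?g (insert (mode z \<sigma>) R)) =
      (\<Sum>T\<in>insert (mode z True) ` ?Q. ?g T) + (\<Sum>T\<in>insert (mode z False) ` ?Q. ?g T)"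
      unfolding reidx by (simp add: UNIV_bool add.commute)
    also have "\<dots> = (\<Sum>T\<in>insert (mode z True) ` ?Q \<union> insert (mode z False) ` ?Q. ?g T)"
      using fQ disj by (intro sum.union_disjoint[symmetric]) auto
    also have "\<dots> \<le> (\<Sum>T\<in>{T \<in> Pow {..<2 * n}. z \<in> occupied T \<and> w \<notin> occupied T}. ?g T)"
      by (rule sum_mono2[OF _ sub]) auto
    also have "\<dots> = (\<Sum>T\<in>Pow {..<2 * n}. ?g T * (if z \<in> occupied T \<and> w \<notin> occupied T then 1 else 0))"
      by (subst sum.inter_filter) (auto intro!: sum.cong)
    finally show ?thesis .
  qed
  have "{R \<in> Pow {..<2 * n}. y \<notin> occupied R \<and> x \<notin> occupied R} = ?P" by auto
  then have "(\<Sum>\<sigma>\<in>UNIV. \<Sum>R\<in>?P. ?g (insert (mode x \<sigma>) R) + ?g (insert (mode y \<sigma>) R))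
    \<le> (\<Sum>T\<in>Pow {..<2 * n}. ?g T * ((if x \<in> occupied T \<and> y \<notin> occupied T then 1 else 0) + (if y \<in> occupied T \<and> x \<notin> occupied T then 1 else 0)))"
    using push[OF x xy] push[of y x] y xy by (simp add: sum.distrib distrib_left)
  moreover have "(\<Sum>\<sigma>\<in>UNIV. - (\<Sum>R\<in>?P. ?g (insert (mode x \<sigma>) R) + ?g (insert (mode y \<sigma>) R)))
    \<le> (\<Sum>\<sigma>\<in>UNIV. 2 * Re (ip (2 * n) (cann (mode x \<sigma>) \<psi>) (cann (mode y \<sigma>) \<psi>)))"
    by (rule sum_mono) (rule main)
  ultimately show ?thesis unfolding sum_negf by linarith
qed

text \<open>Every hole is the end of six bonds. A bond between two holes is counted twice in this
  way although no electron can hop across it.\<close>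

lemma boundary_bonds:
  assumes "L > 0" "A \<subseteq> {..<L\<^sup>2}"
  shows "(\<Sum>b<nbonds L. (if bfst L ori b \<in> A \<and> bsnd L ori b \<notin> A then 1 else 0) + (if bsnd L ori b \<in> A \<and> bfst L ori b \<notin> A then 1 else 0))
    = 6 * real (L\<^sup>2 - card A) - 2 * real (hole_bonds L A)"
proof -
  let ?h = "\<lambda>x. if x \<notin> A then 1 else 0 :: real"
  let ?hh = "\<lambda>x y. if x \<notin> A \<and> y \<notin> A then 1 else 0 :: real"
  have "(\<Sum>b<nbonds L. (if bfst L ori b \<in> A \<and> bsnd L ori b \<notin> A then 1 else 0) + (if bsnd L ori b \<in> A \<and> bfst L ori b \<notin> A then 1 else 0))
    = (\<Sum>b<nbonds L. (?h (bfst L ori b) + ?h (bsnd L ori b)) - 2 * ?hh (bfst L ori b) (bsnd L ori b))"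
    by (intro sum.cong refl) auto
  also have "\<dots> = 6 * (\<Sum>x<L\<^sup>2. ?h x) - 2 * (\<Sum>b<nbonds L. ?hh (bfst L ori b) (bsnd L ori b))"
    unfolding sum_subtractf sum_distrib_left[symmetric] sum_bond_ends[OF assms(1), of ?h ori] ..
  also have "(\<Sum>b<nbonds L. ?hh (bfst L ori b) (bsnd L ori b)) = (\<Sum>x<L\<^sup>2. \<Sum>d<3. ?hh x (nbr L x d))"
    by (rule sum_bonds_sym) auto
  also have "\<dots> = real (hole_bonds L A)" unfolding hole_bonds_def of_nat_sum by (intro sum.cong refl) simp
  also have "(\<Sum>x<L\<^sup>2. ?h x) = real (card ({..<L\<^sup>2} - A))"
    by (simp add: sum.If_cases Int_def set_diff_eq)
  also have "card ({..<L\<^sup>2} - A) = L\<^sup>2 - card A" using assms(2) by (simp add: card_Diff_subset finite_subset)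
  finally show ?thesis .
qed

lemma nbr_neq:
  assumes "L \<ge> 3"
  shows "nbr L x d \<noteq> x"
proof
  assume e: "nbr L x d = x"
  have L0: "L > 0" using assms by simp
  have a: "nbr L x d = msite L (x div L + dirp d) (x mod L + dirq L d)" by (simp add: nbr_shift[OF L0] shift_def)
  have "(x div L + dirp d) mod L = x div L" "(x mod L + dirq L d) mod L = x mod L"
    using msite_div_mod[OF L0, of "x div L + dirp d" "x mod L + dirq L d"] unfolding a[symmetric] e by simp_all
  moreover have "x div L < L" if "x < L\<^sup>2" using that by (rule site_div_less)
  moreover have "x < L\<^sup>2" using e nbr_less[OF L0] by metis
  ultimately have "x div L < L" "x mod L < L" "(x div L + dirp d) mod L = x div L" "(x mod L + dirq L d) mod L = x mod L" using L0 by auto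
  moreover have "(i + 1) mod L \<noteq> i" if "i < L" for i
    using that assms by (cases "i + 1 = L") auto
  ultimately show False by (cases "d = 1") (auto simp: dirp_def dirq_def)
qed

lemma bond_neq: "L \<ge> 3 \<Longrightarrow> bfst L ori b \<noteq> bsnd L ori b"
  using nbr_neq by (auto simp: bfst_def bsnd_def) metis

text \<open>The bond estimates add up to minus the weighted number of bonds between an electron and
  a hole, evaluated per configuration by \<open>boundary_bonds\<close>. Restriction to the
  triangular lattice rescales energy and norm by the same power of
  \<open>kappa \<mu>\<close>.\<close>

lemma hform_lower_bound:
  assumes L: "L \<ge> 3" and fe: "finite_energy L \<mu> ori \<psi>" and ne: "ne_state L (Suc N) \<psi>"
    and w: "\<And>T. T \<subseteq> {..<2 * L\<^sup>2} \<Longrightarrow> \<psi> T \<noteq> 0 \<Longrightarrow> w \<le> 2 * real (hole_bonds L (occupied T))"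
  shows "Re (hform L \<mu> ori \<psi> \<psi>) \<ge> (w - 6 * real (L\<^sup>2 - Suc N)) * Re (ip (nmodes L) \<psi> \<psi>)"
proof -
  have L0: "L > 0" using L by simp
  let ?x = "bfst L ori" and ?y = "bsnd L ori"
  let ?K = "kappa \<mu> ^ (2 * Suc N)" and ?n = "L\<^sup>2"
  let ?g = "\<lambda>T. (cmod (\<psi> T))\<^sup>2"
  let ?F = "\<lambda>x y. \<Sum>\<sigma>\<in>UNIV. ip (2 * ?n) (cann (mode x \<sigma>) \<psi>) (cann (mode y \<sigma>) \<psi>)"
  let ?E = "\<lambda>T b. (if ?x b \<in> occupied T \<and> ?y b \<notin> occupied T then 1 else 0) + (if ?y b \<in> occupied T \<and> ?x b \<notin> occupied T then 1 else 0) :: real"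
  have K: "?K > 0" using kappa_pos by simp
  have nd: "\<psi> T = 0" if "z < ?n" "mode z True \<in> T" "mode z False \<in> T" for z T
    using finite_energy_no_double[OF fe site_less(1)[OF that(1)]] that by blast
  have bond: "- (\<Sum>T\<in>Pow {..<2 * ?n}. ?g T * ?E T b) \<le> Re (?F (?x b) (?y b) + ?F (?y b) (?x b))" if "b < nbonds L" for b
  proof -
    have "?F (?y b) (?x b) = cnj (?F (?x b) (?y b))" by (simp add: ip_cnj)
    then have "Re (?F (?y b) (?x b)) = Re (?F (?x b) (?y b))" by (simp only: cnj.sel)
    then have "Re (?F (?x b) (?y b) + ?F (?y b) (?x b)) = (\<Sum>\<sigma>\<in>UNIV. 2 * Re (ip (2 * ?n) (cann (mode (?x b) \<sigma>) \<psi>) (cann (mode (?y b) \<sigma>) \<psi>)))"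
      by (simp add: sum_distrib_left)
    then show ?thesis
      using hop_bound[of "?x b" ?n "?y b" \<psi>, OF bond_less[OF L0 that] bond_neq[OF L] nd] by simp
  qed
  have T: "w - 6 * real (?n - Suc N) \<le> - (\<Sum>b<nbonds L. ?E T b)" if T: "T \<subseteq> {..<2 * ?n}" "\<psi> T \<noteq> 0" for T
  proof -
    have p: "occupied T \<subseteq> {..<?n}" using T(1) unfolding occupied_def by auto
    have nd2: "\<not> (mode z True \<in> T \<and> mode z False \<in> T)" for z
    proof (cases "z < ?n")
      case True then show ?thesis using nd T(2) by blast
    next
      case False then show ?thesis using p by (auto simp: occupied_iff)
    qed
    have "card (occupied T) = card T" using card_config[of "occupied T"] config_occupied[OF nd2] by metis
    also have "\<dots> = Suc N" using ne T(2) unfolding ne_state_def by blast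
    finally have c: "card (occupied T) = Suc N" .
    show ?thesis using boundary_bonds[OF L0 p, of ori] w[OF T] unfolding c by linarith
  qed
  have "(w - 6 * real (?n - Suc N)) * (\<Sum>T\<in>Pow {..<2 * ?n}. ?g T) = (\<Sum>T\<in>Pow {..<2 * ?n}. ?g T * (w - 6 * real (?n - Suc N)))"
    by (simp add: sum_distrib_left mult.commute)
  also have "\<dots> \<le> (\<Sum>T\<in>Pow {..<2 * ?n}. ?g T * (- (\<Sum>b<nbonds L. ?E T b)))"
  proof (rule sum_mono)
    fix T assume "T \<in> Pow {..<2 * ?n}"
    then show "?g T * (w - 6 * real (?n - Suc N)) \<le> ?g T * (- (\<Sum>b<nbonds L. ?E T b))"
      using T[of T] by (cases "\<psi> T = 0") (simp, intro mult_left_mono, auto)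
  qed
  also have "\<dots> = (\<Sum>b<nbonds L. - (\<Sum>T\<in>Pow {..<2 * ?n}. ?g T * ?E T b))"
    by (simp only: mult_minus_right sum_negf sum_distrib_left) (subst sum.swap, rule refl)
  also have "\<dots> \<le> (\<Sum>b<nbonds L. Re (?F (?x b) (?y b) + ?F (?y b) (?x b)))"
    by (rule sum_mono) (use bond in simp)
  finally have "?K * ((w - 6 * real (?n - Suc N)) * (\<Sum>T\<in>Pow {..<2 * ?n}. ?g T)) \<le> ?K * (\<Sum>b<nbonds L. Re (?F (?x b) (?y b) + ?F (?y b) (?x b)))"
    using K by (intro mult_left_mono) auto
  moreover have "?K * (\<Sum>b<nbonds L. Re (?F (?x b) (?y b) + ?F (?y b) (?x b))) = Re (hform L \<mu> ori \<psi> \<psi>)"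
  proof -
    have "hform L \<mu> ori \<psi> \<psi> = (\<Sum>b<nbonds L. of_real ?K * (?F (?x b) (?y b) + ?F (?y b) (?x b)))"
      unfolding hform_def using bond_less[OF L0]
      by (intro sum.cong refl) (simp add: finite_energy_lform[OF L0 fe fe ne ne] distrib_left)
    then show ?thesis by (simp only: Re_sum Re_complex_of_real sum_distrib_left) simp
  qed
  moreover have "Re (ip (nmodes L) \<psi> \<psi>) = ?K * (\<Sum>T\<in>Pow {..<2 * ?n}. ?g T)"
    by (subst finite_energy_ip[OF L0 fe fe ne ne]) (simp add: ip_self)
  ultimately show ?thesis by (simp add: mult_ac)
qed

section \<open>Fully polarized trial states\<close>

lemma sum_cis:
  assumes "L > 0"
  shows "(\<Sum>n<L. cis (2 * pi * real_of_int m * real n / real L)) = (if int L dvd m then of_nat L else 0)"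
proof -
  let ?z = "cis (2 * pi * real_of_int m / real L)"
  have p: "cis (2 * pi * real_of_int m * real n / real L) = ?z ^ n" for n
  proof -
    have "2 * pi * real_of_int m * real n / real L = real n * (2 * pi * real_of_int m / real L)" by simp
    then show ?thesis by (simp only: Complex.DeMoivre)
  qed
  have zL: "?z ^ L = 1"
  proof -
    have "?z ^ L = cis (2 * pi * real_of_int m)" using assms by (simp add: Complex.DeMoivre)
    then show ?thesis by (simp add: cis_multiple_2pi)
  qed
  have iff: "?z = 1 \<longleftrightarrow> int L dvd m"
  proof
    assume "?z = 1"
    then have "cos (2 * pi * real_of_int m / real L) = 1" by (simp add: complex_eq_iff)
    then obtain n :: int where "2 * pi * real_of_int m / real L = of_int n * 2 * pi" by (auto simp: cos_one_2pi_int)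
    then have "real_of_int m = of_int n * real L" using assms by (simp add: field_simps)
    then have "real_of_int m = real_of_int (n * int L)" by simp
    then have "m = n * int L" unfolding of_int_eq_iff .
    then show "int L dvd m" by simp
  next
    assume "int L dvd m"
    then obtain n where "m = int L * n" by blast
    then have "2 * pi * real_of_int m / real L = 2 * pi * real_of_int n" using assms by simp
    then show "?z = 1" by (simp add: cis_multiple_2pi)
  qed
  show ?thesis
  proof (cases "?z = 1")
    case True
    then show ?thesis using iff unfolding p by simp
  next
    case False
    then show ?thesis using iff zL geometric_sum[OF False, of L] unfolding p by simp
  qed
qed

definition ang :: "nat \<Rightarrow> int \<times> int \<Rightarrow> real \<Rightarrow> real \<Rightarrow> real" where
  "ang L k p q = 2 * pi * (real_of_int (fst k) * p + real_of_int (snd k) * q) / real L"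

text \<open>Plane waves are replaced by real orbitals because \<^const>\<open>lcre\<close> only takes real weights; the
  addition formula for \<open>cas x * cas y\<close> still makes them orthogonal.\<close>

definition cas :: "real \<Rightarrow> real" where "cas x = cos x + sin x"

definition wave :: "nat \<Rightarrow> int \<times> int \<Rightarrow> nat \<Rightarrow> real" where
  "wave L k x = cas (ang L k (real (x div L)) (real (x mod L))) / real L"

definition disp :: "nat \<Rightarrow> int \<times> int \<Rightarrow> real" where
  "disp L k = 2 * (cos (ang L k 1 0) + cos (ang L k 0 1) + cos (ang L k 1 (-1)))"

lemma cas_periodic: "cas (x + 2 * pi * real_of_int n) = cas x"
proof -
  have "cos (2 * pi * real_of_int n) = 1" "sin (2 * pi * real_of_int n) = 0"
    using cos_int_2pin[of n] sin_int_2pin[of n] by simp_all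
  then show ?thesis by (simp add: cas_def cos_add sin_add)
qed

lemma cas_mult: "cas x * cas y = cos (x - y) + sin (x + y)"
  by (simp add: cas_def cos_diff sin_add algebra_simps)

lemma cas_add_diff: "cas (x + y) + cas (x - y) = 2 * cos y * cas x"
  by (simp add: cas_def cos_diff sin_diff cos_add sin_add algebra_simps)

lemma wave_msite:
  assumes "L > 0"
  shows "wave L k (msite L i j) = cas (ang L k (real i) (real j)) / real L"
proof -
  have r: "real n = real (n mod L) + real L * real (n div L)" for n
    by (metis of_nat_add of_nat_mult mod_mult_div_eq)
  have "ang L k (real i) (real j) = ang L k (real (i mod L)) (real (j mod L)) +
     2 * pi * real_of_int (fst k * int (i div L) + snd k * int (j div L))"
    unfolding ang_def r[of i] r[of j] using assms by (simp add: field_simps)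
  then have "cas (ang L k (real i) (real j)) = cas (ang L k (real (i mod L)) (real (j mod L)))"
    by (simp only: cas_periodic)
  then show ?thesis using assms by (simp add: wave_def)
qed

text \<open>A single shift mixes \<open>cas x\<close> with \<open>cas (- x)\<close>; the mixed terms
  cancel only in the sum over a shift and its inverse.\<close>

lemma wave_shift:
  assumes "L > 0" "p \<le> L" "q \<le> L" "x < L\<^sup>2"
  shows "wave L k (shift L p q x) + wave L k (shift L (L - p) (L - q) x) = 2 * cos (ang L k (real p) (real q)) * wave L k x"
proof -
  let ?i = "x div L" and ?j = "x mod L"
  let ?t = "ang L k (real ?i) (real ?j)" and ?a = "ang L k (real p) (real q)"
  have "wave L k (shift L p q x) = cas (?t + ?a) / real L"
    unfolding shift_def wave_msite[OF assms(1)]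
    by (simp add: ang_def ring_distribs add_divide_distrib[symmetric] add_ac)
  moreover have "wave L k (shift L (L - p) (L - q) x) = cas (?t - ?a) / real L"
  proof -
    have "ang L k (real (?i + (L - p))) (real (?j + (L - q))) = (?t - ?a) + 2 * pi * real_of_int (fst k + snd k)"
      using assms unfolding ang_def by (simp add: of_nat_diff field_simps)
    then show ?thesis unfolding shift_def wave_msite[OF assms(1)] by (simp only: cas_periodic)
  qed
  moreover have "wave L k x = cas ?t / real L" by (rule wave_def)
  ultimately show ?thesis using cas_add_diff[of ?t ?a] by (simp add: add_divide_distrib[symmetric])
qed

text \<open>In \<open>cas_mult\<close> the cosine of the difference yields the orthogonality
  relation of plane waves. The sine of the sum contributes the imaginary part of an exponential sum
  that is always real, hence nothing.\<close>

lemma wave_orthonormal: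
  assumes "L > 0"
  shows "(\<Sum>x<L\<^sup>2. wave L k x * wave L k' x) =
    (if int L dvd fst k - fst k' \<and> int L dvd snd k - snd k' then 1 else 0)"
proof -
  have prod: "(\<Sum>i<L. \<Sum>j<L. cis (ang L m (real i) (real j))) =
    (if int L dvd fst m \<and> int L dvd snd m then of_real ((real L)\<^sup>2) else 0)" for m
  proof -
    have "cis (ang L m (real i) (real j)) = cis (2 * pi * real_of_int (fst m) * real i / real L) * cis (2 * pi * real_of_int (snd m) * real j / real L)" for i j
      by (simp add: cis_mult ang_def ring_distribs add_divide_distrib mult_ac)
    then have "(\<Sum>i<L. \<Sum>j<L. cis (ang L m (real i) (real j))) = (\<Sum>i<L. cis (2 * pi * real_of_int (fst m) * real i / real L)) * (\<Sum>j<L. cis (2 * pi * real_of_int (snd m) * real j / real L))"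
      by (simp add: sum_product)
    then show ?thesis unfolding sum_cis[OF assms] by (simp add: power2_eq_square)
  qed
  let ?d = "(fst k - fst k', snd k - snd k')" and ?s = "(fst k + fst k', snd k + snd k')"
  have "(\<Sum>x<L\<^sup>2. wave L k x * wave L k' x) = (\<Sum>i<L. \<Sum>j<L. (cos (ang L ?d (real i) (real j)) + sin (ang L ?s (real i) (real j))) / (real L)\<^sup>2)"
    unfolding sum_msite[OF assms] wave_msite[OF assms]
  proof (intro sum.cong refl)
    fix i j
    have "ang L k (real i) (real j) - ang L k' (real i) (real j) = ang L ?d (real i) (real j)"
      "ang L k (real i) (real j) + ang L k' (real i) (real j) = ang L ?s (real i) (real j)"
      unfolding ang_def by (simp_all add: ring_distribs add_divide_distrib diff_divide_distrib)
    then show "cas (ang L k (real i) (real j)) / real L * (cas (ang L k' (real i) (real j)) / real L) =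
       (cos (ang L ?d (real i) (real j)) + sin (ang L ?s (real i) (real j))) / (real L)\<^sup>2"
      using cas_mult[of "ang L k (real i) (real j)" "ang L k' (real i) (real j)"] by (simp add: power2_eq_square)
  qed
  also have "\<dots> = (Re (\<Sum>i<L. \<Sum>j<L. cis (ang L ?d (real i) (real j))) + Im (\<Sum>i<L. \<Sum>j<L. cis (ang L ?s (real i) (real j)))) / (real L)\<^sup>2"
    by (simp add: sum.distrib flip: sum_divide_distrib)
  also have "\<dots> = (if int L dvd fst k - fst k' \<and> int L dvd snd k - snd k' then 1 else 0)"
    unfolding prod using assms by simp
  finally show ?thesis .
qed

lemma wave_eigen:
  assumes "L > 0"
  shows "(\<Sum>b<nbonds L. wave L k (bsnd L ori b) * f (bfst L ori b) + wave L k (bfst L ori b) * f (bsnd L ori b))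
    = disp L k * (\<Sum>x<L\<^sup>2. wave L k x * f x)"
proof -
  let ?w = "wave L k"
  have dir: "dirp d \<le> L" "dirq L d \<le> L" for d using assms by (auto simp: dirp_def dirq_def)
  have d: "(\<Sum>x<L\<^sup>2. ?w (nbr L x d) * f x + ?w x * f (nbr L x d)) =
      2 * cos (ang L k (real (dirp d)) (real (dirq L d))) * (\<Sum>x<L\<^sup>2. ?w x * f x)" for d
  proof -
    have "(\<Sum>x<L\<^sup>2. ?w x * f (nbr L x d)) = (\<Sum>x<L\<^sup>2. ?w (shift L (L - dirp d) (L - dirq L d) x) * f x)"
      using sum_shift[OF assms, of "dirp d" "L - dirp d" "dirq L d" "L - dirq L d" "\<lambda>y x. ?w x * f y"] dir assms
      by (simp add: nbr_shift)
    then have "(\<Sum>x<L\<^sup>2. ?w (nbr L x d) * f x + ?w x * f (nbr L x d)) =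
      (\<Sum>x<L\<^sup>2. (?w (shift L (dirp d) (dirq L d) x) + ?w (shift L (L - dirp d) (L - dirq L d) x)) * f x)"
      using assms by (simp add: sum.distrib distrib_right nbr_shift)
    also have "\<dots> = (\<Sum>x<L\<^sup>2. 2 * cos (ang L k (real (dirp d)) (real (dirq L d))) * (?w x * f x))"
      by (intro sum.cong refl) (simp add: wave_shift[OF assms dir])
    finally show ?thesis by (simp add: sum_distrib_left)
  qed
  have "ang L k 1 (real (L - 1)) = ang L k 1 (-1) + 2 * pi * real_of_int (snd k)"
    unfolding ang_def using assms by (simp add: of_nat_diff field_simps)
  then have c2: "cos (ang L k 1 (real (L - 1))) = cos (ang L k 1 (-1))"
    using cos_int_2pin[of "snd k"] sin_int_2pin[of "snd k"] by (simp add: cos_add)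
  have "(\<Sum>b<nbonds L. ?w (bsnd L ori b) * f (bfst L ori b) + ?w (bfst L ori b) * f (bsnd L ori b)) =
    (\<Sum>x<L\<^sup>2. \<Sum>d<3. ?w (nbr L x d) * f x + ?w x * f (nbr L x d))"
    by (rule sum_bonds_sym[where f="\<lambda>x y. ?w y * f x + ?w x * f y"]) (rule add.commute)
  also have "\<dots> = (\<Sum>d<3. 2 * cos (ang L k (real (dirp d)) (real (dirq L d))) * (\<Sum>x<L\<^sup>2. ?w x * f x))"
    by (subst sum.swap) (simp only: d)
  also have "\<dots> = disp L k * (\<Sum>x<L\<^sup>2. ?w x * f x)"
  proof -
    have "{..<3::nat} = {0, 1, 2}" by auto
    then show ?thesis using c2 by (simp add: disp_def dirp_def dirq_def algebra_simps)
  qed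
  finally show ?thesis .
qed

section \<open>One-electron orbitals built from the waves\<close>

lemma avec_values:
  assumes "x < L\<^sup>2"
  shows "y < L\<^sup>2 \<Longrightarrow> avec L \<mu> ori y x = (if x = y then 1 / kappa \<mu> else 0)"
    "b < nbonds L \<Longrightarrow> avec L \<mu> ori x (usite L b) = \<mu> / kappa \<mu> * (ind (bfst L ori b = x) + ind (bsnd L ori b = x))"
    "b < nbonds L \<Longrightarrow> avec L \<mu> ori x (ubsite L b) = \<mu> / kappa \<mu> * (- ind (bfst L ori b = x) + ind (bsnd L ori b = x))"
proof -
  have ne: "usite L b \<noteq> z" "ubsite L b \<noteq> z" if "z < L\<^sup>2" for b z using that by (auto simp: usite_def ubsite_def)
  show "avec L \<mu> ori y x = (if x = y then 1 / kappa \<mu> else 0)" if "y < L\<^sup>2"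
  proof -
    have "x \<noteq> usite L b" "x \<noteq> ubsite L b" for b using assms by (auto simp: usite_def ubsite_def)
    then show ?thesis unfolding avec_def kappa_def by (simp add: ind_def cong: if_cong)
  qed
  have u: "usite L b = usite L b' \<longleftrightarrow> b = b'" "ubsite L b = ubsite L b' \<longleftrightarrow> b = b'" for b b'
    by (auto simp: usite_def ubsite_def)
  have s: "(\<Sum>b'<nbonds L. if P b' then g b' else 0) = (if P b then g b else 0)"
    if "b < nbonds L" "\<And>b'. b' \<noteq> b \<Longrightarrow> b' < nbonds L \<Longrightarrow> g b' = 0" for b and P :: "nat \<Rightarrow> bool" and g :: "nat \<Rightarrow> real"
  proof -
    have "(\<Sum>b'<nbonds L. if P b' then g b' else 0) = (\<Sum>b'\<in>{b}. if P b' then g b' else 0)"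
      using that by (intro sum.mono_neutral_right) auto
    then show ?thesis by simp
  qed
  show "avec L \<mu> ori x (usite L b) = \<mu> / kappa \<mu> * (ind (bfst L ori b = x) + ind (bsnd L ori b = x))" if b: "b < nbonds L"
  proof -
    have n: "usite L b \<noteq> ubsite L b'" "usite L b \<noteq> x" for b' using b assms by (auto simp: usite_def ubsite_def nbonds_def)
    show ?thesis unfolding avec_def kappa_def[symmetric]
      by (subst s[OF b], simp add: n u ind_def, subst s[OF b]) (simp_all add: n u ind_def)
  qed
  show "avec L \<mu> ori x (ubsite L b) = \<mu> / kappa \<mu> * (- ind (bfst L ori b = x) + ind (bsnd L ori b = x))" if b: "b < nbonds L"
  proof -
    have n: "ubsite L b \<noteq> x" "b' < nbonds L \<Longrightarrow> ubsite L b \<noteq> usite L b'" for b' using b assms by (auto simp: usite_def ubsite_def nbonds_def)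
    show ?thesis unfolding avec_def kappa_def[symmetric]
      by (subst s[OF b], simp add: n n(2)[OF b] u ind_def, subst s[OF b]) (simp_all add: n n(2)[OF b] u ind_def)
  qed
qed

text \<open>The continuation of a wave to the auxiliary sites that is orthogonal to all
  \<open>b\<close> vectors.\<close>

definition orbital :: "nat \<Rightarrow> real \<Rightarrow> (nat \<Rightarrow> bool) \<Rightarrow> int \<times> int \<Rightarrow> nat \<Rightarrow> real" where
  "orbital L \<mu> ori k z = (\<Sum>x<L\<^sup>2. wave L k x * avec L \<mu> ori x z)"

lemma orbital_site:
  assumes "x < L\<^sup>2"
  shows "orbital L \<mu> ori k x = wave L k x / kappa \<mu>"
proof -
  have "orbital L \<mu> ori k x = (\<Sum>y<L\<^sup>2. if y = x then wave L k x / kappa \<mu> else 0)"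
    unfolding orbital_def using assms by (intro sum.cong refl) (auto simp: avec_values)
  then show ?thesis using assms by simp
qed

text \<open>By linearity it suffices that each \<open>avec\<close> satisfies the conditions: its
  value at an auxiliary site is \<open>\<mu>\<close> times the sum, or the negative difference, of
  its values at the two ends of the bond.\<close>

lemma bkill_orbital:
  assumes "L > 0"
  shows "bkill L \<mu> ori (\<lambda>z. complex_of_real (orbital L \<mu> ori k z))"
proof -
  have i: "(\<Sum>x<L\<^sup>2. wave L k x * ind (y = x)) = wave L k y" if "y < L\<^sup>2" for y
  proof -
    have "(\<Sum>x<L\<^sup>2. wave L k x * ind (y = x)) = (\<Sum>x<L\<^sup>2. if x = y then wave L k y else 0)"
      by (intro sum.cong refl) (auto simp: ind_def)
    then show ?thesis using that by simp
  qed
  have "orbital L \<mu> ori k (usite L b) = \<mu> * (orbital L \<mu> ori k (bfst L ori b) + orbital L \<mu> ori k (bsnd L ori b))"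
    "orbital L \<mu> ori k (ubsite L b) = - \<mu> * (orbital L \<mu> ori k (bfst L ori b) - orbital L \<mu> ori k (bsnd L ori b))"
    if b: "b < nbonds L" for b
  proof -
    let ?x = "bfst L ori b" and ?y = "bsnd L ori b"
    note lt = bond_less[OF assms b, of ori]
    have "orbital L \<mu> ori k (usite L b) = \<mu> / kappa \<mu> * ((\<Sum>x<L\<^sup>2. wave L k x * ind (?x = x)) + (\<Sum>x<L\<^sup>2. wave L k x * ind (?y = x)))"
      unfolding orbital_def sum.distrib[symmetric] sum_distrib_left
      by (intro sum.cong refl) (simp add: avec_values(2)[OF _ b] algebra_simps)
    then show "orbital L \<mu> ori k (usite L b) = \<mu> * (orbital L \<mu> ori k ?x + orbital L \<mu> ori k ?y)"
      using lt by (simp add: i orbital_site add_divide_distrib distrib_left)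
    have "orbital L \<mu> ori k (ubsite L b) = \<mu> / kappa \<mu> * ((\<Sum>x<L\<^sup>2. wave L k x * ind (?y = x)) - (\<Sum>x<L\<^sup>2. wave L k x * ind (?x = x)))"
      unfolding orbital_def sum_subtractf[symmetric] sum_distrib_left
      by (intro sum.cong refl) (simp add: avec_values(3)[OF _ b] algebra_simps)
    then show "orbital L \<mu> ori k (ubsite L b) = - \<mu> * (orbital L \<mu> ori k ?x - orbital L \<mu> ori k ?y)"
      using lt by (simp add: i orbital_site diff_divide_distrib right_diff_distrib)
  qed
  then show ?thesis unfolding bkill_def by simp
qed

text \<open>On the lattice an orbital is the wave divided by \<open>kappa \<mu>\<close>, and
  \<open>sum_avec\<close> restores this factor; so overlaps of orbitals reduce to overlaps of
  waves.\<close>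

lemma orbital_products:
  assumes "L > 0"
  shows "x < L\<^sup>2 \<Longrightarrow> (\<Sum>z<nsites L. avec L \<mu> ori x z * orbital L \<mu> ori k z) = wave L k x"
    "b < nbonds L \<Longrightarrow> (\<Sum>z<nsites L. buvec L \<mu> ori b z * orbital L \<mu> ori k z) = 0"
    "b < nbonds L \<Longrightarrow> (\<Sum>z<nsites L. bubvec L \<mu> ori b z * orbital L \<mu> ori k z) = 0"
    "(\<Sum>z<nsites L. orbital L \<mu> ori k' z * orbital L \<mu> ori k z) = (\<Sum>x<L\<^sup>2. wave L k' x * wave L k x)"
proof -
  show a: "(\<Sum>z<nsites L. avec L \<mu> ori x z * orbital L \<mu> ori k z) = wave L k x" if x: "x < L\<^sup>2" for x
  proof -
    have "complex_of_real (\<Sum>z<nsites L. avec L \<mu> ori x z * orbital L \<mu> ori k z) = complex_of_real (wave L k x)"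
      using sum_avec[OF assms x bkill_orbital[OF assms], of \<mu> ori k] kappa_pos[of \<mu>] by (simp add: orbital_site[OF x])
    then show ?thesis unfolding of_real_eq_iff .
  qed
  show "(\<Sum>z<nsites L. buvec L \<mu> ori b z * orbital L \<mu> ori k z) = 0"
    "(\<Sum>z<nsites L. bubvec L \<mu> ori b z * orbital L \<mu> ori k z) = 0" if "b < nbonds L"
  proof -
    have "complex_of_real (\<Sum>z<nsites L. buvec L \<mu> ori b z * orbital L \<mu> ori k z) = 0"
      "complex_of_real (\<Sum>z<nsites L. bubvec L \<mu> ori b z * orbital L \<mu> ori k z) = 0"
      using bkill_orbital[OF assms, of \<mu> ori k, unfolded bkill_iff[OF assms]] that by simp_all
    then show "(\<Sum>z<nsites L. buvec L \<mu> ori b z * orbital L \<mu> ori k z) = 0"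
      "(\<Sum>z<nsites L. bubvec L \<mu> ori b z * orbital L \<mu> ori k z) = 0" unfolding of_real_eq_0_iff .
  qed
  have "(\<Sum>z<nsites L. orbital L \<mu> ori k' z * orbital L \<mu> ori k z) =
    (\<Sum>z<nsites L. \<Sum>x<L\<^sup>2. wave L k' x * (avec L \<mu> ori x z * orbital L \<mu> ori k z))"
    unfolding orbital_def[of L \<mu> ori k'] by (simp add: sum_distrib_right mult.assoc)
  also have "\<dots> = (\<Sum>x<L\<^sup>2. wave L k' x * (\<Sum>z<nsites L. avec L \<mu> ori x z * orbital L \<mu> ori k z))"
    by (subst sum.swap) (simp add: sum_distrib_left)
  also have "\<dots> = (\<Sum>x<L\<^sup>2. wave L k' x * wave L k x)" by (simp add: a)
  finally show "(\<Sum>z<nsites L. orbital L \<mu> ori k' z * orbital L \<mu> ori k z) = (\<Sum>x<L\<^sup>2. wave L k' x * wave L k x)" .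
qed

section \<open>Slater determinants and their energy\<close>

definition hop :: "nat \<Rightarrow> real \<Rightarrow> (nat \<Rightarrow> bool) \<Rightarrow> fop" where
  "hop L \<mu> ori \<psi> = (\<lambda>T. \<Sum>b<nbonds L. \<Sum>\<sigma>\<in>UNIV.
         lcre L (avec L \<mu> ori (bfst L ori b)) \<sigma> (lann L (avec L \<mu> ori (bsnd L ori b)) \<sigma> \<psi>) T
       + lcre L (avec L \<mu> ori (bsnd L ori b)) \<sigma> (lann L (avec L \<mu> ori (bfst L ori b)) \<sigma> \<psi>) T)"

lemma hform_hop: "hform L \<mu> ori \<phi> \<psi> = ip (nmodes L) \<phi> (hop L \<mu> ori \<psi>)"
  unfolding hop_def hform_def lform_def ip_sum_right ip_add_right ip_lcre_right by (simp add: sum.distrib)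

lemma lcre_lin: "lcre L w \<sigma> (\<lambda>T. c * f T) = (\<lambda>T. c * lcre L w \<sigma> f T)"
  "lcre L w \<sigma> (\<lambda>T. f T + g T) = (\<lambda>T. lcre L w \<sigma> f T + lcre L w \<sigma> g T)"
  "lcre L w \<sigma> (\<lambda>T. f T - g T) = (\<lambda>T. lcre L w \<sigma> f T - lcre L w \<sigma> g T)"
  "lcre L w \<sigma> (\<lambda>T. - f T) = (\<lambda>T. - lcre L w \<sigma> f T)"
  unfolding lcre_def by (simp_all add: fock_lin sum_distrib_left algebra_simps sum.distrib sum_subtractf sum_negf)

lemma lcre_sum: "lcre L w \<sigma> (\<lambda>T. \<Sum>i\<in>I. f i T) = (\<lambda>T. \<Sum>i\<in>I. lcre L w \<sigma> (f i) T)"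
  unfolding lcre_def by (rule ext) (simp add: fock_lin sum_distrib_left, rule sum.swap)

text \<open>The orbital is an eigenvector of the one-particle hopping matrix, so its creation
  operator is an eigenvector of the commutator with \<open>hop\<close>. Determinants of orbitals are
  therefore eigenstates with additive energy.\<close>

lemma hop_lcre:
  assumes L: "L > 0"
  shows "hop L \<mu> ori (lcre L (orbital L \<mu> ori k) True \<psi>) T =
    complex_of_real (disp L k) * lcre L (orbital L \<mu> ori k) True \<psi> T + lcre L (orbital L \<mu> ori k) True (hop L \<mu> ori \<psi>) T"
proof -
  let ?W = "orbital L \<mu> ori k" and ?a = "avec L \<mu> ori" and ?x = "bfst L ori" and ?y = "bsnd L ori"
  have one: "lcre L (?a x) \<sigma> (lann L (?a y) \<sigma> (lcre L ?W True \<psi>)) T =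
    (if \<sigma> then complex_of_real (wave L k y) * lcre L (?a x) True \<psi> T else 0) + lcre L ?W True (lcre L (?a x) \<sigma> (lann L (?a y) \<sigma> \<psi>)) T"
    if "y < L\<^sup>2" for x y \<sigma>
  proof -
    have "lann L (?a y) \<sigma> (lcre L ?W True \<psi>) = (\<lambda>T. (if \<sigma> then complex_of_real (wave L k y) else 0) * \<psi> T - lcre L ?W True (lann L (?a y) \<sigma> \<psi>) T)"
      using lann_lcre[of L "?a y" \<sigma> ?W True \<psi>] orbital_products(1)[OF L that, of \<mu> ori k] by (auto simp: fun_eq_iff)
    then have "lcre L (?a x) \<sigma> (lann L (?a y) \<sigma> (lcre L ?W True \<psi>)) T =
      (if \<sigma> then complex_of_real (wave L k y) else 0) * lcre L (?a x) \<sigma> \<psi> T - lcre L (?a x) \<sigma> (lcre L ?W True (lann L (?a y) \<sigma> \<psi>)) T"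
      by (simp only: lcre_lin)
    then show ?thesis using lcre_lcre[of L "?a x" \<sigma> ?W True "lann L (?a y) \<sigma> \<psi>" T] by (cases \<sigma>) simp_all
  qed
  have eig: "(\<Sum>b<nbonds L. wave L k (?y b) * ?a (?x b) z + wave L k (?x b) * ?a (?y b) z) = disp L k * ?W z" for z
    unfolding orbital_def by (rule wave_eigen[OF L])
  have "hop L \<mu> ori (lcre L ?W True \<psi>) T = (\<Sum>b<nbonds L. complex_of_real (wave L k (?y b)) * lcre L (?a (?x b)) True \<psi> T + complex_of_real (wave L k (?x b)) * lcre L (?a (?y b)) True \<psi> T)
    + (\<Sum>b<nbonds L. \<Sum>\<sigma>\<in>UNIV. lcre L ?W True (lcre L (?a (?x b)) \<sigma> (lann L (?a (?y b)) \<sigma> \<psi>)) T + lcre L ?W True (lcre L (?a (?y b)) \<sigma> (lann L (?a (?x b)) \<sigma> \<psi>)) T)"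
    unfolding hop_def sum.distrib[symmetric] using bond_less[OF L]
    by (intro sum.cong refl) (simp add: one UNIV_bool)
  also have "(\<Sum>b<nbonds L. \<Sum>\<sigma>\<in>UNIV. lcre L ?W True (lcre L (?a (?x b)) \<sigma> (lann L (?a (?y b)) \<sigma> \<psi>)) T + lcre L ?W True (lcre L (?a (?y b)) \<sigma> (lann L (?a (?x b)) \<sigma> \<psi>)) T) = lcre L ?W True (hop L \<mu> ori \<psi>) T"
    unfolding hop_def lcre_sum lcre_lin ..
  also have "(\<Sum>b<nbonds L. complex_of_real (wave L k (?y b)) * lcre L (?a (?x b)) True \<psi> T + complex_of_real (wave L k (?x b)) * lcre L (?a (?y b)) True \<psi> T)
    = (\<Sum>z<nsites L. (\<Sum>b<nbonds L. complex_of_real (wave L k (?y b) * ?a (?x b) z + wave L k (?x b) * ?a (?y b) z)) * ccre (mode z True) \<psi> T)"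
    unfolding lcre_def sum_distrib_left sum_distrib_right sum.distrib[symmetric]
    by (subst sum.swap) (simp add: algebra_simps)
  also have "\<dots> = (\<Sum>z<nsites L. complex_of_real (disp L k * ?W z) * ccre (mode z True) \<psi> T)"
    unfolding of_real_sum[symmetric] eig ..
  also have "\<dots> = complex_of_real (disp L k) * lcre L ?W True \<psi> T"
    unfolding lcre_def sum_distrib_left by (simp add: mult.assoc)
  finally show ?thesis .
qed

lemma ne_state_lcre:
  assumes "ne_state L N \<psi>"
  shows "ne_state L (Suc N) (lcre L w \<sigma> \<psi>)"
  unfolding ne_state_def
proof (intro allI impI)
  fix T assume "lcre L w \<sigma> \<psi> T \<noteq> 0"
  then have "\<exists>z\<in>{..<nsites L}. complex_of_real (w z) * ccre (mode z \<sigma>) \<psi> T \<noteq> 0"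
    unfolding lcre_def by (metis (mono_tags, lifting) sum.neutral)
  then obtain z where z: "z < nsites L" "ccre (mode z \<sigma>) \<psi> T \<noteq> 0" by auto
  then have T: "mode z \<sigma> \<in> T" "\<psi> (T - {mode z \<sigma>}) \<noteq> 0" by (auto simp: ccre_def split: if_splits)
  then have s: "T - {mode z \<sigma>} \<subseteq> {..<nmodes L}" "card (T - {mode z \<sigma>}) = N"
    using assms unfolding ne_state_def by blast+
  have sub: "T \<subseteq> {..<nmodes L}" using s(1) z(1) by (auto simp: nmodes_def)
  then have "finite T" by (rule finite_subset) simp
  then show "T \<subseteq> {..<nmodes L} \<and> card T = Suc N" using card_Suc_Diff1[OF _ T(1)] s(2) sub by simp
qed

fun slater :: "nat \<Rightarrow> real \<Rightarrow> (nat \<Rightarrow> bool) \<Rightarrow> (int \<times> int) list \<Rightarrow> fstate" where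
  "slater L \<mu> ori [] = (\<lambda>T. if T = {} then 1 else 0)"
| "slater L \<mu> ori (k # ks) = lcre L (orbital L \<mu> ori k) True (slater L \<mu> ori ks)"

lemma lann_vacuum: "lann L w \<sigma> (\<lambda>T. if T = {} then 1 else 0) = (\<lambda>T. 0)"
  by (simp add: lann_def cann_def cong: if_cong)

definition orthogonal_momenta :: "nat \<Rightarrow> (int \<times> int) set \<Rightarrow> bool" where
  "orthogonal_momenta L M \<longleftrightarrow> (\<forall>k\<in>M. \<forall>k'\<in>M. k \<noteq> k' \<longrightarrow> \<not> (int L dvd fst k - fst k' \<and> int L dvd snd k - snd k'))"

lemma slater_ne_state: "ne_state L (length ks) (slater L \<mu> ori ks)"
proof (induction ks)
  case Nil
  then show ?case by (auto simp: ne_state_def)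
next
  case (Cons k ks)
  then show ?case by (simp add: ne_state_lcre)
qed

text \<open>All electrons have spin up, which excludes double occupancy, and their orbitals are
  orthogonal to the \<open>b\<close> vectors.\<close>

lemma slater_finite_energy:
  assumes L: "L > 0"
  shows "finite_energy L \<mu> ori (slater L \<mu> ori ks)"
proof -
  have c: "cann (mode z False) (slater L \<mu> ori ks) = (\<lambda>T. 0)" for z
  proof (induction ks)
    case Nil then show ?case by (auto simp: cann_def)
  next
    case (Cons k ks)
    have *: "cann (mode z False) (lcre L w True \<psi>) T = - lcre L w True (cann (mode z False) \<psi>) T" for w \<psi> T
      unfolding lcre_def by (simp add: fock_lin cann_ccre sum_negf)
    show ?case by (rule ext) (simp only: slater.simps * Cons lcre_zero minus_zero)
  qed
  have b: "lann L w \<sigma> (slater L \<mu> ori ks) = (\<lambda>T. 0)" if w: "\<And>k. (\<Sum>z<nsites L. w z * orbital L \<mu> ori k z) = 0" for w \<sigma>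
  proof (induction ks)
    case Nil then show ?case by (simp add: lann_vacuum)
  next
    case (Cons k ks)
    then show ?case by (intro ext) (simp add: lann_lcre w)
  qed
  show ?thesis unfolding finite_energy_def using b orbital_products(2,3)[OF L] c by simp
qed

lemma slater_annihilate:
  assumes L: "L > 0" and "orthogonal_momenta L (insert k (set ks))" "k \<notin> set ks"
  shows "lann L (orbital L \<mu> ori k) True (slater L \<mu> ori ks) = (\<lambda>T. 0)"
  using assms(2,3)
proof (induction ks)
  case Nil then show ?case by (simp add: lann_vacuum)
next
  case (Cons k' ks)
  have "(\<Sum>z<nsites L. orbital L \<mu> ori k z * orbital L \<mu> ori k' z) = 0"
    using Cons.prems unfolding orbital_products(4)[OF L] wave_orthonormal[OF L] orthogonal_momenta_def by simp
  moreover have "lann L (orbital L \<mu> ori k) True (slater L \<mu> ori ks) = (\<lambda>T. 0)"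
    using Cons by (auto simp: orthogonal_momenta_def)
  ultimately show ?case by (intro ext) (simp add: lann_lcre)
qed

lemma slater_norm:
  assumes L: "L > 0" and "orthogonal_momenta L (set ks)" "distinct ks"
  shows "ip (nmodes L) (slater L \<mu> ori ks) (slater L \<mu> ori ks) = 1"
  using assms(2,3)
proof (induction ks)
  case Nil
  show ?case unfolding ip_def by (subst sum.mono_neutral_right[of _ "{{}}"]) auto
next
  case (Cons k ks)
  have "lann L (orbital L \<mu> ori k) True (slater L \<mu> ori ks) = (\<lambda>T. 0)"
    using Cons.prems by (intro slater_annihilate[OF L]) auto
  then have "lann L (orbital L \<mu> ori k) True (slater L \<mu> ori (k # ks)) = slater L \<mu> ori ks"
    using orbital_products(4)[OF L, of \<mu> ori k k] wave_orthonormal[OF L, of k k] by (intro ext) (simp add: lann_lcre)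
  then show ?case using Cons by (simp add: ip_lcre orthogonal_momenta_def)
qed

lemma slater_hop:
  assumes L: "L > 0"
  shows "hop L \<mu> ori (slater L \<mu> ori ks) = (\<lambda>T. complex_of_real (\<Sum>k\<leftarrow>ks. disp L k) * slater L \<mu> ori ks T)"
proof (induction ks)
  case Nil
  show ?case unfolding hop_def by (simp add: lann_vacuum)
next
  case (Cons k ks)
  then show ?case by (intro ext) (simp add: hop_lcre[OF L] lcre_lin algebra_simps)
qed

lemma slater_energy:
  assumes L: "L > 0" and "orthogonal_momenta L M" "finite M"
  shows "\<exists>\<psi>. ne_state L (card M) \<psi> \<and> finite_energy L \<mu> ori \<psi> \<and> ip (nmodes L) \<psi> \<psi> = 1 \<and>
     Re (hform L \<mu> ori \<psi> \<psi>) = (\<Sum>k\<in>M. disp L k)"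
proof -
  obtain ks where ks: "set ks = M" "distinct ks" using finite_distinct_list[OF assms(3)] by blast
  have n: "ip (nmodes L) (slater L \<mu> ori ks) (slater L \<mu> ori ks) = 1" using slater_norm[OF L] assms(2) ks by blast
  moreover have "Re (hform L \<mu> ori (slater L \<mu> ori ks) (slater L \<mu> ori ks)) = (\<Sum>k\<in>M. disp L k)"
    unfolding hform_hop slater_hop[OF L] ip_scale_right n using ks by (simp add: sum_list_distinct_conv_sum_set)
  moreover have "length ks = card M" using distinct_card[OF ks(2)] ks(1) by simp
  ultimately show ?thesis using slater_ne_state[of L ks \<mu> ori] slater_finite_energy[OF L, of \<mu> ori ks]
    by (intro exI[of _ "slater L \<mu> ori ks"]) simp
qed

section \<open>Momenta near the top of the band\<close>

definition int_run :: "nat \<Rightarrow> nat \<Rightarrow> int set" where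
  "int_run a n = {- int a ..< int n - int a}"

lemma sum_int_run: "(\<Sum>m\<in>int_run a n. f m) = (\<Sum>i<n. f (int i - int a))"
  unfolding int_run_def
  by (rule sum.reindex_bij_witness[where i="\<lambda>i. int i - int a" and j="\<lambda>m. nat (m + int a)"]) auto

lemma card_int_run [simp]: "card (int_run a n) = n"
  by (simp add: int_run_def)

lemma finite_int_run [simp]: "finite (int_run a n)"
  by (simp add: int_run_def)

lemma int_run_orthogonal: "orthogonal_momenta L (int_run a L \<times> int_run a L)"
proof -
  have "m = m'" if "m \<in> int_run a L" "m' \<in> int_run a L" "int L dvd m - m'" for m m'
  proof (rule ccontr)
    assume "m \<noteq> m'"
    then have "int L \<le> \<bar>m - m'\<bar>" using that(3) dvd_imp_le_int[of "m - m'" "int L"] by simp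
    then show False using that(1,2) by (auto simp: int_run_def)
  qed
  then show ?thesis unfolding orthogonal_momenta_def by (auto simp: prod_eq_iff)
qed

lemma sum_cos_int_run:
  assumes "L \<ge> 2"
  shows "(\<Sum>m\<in>int_run a L. cos (2 * pi * (real_of_int m - real_of_int c) / real L)) = 0"
proof -
  have "(\<Sum>m\<in>int_run a L. cos (2 * pi * (real_of_int m - real_of_int c) / real L)) =
    Re (cis (- (2 * pi * (real a + real_of_int c) / real L)) * (\<Sum>i<L. cis (2 * pi * real_of_int 1 * real i / real L)))"
    unfolding sum_int_run sum_distrib_left Re_sum cis_mult
  proof (intro sum.cong refl)
    fix i
    have "2 * pi * (real_of_int (int i - int a) - real_of_int c) / real L =
      - (2 * pi * (real a + real_of_int c) / real L) + 2 * pi * real_of_int 1 * real i / real L"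
      by (simp add: ring_distribs add_divide_distrib diff_divide_distrib)
    then show "cos (2 * pi * (real_of_int (int i - int a) - real_of_int c) / real L) =
      Re (cis (- (2 * pi * (real a + real_of_int c) / real L) + 2 * pi * real_of_int 1 * real i / real L))"
      by (simp only: cis.sel)
  qed
  also have "(\<Sum>i<L. cis (2 * pi * real_of_int 1 * real i / real L)) = 0"
    using assms by (subst sum_cis) auto
  finally show ?thesis by simp
qed

text \<open>The hopping matrix has trace zero. Leaving momenta empty therefore costs minus the sum
  of their energies, and the lowest total is reached by emptying the top of the band.\<close>

lemma sum_disp:
  assumes "L \<ge> 2"
  shows "(\<Sum>k\<in>int_run a L \<times> int_run a L. disp L k) = 0"
proof -
  have "(\<Sum>k\<in>int_run a L \<times> int_run a L. disp L k) = (\<Sum>m\<in>int_run a L. \<Sum>n\<in>int_run a L.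
      2 * cos (2 * pi * (real_of_int m - real_of_int 0) / real L) + 2 * cos (2 * pi * (real_of_int n - real_of_int 0) / real L)
      + 2 * cos (2 * pi * (real_of_int n - real_of_int m) / real L))"
    unfolding sum.cartesian_product
  proof (intro sum.cong refl, clarify)
    fix m n
    have "cos (2 * pi * (real_of_int m - real_of_int n) / real L) = cos (2 * pi * (real_of_int n - real_of_int m) / real L)"
    proof -
      have "2 * pi * (real_of_int m - real_of_int n) / real L = - (2 * pi * (real_of_int n - real_of_int m) / real L)"
        by (simp add: right_diff_distrib diff_divide_distrib)
      then show ?thesis by (simp only: cos_minus)
    qed
    then show "disp L (m, n) = 2 * cos (2 * pi * (real_of_int m - real_of_int 0) / real L) + 2 * cos (2 * pi * (real_of_int n - real_of_int 0) / real L)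
      + 2 * cos (2 * pi * (real_of_int n - real_of_int m) / real L)"
      by (simp add: disp_def ang_def)
  qed
  also have "\<dots> = 0"
  proof -
    have "(\<Sum>m\<in>int_run a L. cos (2 * pi * real_of_int m / real L)) = 0" using sum_cos_int_run[OF assms, where a=a and c=0] by simp
    then show ?thesis unfolding sum.distrib sum_distrib_left[symmetric] sum_cos_int_run[OF assms] by (simp flip: sum_distrib_left)
  qed
  finally show ?thesis .
qed

text \<open>The second-order decrease of \<open>disp\<close> away from zero momentum, in units of
  \<open>(2 * pi / L)\<^sup>2\<close>.\<close>

definition quad :: "int \<times> int \<Rightarrow> real" where
  "quad k = (real_of_int (fst k))\<^sup>2 + (real_of_int (snd k))\<^sup>2 + (real_of_int (fst k) - real_of_int (snd k))\<^sup>2"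

lemma cos_ge_parabola: "cos x \<ge> 1 - x\<^sup>2 / (2::real)"
proof -
  have "cos x = 1 - 2 * (sin (x / 2))\<^sup>2" using cos_double_sin[of "x / 2"] by simp
  moreover have "(sin (x / 2))\<^sup>2 \<le> (x / 2)\<^sup>2" using abs_sin_x_le_abs_x[of "x / 2"] unfolding abs_le_square_iff .
  ultimately show ?thesis by (simp add: power_divide)
qed

lemma disp_ge: "disp L k \<ge> 6 - (2 * pi / real L)\<^sup>2 * quad k"
proof -
  have "disp L k \<ge> 2 * ((1 - (ang L k 1 0)\<^sup>2 / 2) + (1 - (ang L k 0 1)\<^sup>2 / 2) + (1 - (ang L k 1 (-1))\<^sup>2 / 2))"
    unfolding disp_def by (intro mult_left_mono add_mono cos_ge_parabola) auto
  also have "2 * ((1 - (ang L k 1 0)\<^sup>2 / 2) + (1 - (ang L k 0 1)\<^sup>2 / 2) + (1 - (ang L k 1 (-1))\<^sup>2 / 2)) = 6 - (2 * pi / real L)\<^sup>2 * quad k"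
    by (simp add: ang_def quad_def power_divide power_mult_distrib distrib_left add_divide_distrib)
  finally show ?thesis .
qed

text \<open>Discarding a largest element does not raise the average. This handles hole numbers that
  do not fill a square of momenta.\<close>

lemma subset_below_average:
  fixes f :: "'a \<Rightarrow> real"
  assumes "finite X" "h \<le> card X"
  shows "\<exists>Y\<subseteq>X. card Y = h \<and> sum f Y * real (card X) \<le> real h * sum f X"
  using assms
proof (induction "card X - h" arbitrary: X)
  case 0
  then show ?case by (intro exI[of _ X]) (simp add: mult.commute)
next
  case (Suc d)
  then have "X \<noteq> {}" by auto
  then obtain x where x: "x \<in> X" "\<And>y. y \<in> X \<Longrightarrow> f y \<le> f x"
    using Max_in[of "f ` X"] Max_ge[of "f ` X"] Suc.prems(1) by (metis (no_types, lifting) finite_imageI image_iff image_is_empty)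
  define n where "n = card (X - {x})"
  have n: "card X = Suc n" "h \<le> n" using Suc x unfolding n_def by (simp_all add: card_Diff_singleton)
  have "d = card (X - {x}) - h" using Suc.hyps(2) n unfolding n_def[symmetric] by simp
  from Suc.hyps(1)[OF this] Suc.prems n obtain Y where Y: "Y \<subseteq> X - {x}" "card Y = h" "sum f Y * real n \<le> real h * sum f (X - {x})"
    unfolding n_def by auto
  have sx: "sum f X = sum f (X - {x}) + f x" using sum.remove[OF Suc.prems(1) x(1), of f] by simp
  have avg: "sum f X \<le> real (Suc n) * f x" using sum_bounded_above[of X f "f x"] x n by simp
  have "sum f Y * real (Suc n) \<le> real h * sum f X"
  proof (cases "n = 0")
    case True
    then have "Y = {}" using n(2) Y Suc.prems(1) by (metis card_0_eq finite_Diff finite_subset le_zero_eq)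
    then show ?thesis using Y(2) by simp
  next
    case False
    have "real (Suc n) * sum f (X - {x}) \<le> real n * sum f X" using avg unfolding sx by (simp add: algebra_simps)
    then have "real h * (real (Suc n) * sum f (X - {x})) \<le> real h * (real n * sum f X)" by (intro mult_left_mono) auto
    moreover have "real (Suc n) * (sum f Y * real n) \<le> real (Suc n) * (real h * sum f (X - {x}))" using Y(3) by (intro mult_left_mono) auto
    moreover have "real n * (sum f Y * real (Suc n)) = real (Suc n) * (sum f Y * real n)"
      "real (Suc n) * (real h * sum f (X - {x})) = real h * (real (Suc n) * sum f (X - {x}))"
      "real h * (real n * sum f X) = real n * (real h * sum f X)" by (simp_all only: mult_ac)
    ultimately have "real n * (sum f Y * real (Suc n)) \<le> real n * (real h * sum f X)" by linarith
    then show ?thesis by (rule mult_left_le_imp_le) (use False in simp)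
  qed
  then show ?case using Y n by (intro exI[of _ Y]) auto
qed

lemma sum_quad_box:
  "(\<Sum>k\<in>int_run a n \<times> int_run a n. quad k) =
    4 * real n * (\<Sum>i<n. (real i - real a)\<^sup>2) - 2 * (\<Sum>i<n. real i - real a)\<^sup>2"
proof -
  let ?f = "\<lambda>i. real i - real a"
  have "(\<Sum>k\<in>int_run a n \<times> int_run a n. quad k) = (\<Sum>i<n. \<Sum>j<n. 2 * (?f i)\<^sup>2 + 2 * (?f j)\<^sup>2 - 2 * (?f i * ?f j))"
    unfolding sum.cartesian_product[symmetric, of "\<lambda>x y. quad (x, y)", simplified] sum_int_run
    by (intro sum.cong refl) (simp add: quad_def power2_eq_square algebra_simps)
  also have "\<dots> = 4 * real n * (\<Sum>i<n. (?f i)\<^sup>2) - 2 * ((\<Sum>i<n. ?f i) * (\<Sum>i<n. ?f i))"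
  proof -
    have "(\<Sum>i<n. \<Sum>j<n. 2 * (g i)\<^sup>2 + 2 * (g j)\<^sup>2 - 2 * (g i * g j)) =
      4 * real n * (\<Sum>i<n. (g i)\<^sup>2) - 2 * ((\<Sum>i<n. g i) * (\<Sum>i<n. g i))" for g :: "nat \<Rightarrow> real"
      unfolding sum_product by (simp add: sum.distrib sum_subtractf flip: sum_distrib_left)
    then show ?thesis .
  qed
  finally show ?thesis by (simp add: power2_eq_square)
qed

lemma sum_shifted_squares:
  "(\<Sum>i<n. real i - c) = real n * (real n - 1) / 2 - c * real n"
  "(\<Sum>i<n. (real i - c)\<^sup>2) = (real n - 1) * real n * (2 * real n - 1) / 6 - c * real n * (real n - 1) + c\<^sup>2 * real n"
  by (induction n) (simp_all add: field_simps power2_eq_square)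

text \<open>The average of \<open>quad\<close> over the centred box is
  \<open>(n\<^sup>2 - 1) / 3\<close> for odd \<open>n\<close> and
  \<open>n\<^sup>2 / 3 + 1 / 6\<close> for even \<open>n\<close>, while \<open>h\<close> exceeds
  \<open>(n - 1)\<^sup>2\<close>. The factor \<open>3 / 5\<close> instead of the asymptotic
  \<open>1 / 3\<close> accommodates small boxes.\<close>

lemma sum_quad_le:
  assumes h: "h \<ge> 3" "(n - 1)\<^sup>2 < h" and n: "n \<ge> 1"
  shows "(\<Sum>k\<in>int_run ((n - 1) div 2) n \<times> int_run ((n - 1) div 2) n. quad k) \<le> 3 / 5 * real h * (real n)\<^sup>2"
proof -
  define a where "a = (n - 1) div 2"
  have "n = 2 * a + 1 \<or> n = 2 * a + 2" using n unfolding a_def by presburger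
  then show ?thesis unfolding a_def[symmetric]
  proof
    assume na: "n = 2 * a + 1"
    then have "real ((2 * a)\<^sup>2 + 1) \<le> real h" using h by (simp only: of_nat_le_iff) simp
    then have h1: "4 * (real a)\<^sup>2 + 1 \<le> real h" by (simp add: power_mult_distrib)
    have "(\<Sum>k\<in>int_run a n \<times> int_run a n. quad k) = (real n)\<^sup>2 * (4 * (real a * (real a + 1)) / 3)"
      unfolding sum_quad_box sum_shifted_squares na by (simp add: field_simps power2_eq_square)
    also have "\<dots> \<le> (real n)\<^sup>2 * (3 / 5 * real h)"
    proof (intro mult_left_mono)
      \<comment> \<open>The difference of the two sides compared below is this square plus
        \<open>11 / 4\<close>.\<close>
      have "0 \<le> (4 * real a - 5 / 2)\<^sup>2" by simp
      then have "20 * (real a * (real a + 1)) \<le> 9 * (4 * (real a)\<^sup>2 + 1)" by (simp add: power2_eq_square algebra_simps)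
      then show "4 * (real a * (real a + 1)) / 3 \<le> 3 / 5 * real h" using h1 by simp
    qed simp
    finally show "(\<Sum>k\<in>int_run a n \<times> int_run a n. quad k) \<le> 3 / 5 * real h * (real n)\<^sup>2" by (simp add: mult_ac)
  next
    assume na: "n = 2 * a + 2"
    then have "real ((2 * a + 1)\<^sup>2 + 1) \<le> real h" using h by (simp only: of_nat_le_iff) simp
    then have h1: "4 * (real a)\<^sup>2 + 4 * real a + 2 \<le> real h" by (simp add: power2_eq_square algebra_simps)
    have "(\<Sum>k\<in>int_run a n \<times> int_run a n. quad k) = (real n)\<^sup>2 * ((8 * (real a + 1)\<^sup>2 + 1) / 6)"
      unfolding sum_quad_box sum_shifted_squares na by (simp add: field_simps power2_eq_square)
    also have "\<dots> \<le> (real n)\<^sup>2 * (3 / 5 * real h)"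
    proof (intro mult_left_mono)
      show "(8 * (real a + 1)\<^sup>2 + 1) / 6 \<le> 3 / 5 * real h"
      \<comment> \<open>For \<open>n = 2\<close> the average is \<open>3 / 2\<close>, and
        \<open>h = 2\<close> would violate the bound; here \<open>h \<ge> 3\<close> enters.\<close>
      proof (cases "a = 0")
        case True
        have "real 3 \<le> real h" using h(1) by (simp only: of_nat_le_iff)
        then show ?thesis using True by simp
      next
        case False
        then have "1 \<le> real a" by simp
        then have "real a * 1 \<le> real a * real a" by (intro mult_left_mono) auto
        moreover have "18 * (4 * (real a)\<^sup>2 + 4 * real a + 2) - 5 * (8 * (real a + 1)\<^sup>2 + 1) = 32 * (real a * real a) - 8 * real a - 9"
          by (simp add: power2_eq_square algebra_simps)
        ultimately have "5 * (8 * (real a + 1)\<^sup>2 + 1) \<le> 18 * (4 * (real a)\<^sup>2 + 4 * real a + 2)"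
          using \<open>1 \<le> real a\<close> by linarith
        then show ?thesis using h1 by simp
      qed
    qed simp
    finally show "(\<Sum>k\<in>int_run a n \<times> int_run a n. quad k) \<le> 3 / 5 * real h * (real n)\<^sup>2" by (simp add: mult_ac)
  qed
qed

text \<open>The momenta left empty are chosen in the smallest centred box with room for
  \<open>h\<close> of them, so that the quadratic expansion of the band at its top loses little. The
  constant is \<open>4 * 3 / 5\<close>, from \<open>(2 * pi)\<^sup>2\<close> and
  \<open>sum_quad_le\<close>.\<close>

lemma ferromagnetic_trial_state:
  assumes L: "L \<ge> 3" and h: "3 \<le> h" "h \<le> L\<^sup>2"
  shows "\<exists>\<psi>. ne_state L (L\<^sup>2 - h) \<psi> \<and> finite_energy L \<mu> ori \<psi> \<and> ip (nmodes L) \<psi> \<psi> = 1 \<and>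
     Re (hform L \<mu> ori \<psi> \<psi>) \<le> 12 / 5 * pi\<^sup>2 * (real h)\<^sup>2 / (real L)\<^sup>2 - 6 * real h"
proof -
  have L0: "L > 0" using L by simp
  define n where "n = (LEAST n. h \<le> n\<^sup>2)"
  have n1: "h \<le> n\<^sup>2" unfolding n_def by (rule LeastI[of "\<lambda>n. h \<le> n\<^sup>2", OF h(2)])
  have nL: "n \<le> L" unfolding n_def by (rule Least_le) (rule h(2))
  have n0: "n \<ge> 1" using n1 h(1) by (cases n) auto
  have n2: "(n - 1)\<^sup>2 < h"
    using not_less_Least[of "n - 1" "\<lambda>n. h \<le> n\<^sup>2"] n0 unfolding n_def[symmetric] by simp
  \<comment> \<open>The same offset is used for the small box and for the full set of
    \<open>L * L\<close> momenta, which makes the inclusion \<open>BM\<close> immediate; it centres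
    the small box at zero momentum.\<close>
  define a where "a = (n - 1) div 2"
  let ?B = "int_run a n \<times> int_run a n" and ?M = "int_run a L \<times> int_run a L"
  have BM: "?B \<subseteq> ?M" using nL by (auto simp: int_run_def)
  have cB: "card ?B = n\<^sup>2" by (simp add: card_cartesian_product power2_eq_square)
  obtain H where H: "H \<subseteq> ?B" "card H = h" "sum quad H * real (n\<^sup>2) \<le> real h * sum quad ?B"
    using subset_below_average[of ?B h quad] n1 unfolding cB by auto
  have "real h * sum quad ?B \<le> real h * (3 / 5 * real h * (real n)\<^sup>2)"
    unfolding a_def using sum_quad_le[OF h(1) n2 n0] by (intro mult_left_mono) auto
  then have "sum quad H * (real n)\<^sup>2 \<le> (3 / 5 * (real h)\<^sup>2) * (real n)\<^sup>2"
    using H(3) by (simp add: power2_eq_square mult_ac)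
  then have sH: "sum quad H \<le> 3 / 5 * (real h)\<^sup>2"
    by (rule mult_right_le_imp_le) (use n0 in simp)
  have HM: "H \<subseteq> ?M" using H(1) BM by blast
  have fM: "finite ?M" by simp
  have cM: "card (?M - H) = L\<^sup>2 - h"
    using HM fM H(2) by (simp add: card_Diff_subset finite_subset card_cartesian_product power2_eq_square)
  have "orthogonal_momenta L (?M - H)" using int_run_orthogonal[of L a] unfolding orthogonal_momenta_def by blast
  from slater_energy[OF L0 this, of \<mu> ori] obtain \<psi> where \<psi>:
    "ne_state L (L\<^sup>2 - h) \<psi>" "finite_energy L \<mu> ori \<psi>" "ip (nmodes L) \<psi> \<psi> = 1" "Re (hform L \<mu> ori \<psi> \<psi>) = (\<Sum>k\<in>?M - H. disp L k)"
    unfolding cM by auto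
  have "(\<Sum>k\<in>?M - H. disp L k) = - (\<Sum>k\<in>H. disp L k)"
    using sum_diff[OF fM HM, of "disp L"] sum_disp[of L a] L by simp
  also have "\<dots> \<le> - (\<Sum>k\<in>H. 6 - (2 * pi / real L)\<^sup>2 * quad k)"
    by (simp add: sum_mono disp_ge)
  also have "\<dots> = (2 * pi / real L)\<^sup>2 * sum quad H - 6 * real h"
    using H(2) by (simp add: sum_subtractf sum_distrib_left)
  also have "\<dots> \<le> (2 * pi / real L)\<^sup>2 * (3 / 5 * (real h)\<^sup>2) - 6 * real h"
    using sH by (intro diff_right_mono mult_left_mono) auto
  also have "\<dots> = 12 / 5 * pi\<^sup>2 * (real h)\<^sup>2 / (real L)\<^sup>2 - 6 * real h"
    by (simp add: power_divide power_mult_distrib)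
  finally show ?thesis using \<psi> by (intro exI[of _ \<psi>]) simp
qed

section \<open>Ground states\<close>

definition down_part :: "nat \<Rightarrow> fstate \<Rightarrow> fstate" where
  "down_part q \<psi> = (\<lambda>T. if card {j\<in>T. odd j} = q then \<psi> T else 0)"

lemma down_part_sector: "ne_state L N \<psi> \<Longrightarrow> sector L N q (down_part q \<psi>)"
  unfolding ne_state_def sector_def down_part_def by (auto split: if_splits)

lemma down_part_sum:
  assumes "ne_state L N \<psi>"
  shows "\<psi> = (\<lambda>T. \<Sum>q\<le>N. down_part q \<psi> T)"
proof
  fix T
  show "\<psi> T = (\<Sum>q\<le>N. down_part q \<psi> T)"
  proof (cases "\<psi> T = 0")
    case True
    then have "down_part q \<psi> T = 0" for q by (simp add: down_part_def)
    then show ?thesis using True by simp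
  next
    case False
    then have T: "T \<subseteq> {..<nmodes L}" "card T = N" using assms by (simp_all add: ne_state_def)
    have "finite T" by (rule finite_subset[OF T(1)]) simp
    then have "card {j\<in>T. odd j} \<le> N" using T(2) card_mono[of T "{j\<in>T. odd j}"] by auto
    then show ?thesis unfolding down_part_def by simp
  qed
qed

lemma cann_down_part:
  assumes "ne_state L N \<psi>"
  shows "cann (mode z \<sigma>) (down_part q \<psi>) T =
    (if card {j\<in>T. odd j} + (if \<sigma> then 0 else 1) = q then cann (mode z \<sigma>) \<psi> T else 0)"
proof (cases "finite T")
  case True
  let ?O = "{j\<in>T. odd j}"
  have "card {j \<in> insert (mode z \<sigma>) T. odd j} = card ?O + (if \<sigma> then 0 else 1)" if "mode z \<sigma> \<notin> T"
  proof (cases \<sigma>)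
    case up: True
    then have "{j \<in> insert (mode z \<sigma>) T. odd j} = ?O" by auto
    then show ?thesis using up by (simp only: if_True add_0_right)
  next
    case down: False
    then have "{j \<in> insert (mode z \<sigma>) T. odd j} = insert (mode z \<sigma>) ?O" by auto
    moreover have "finite ?O" "mode z \<sigma> \<notin> ?O" using True that by auto
    ultimately show ?thesis using down by (simp only: card_insert_disjoint) simp
  qed
  then show ?thesis unfolding cann_def down_part_def by auto
next
  case False
  have "\<psi> (insert j T) = 0" for j
  proof (rule ccontr)
    assume "\<psi> (insert j T) \<noteq> 0"
    then have "insert j T \<subseteq> {..<nmodes L}" using assms unfolding ne_state_def by blast
    then have "finite (insert j T)" by (rule finite_subset) simp
    with False show False by simp
  qed
  then show ?thesis unfolding cann_def down_part_def by simp
qed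

lemma down_part_finite_energy:
  assumes ne: "ne_state L N \<psi>" and fe: "finite_energy L \<mu> ori \<psi>"
  shows "finite_energy L \<mu> ori (down_part q \<psi>)"
proof -
  have "lann L w \<sigma> (down_part q \<psi>) = (\<lambda>T. 0)" if "lann L w \<sigma> \<psi> = (\<lambda>T. 0)" for w \<sigma>
  proof
    fix T
    have "lann L w \<sigma> (down_part q \<psi>) T = (if card {j\<in>T. odd j} + (if \<sigma> then 0 else 1) = q then lann L w \<sigma> \<psi> T else 0)"
      unfolding lann_def cann_down_part[OF ne] by simp
    then show "lann L w \<sigma> (down_part q \<psi>) T = 0" using that by simp
  qed
  moreover have "cann (mode z True) (cann (mode z False) (down_part q \<psi>)) = (\<lambda>T. 0)" if "z < nsites L" for z
  proof
    fix R
    have "\<psi> (insert (mode z False) (insert (mode z True) R)) = 0"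
      by (rule finite_energy_no_double[OF fe that]) auto
    then show "cann (mode z True) (cann (mode z False) (down_part q \<psi>)) R = 0"
      by (simp add: cann_def down_part_def)
  qed
  ultimately show ?thesis using fe unfolding finite_energy_def by simp
qed

lemma ne_state_sum:
  assumes "\<And>i. i \<in> I \<Longrightarrow> ne_state L N (f i)"
  shows "ne_state L N (\<lambda>T. \<Sum>i\<in>I. f i T)"
  unfolding ne_state_def
proof (intro allI impI)
  fix T assume "(\<Sum>i\<in>I. f i T) \<noteq> 0"
  then obtain i where "i \<in> I" "f i T \<noteq> 0" by (meson sum.neutral)
  then show "T \<subseteq> {..<nmodes L} \<and> card T = N" using assms unfolding ne_state_def by blast
qed

lemma finite_energy_sum:
  assumes "finite I" "\<And>i. i \<in> I \<Longrightarrow> finite_energy L \<mu> ori (f i)"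
  shows "finite_energy L \<mu> ori (\<lambda>T. \<Sum>i\<in>I. f i T)"
  using assms
proof (induction I rule: finite_induct)
  case empty
  have "lann L w \<sigma> (\<lambda>T. 0) = (\<lambda>T. 0)" for w \<sigma> by simp
  then show ?case by (simp add: finite_energy_def)
next
  case (insert x F)
  then show ?case using finite_energy_lin(2)[of L \<mu> ori "f x" "\<lambda>T. \<Sum>i\<in>F. f i T"] by simp
qed

lemma spin_components:
  assumes L: "L > 0" and \<mu>: "\<mu> \<noteq> 0" and ne: "ne_state L N \<Phi>" and fe: "finite_energy L \<mu> ori \<Phi>"
  shows "\<exists>J \<phi> S. finite (J :: (nat \<times> real) set) \<and> \<Phi> = (\<lambda>T. \<Sum>j\<in>J. \<phi> j T) \<and>
    (\<forall>j\<in>J. ne_state L N (\<phi> j) \<and> finite_energy L \<mu> ori (\<phi> j) \<and> S j \<ge> 0 \<and>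
       stot2 L (\<phi> j) = (\<lambda>T. complex_of_real (S j * (S j + 1)) * \<phi> j T) \<and>
       (\<forall>T D. \<phi> j T \<noteq> 0 \<longrightarrow> component L (occupied T) D \<longrightarrow> real (card D) \<le> real N / 2 + S j))"
proof -
  have "\<forall>q. \<exists>R \<phi>. finite R \<and> down_part q \<Phi> = (\<lambda>T. \<Sum>ev\<in>R. \<phi> ev T) \<and>
    (\<forall>ev\<in>R. finite_energy L \<mu> ori (\<phi> ev) \<and> sector L N q (\<phi> ev) \<and> stot2 L (\<phi> ev) = (\<lambda>T. complex_of_real ev * \<phi> ev T))"
    by (intro allI spin_decomposition[OF down_part_finite_energy[OF ne fe] down_part_sector[OF ne]])
  then obtain R \<phi> where R: "\<And>q. finite (R q)" "\<And>q. down_part q \<Phi> = (\<lambda>T. \<Sum>ev\<in>R q. \<phi> q ev T)"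
    "\<And>q ev. ev \<in> R q \<Longrightarrow> finite_energy L \<mu> ori (\<phi> q ev)" "\<And>q ev. ev \<in> R q \<Longrightarrow> sector L N q (\<phi> q ev)"
    "\<And>q ev. ev \<in> R q \<Longrightarrow> stot2 L (\<phi> q ev) = (\<lambda>T. complex_of_real ev * \<phi> q ev T)"
    by metis
  \<comment> \<open>Zero components are dropped because an eigenvalue is tied to a spin
    \<open>S\<close> only by a nonzero eigenvector. Components with equal spin but different numbers
    of down spins remain separate.\<close>
  define J where "J = {j \<in> Sigma {..N} R. \<phi> (fst j) (snd j) \<noteq> (\<lambda>T. 0)}"
  have fS: "finite (Sigma {..N} R)" using R(1) by auto
  have "\<forall>j\<in>J. \<exists>S\<ge>0. snd j = S * (S + 1) \<and> (\<forall>T D. \<phi> (fst j) (snd j) T \<noteq> 0 \<longrightarrow> component L (occupied T) D \<longrightarrow> real (card D) \<le> real N / 2 + S)"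
  proof
    fix j assume "j \<in> J"
    then have "snd j \<in> R (fst j)" "\<phi> (fst j) (snd j) \<noteq> (\<lambda>T. 0)" unfolding J_def by auto
    then show "\<exists>S\<ge>0. snd j = S * (S + 1) \<and> (\<forall>T D. \<phi> (fst j) (snd j) T \<noteq> 0 \<longrightarrow> component L (occupied T) D \<longrightarrow> real (card D) \<le> real N / 2 + S)"
      by (intro eigenvector_clusters[OF L \<mu> R(3) R(4) _ R(5)])
  qed
  then obtain S where S: "\<And>j. j \<in> J \<Longrightarrow> S j \<ge> 0" "\<And>j. j \<in> J \<Longrightarrow> snd j = S j * (S j + 1)"
    "\<And>j T D. j \<in> J \<Longrightarrow> \<phi> (fst j) (snd j) T \<noteq> 0 \<Longrightarrow> component L (occupied T) D \<Longrightarrow> real (card D) \<le> real N / 2 + S j"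
    by metis
  have "\<Phi> T = (\<Sum>j\<in>J. \<phi> (fst j) (snd j) T)" for T
  proof -
    have "\<Phi> T = (\<Sum>q\<le>N. \<Sum>ev\<in>R q. \<phi> q ev T)"
      by (subst down_part_sum[OF ne]) (simp add: R(2))
    also have "\<dots> = (\<Sum>j\<in>Sigma {..N} R. \<phi> (fst j) (snd j) T)"
      using R(1) by (subst sum.Sigma) (auto simp: case_prod_beta)
    also have "\<dots> = (\<Sum>j\<in>J. \<phi> (fst j) (snd j) T)"
      by (rule sum.mono_neutral_right[OF fS]) (auto simp: J_def fun_eq_iff)
    finally show ?thesis .
  qed
  moreover have "finite J" unfolding J_def using fS by simp
  moreover have "ne_state L N (\<phi> (fst j) (snd j)) \<and> finite_energy L \<mu> ori (\<phi> (fst j) (snd j)) \<and>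
     stot2 L (\<phi> (fst j) (snd j)) = (\<lambda>T. complex_of_real (S j * (S j + 1)) * \<phi> (fst j) (snd j) T)" if "j \<in> J" for j
  proof -
    have "snd j \<in> R (fst j)" using that unfolding J_def by auto
    then show ?thesis using R(3-5) sector_ne_state S(2)[OF that] by metis
  qed
  ultimately show ?thesis using S(1,3)
    by (intro exI[of _ J] exI[of _ "\<lambda>j. \<phi> (fst j) (snd j)"] exI[of _ S]) (auto simp: fun_eq_iff)
qed

text \<open>The variational inequality is put in homogeneous form because it is applied to the
  high-spin part of a ground state, which is not normalized.\<close>

lemma ground_state_minimal:
  assumes t: "t > 0" and gs: "ground_state L \<mu> ori t N \<Phi>"
  shows "ne_state L N \<Phi>" "finite_energy L \<mu> ori \<Phi>" "Re (ip (nmodes L) \<Phi> \<Phi>) = 1"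
    "\<And>\<psi>. ne_state L N \<psi> \<Longrightarrow> finite_energy L \<mu> ori \<psi> \<Longrightarrow>
      Re (hform L \<mu> ori \<Phi> \<Phi>) * Re (ip (nmodes L) \<psi> \<psi>) \<le> Re (hform L \<mu> ori \<psi> \<psi>)"
proof -
  have norm: "normalized L \<psi> \<longleftrightarrow> Re (ip (nmodes L) \<psi> \<psi>) = 1" for \<psi>
    unfolding normalized_def ip_self by simp
  show ne: "ne_state L N \<Phi>" using gs unfolding ground_state_def by blast
  show "Re (ip (nmodes L) \<Phi> \<Phi>) = 1" using gs norm unfolding ground_state_def by blast
  obtain E where E: "lim_energy L \<mu> ori t \<Phi> E"
    and min: "\<And>\<Psi> E'. ne_state L N \<Psi> \<Longrightarrow> normalized L \<Psi> \<Longrightarrow> lim_energy L \<mu> ori t \<Psi> E' \<Longrightarrow> E \<le> E'"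
    using gs unfolding ground_state_def by blast
  show "finite_energy L \<mu> ori \<Phi>" using E lim_energy_iff[OF ne] by blast
  have Eeq: "E = t * Re (hform L \<mu> ori \<Phi> \<Phi>)" using E lim_energy_iff[OF ne] by blast
  fix \<psi> assume \<psi>: "ne_state L N \<psi>" "finite_energy L \<mu> ori \<psi>"
  show "Re (hform L \<mu> ori \<Phi> \<Phi>) * Re (ip (nmodes L) \<psi> \<psi>) \<le> Re (hform L \<mu> ori \<psi> \<psi>)"
  proof (cases "\<psi> = (\<lambda>T. 0)")
    case True
    then show ?thesis by (simp add: hform.zero_left)
  next
    case False
    let ?r = "Re (ip (nmodes L) \<psi> \<psi>)"
    have r: "?r > 0" by (rule ne_state_ip_pos[OF \<psi>(1) False])
    define c where "c = 1 / sqrt ?r"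
    have c2: "c * c = 1 / ?r" using r by (simp add: c_def)
    define \<omega> where "\<omega> = (\<lambda>T. complex_of_real c * \<psi> T)"
    have ne': "ne_state L N \<omega>" using \<psi>(1) unfolding ne_state_def \<omega>_def by auto
    have "ip (nmodes L) \<omega> \<omega> = of_real (c * c) * ip (nmodes L) \<psi> \<psi>" unfolding \<omega>_def ip_scale_left ip_scale_right by simp
    then have "normalized L \<omega>" unfolding norm c2 using r by simp
    moreover have "lim_energy L \<mu> ori t \<omega> (t * Re (hform L \<mu> ori \<omega> \<omega>))"
      unfolding lim_energy_iff[OF ne'] using finite_energy_lin(1)[OF \<psi>(2), of "complex_of_real c"] by (simp add: \<omega>_def)
    ultimately have "E \<le> t * Re (hform L \<mu> ori \<omega> \<omega>)" using min[OF ne'] by blast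
    then have "Re (hform L \<mu> ori \<Phi> \<Phi>) \<le> Re (hform L \<mu> ori \<omega> \<omega>)" unfolding Eeq using t by simp
    also have "hform L \<mu> ori \<omega> \<omega> = of_real (c * c) * hform L \<mu> ori \<psi> \<psi>" unfolding \<omega>_def hform.scale_left hform.scale_right by simp
    finally show ?thesis unfolding c2 using r by (simp add: field_simps)
  qed
qed

text \<open>Degenerate ground states of different spins may be superposed, so the claim is made for
  the spin components of \<open>\<Phi>\<close>.\<close>

theorem theorem6:
  fixes L Ne :: nat and \<nu> \<mu> t :: real and ori :: "nat \<Rightarrow> bool" and \<Phi> :: fstate
  assumes "L \<ge> 3" and "0 < \<nu>" and "\<nu> < 1" and "\<mu> > 0" and "t > 0"
    and "real Ne \<le> real (L^2)"
    and "real Ne \<ge> real (L^2) - (1 - \<nu>) powr (1/4) / 5 * real (L^2) powr (3/4)"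
    and "ground_state L \<mu> ori t Ne \<Phi>"
  shows "\<exists>(n::nat) (\<psi>::nat \<Rightarrow> fstate) (S::nat \<Rightarrow> real).
           \<Phi> = (\<lambda>T. \<Sum>i<n. \<psi> i T) \<and>
           (\<forall>i<n. S i \<ge> 0 \<and> S i > \<nu> * (real Ne / 2) \<and>
                  stot2 L (\<psi> i) = (\<lambda>T. complex_of_real (S i * (S i + 1)) * \<psi> i T))"
proof -
  note L = assms(1) and \<nu> = assms(2,3)
  have L0: "L > 0" and \<mu>: "\<mu> \<noteq> 0" using L assms(4) by auto
  note gs = ground_state_minimal[OF assms(5,8)]
  obtain J :: "(nat \<times> real) set" and \<phi> S where J12: "finite J" "\<Phi> = (\<lambda>T. \<Sum>j\<in>J. \<phi> j T)"
    and J3: "\<forall>j\<in>J. ne_state L Ne (\<phi> j) \<and> finite_energy L \<mu> ori (\<phi> j) \<and> S j \<ge> 0 \<and>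
       stot2 L (\<phi> j) = (\<lambda>T. complex_of_real (S j * (S j + 1)) * \<phi> j T) \<and>
       (\<forall>T D. \<phi> j T \<noteq> 0 \<longrightarrow> component L (occupied T) D \<longrightarrow> real (card D) \<le> real Ne / 2 + S j)"
    using spin_components[OF L0 \<mu> gs(1,2)] by (elim exE conjE) (rule that)
  have J47: "ne_state L Ne (\<phi> j)" "finite_energy L \<mu> ori (\<phi> j)" "S j \<ge> 0"
    "stot2 L (\<phi> j) = (\<lambda>T. complex_of_real (S j * (S j + 1)) * \<phi> j T)"
    "\<And>T D. \<phi> j T \<noteq> 0 \<Longrightarrow> component L (occupied T) D \<Longrightarrow> real (card D) \<le> real Ne / 2 + S j" if "j \<in> J" for j
    using J3[rule_format, OF that] by simp_all
  note J = J12 J47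
  define Hi where "Hi = {j\<in>J. S j > \<nu> * (real Ne / 2)}"
  define Lo where "Lo = {j\<in>J. S j \<le> \<nu> * (real Ne / 2)}"
  have fin: "finite Hi" "finite Lo" using J(1) by (simp_all add: Hi_def Lo_def)
  have part: "J = Hi \<union> Lo" "Hi \<inter> Lo = {}" by (auto simp: Hi_def Lo_def)
  define hi where "hi = (\<lambda>T. \<Sum>j\<in>Hi. \<phi> j T)"
  define lo where "lo = (\<lambda>T. \<Sum>j\<in>Lo. \<phi> j T)"
  have \<Phi>: "\<Phi> = (\<lambda>T. hi T + lo T)"
    unfolding J(2) hi_def lo_def part(1) using fin part(2) by (simp add: sum.union_disjoint)
  have ne: "ne_state L Ne hi" "ne_state L Ne lo"
    unfolding hi_def lo_def by (intro ne_state_sum J(3); simp add: Hi_def Lo_def)+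
  have fe: "finite_energy L \<mu> ori hi" "finite_energy L \<mu> ori lo"
    unfolding hi_def lo_def using fin by (intro finite_energy_sum J(4); simp add: Hi_def Lo_def)+
  \<comment> \<open>On nonnegative numbers \<open>S * (S + 1)\<close> is strictly increasing, so
    high and low components belong to different eigenvalues of \<open>stot2\<close> and are
    orthogonal for every invariant form.\<close>
  have neq: "S i * (S i + 1) \<noteq> S j * (S j + 1)" if "i \<in> Hi" "j \<in> Lo" for i j
  proof -
    have "S j < S i" "0 \<le> S j" using that J(5) by (auto simp: Hi_def Lo_def)
    then have "S j * (S j + 1) < S i * (S i + 1)" by (intro mult_strict_mono) auto
    then show ?thesis by simp
  qed
  have orth: "B hi lo = 0 \<and> B lo hi = 0" if "spin_form L B" for B
  proof -
    interpret spin_form L B by fact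
    have "B (\<phi> i) (\<phi> j) = 0 \<and> B (\<phi> j) (\<phi> i) = 0" if "i \<in> Hi" "j \<in> Lo" for i j
      using stot2_orthogonal[OF J(6)[of i] J(6)[of j] neq[OF that]] stot2_orthogonal[OF J(6)[of j] J(6)[of i] neq[OF that, symmetric]] that part(1) by blast
    then show ?thesis unfolding hi_def lo_def by (simp add: sum_left sum_right fin)
  qed
  have split: "B \<Phi> \<Phi> = B hi hi + B lo lo" if "spin_form L B" for B
  proof -
    interpret spin_form L B by fact
    show ?thesis unfolding \<Phi> add_left add_right using orth[OF that] by simp
  qed
  let ?ip = "\<lambda>\<psi>. Re (ip (nmodes L) \<psi> \<psi>)" and ?h = "\<lambda>\<psi>. Re (hform L \<mu> ori \<psi> \<psi>)"
  have one: "?ip hi + ?ip lo = 1" using gs(3) split[OF ip_form.spin_form_axioms] by simp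
  have E: "?h \<Phi> = ?h hi + ?h lo" using split[OF hform.spin_form_axioms] by simp
  have lo0: "lo = (\<lambda>T. 0)"
  proof (rule ccontr)
    assume nz: "lo \<noteq> (\<lambda>T. 0)"
    have lopos: "?ip lo > 0" by (rule ne_state_ip_pos[OF ne(2) nz])
    define w0 where "w0 = 12 / 5 * pi\<^sup>2 * (real (L\<^sup>2 - Ne))\<^sup>2 / (real L)\<^sup>2"
    have supp: "w0 < 2 * real (hole_bonds L (occupied T)) \<and> L\<^sup>2 - Ne \<ge> 3" if T: "T \<subseteq> {..<2 * L\<^sup>2}" "lo T \<noteq> 0" for T
    proof -
      obtain j where j: "j \<in> Lo" "\<phi> j T \<noteq> 0" using T(2) unfolding lo_def by (meson sum.neutral)
      have p: "occupied T \<subseteq> {..<L\<^sup>2}" using T(1) unfolding occupied_def by auto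
      have "\<not> (mode z True \<in> T \<and> mode z False \<in> T)" for z
      proof (cases "z < L\<^sup>2")
        case True then show ?thesis using finite_energy_no_double[OF fe(2) site_less(1)[OF True]] T(2) by blast
      next
        case False then show ?thesis using p by (auto simp: occupied_iff)
      qed
      then have "card (occupied T) = card T" using card_config[of "occupied T"] config_occupied[of T] by metis
      also have "card T = Ne" using ne(2) T(2) unfolding ne_state_def by blast
      finally have c: "card (occupied T) = Ne" .
      have comp: "real (card D) \<le> (1 + \<nu>) / 2 * real (card (occupied T))" if "component L (occupied T) D" for D
      proof -
        have "real (card D) \<le> real Ne / 2 + S j" using J(7)[OF _ j(2) that] j(1) by (simp add: Lo_def)
        moreover have "S j \<le> \<nu> * (real Ne / 2)" using j(1) by (simp add: Lo_def)
        ultimately show ?thesis unfolding c by (simp add: field_simps)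
      qed
      show ?thesis
        using hole_bonds_large[OF L \<nu> p _ comp] assms(7) unfolding c w0_def by simp
    qed
    \<comment> \<open>A nonzero finite-energy state has a nonzero amplitude with all electrons on
      the triangular lattice, since its norm is a multiple of the norm of that restriction.\<close>
    have "\<exists>T\<subseteq>{..<2 * L\<^sup>2}. lo T \<noteq> 0"
    proof (rule ccontr)
      assume "\<not> ?thesis"
      then have "ip (2 * L\<^sup>2) lo lo = 0" unfolding ip_def by (intro sum.neutral) auto
      then have "ip (nmodes L) lo lo = 0" using finite_energy_ip[OF L0 fe(2) fe(2) ne(2) ne(2)] by simp
      then show False using lopos by simp
    qed
    \<comment> \<open>The trial state is available only for at least three holes; the low-spin
      configuration itself supplies them.\<close>
    then have h3: "3 \<le> L\<^sup>2 - Ne" using supp by blast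
    have NL: "Ne \<le> L\<^sup>2" using assms(6) by (simp only: of_nat_le_iff)
    \<comment> \<open>The strict bound from \<open>supp\<close> depends on the configuration. As
      twice a number of bonds is an integer, rounding \<open>w0\<close> up gives one bound for all
      configurations that is still strictly above the trial energy.\<close>
    define w where "w = real_of_int (\<lfloor>w0\<rfloor> + 1)"
    have w: "w0 < w" unfolding w_def by linarith
    have w2: "w \<le> 2 * real (hole_bonds L (occupied T))" if "T \<subseteq> {..<2 * L\<^sup>2}" "lo T \<noteq> 0" for T
    proof -
      have "w0 < real_of_int (int (2 * hole_bonds L (occupied T)))" using supp[OF that] by simp
      then have "\<lfloor>w0\<rfloor> < int (2 * hole_bonds L (occupied T))" by (simp only: floor_less_iff)
      then have "\<lfloor>w0\<rfloor> + 1 \<le> int (2 * hole_bonds L (occupied T))" by simp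
      then have "w \<le> real_of_int (int (2 * hole_bonds L (occupied T)))" unfolding w_def by (simp only: of_int_le_iff)
      then show ?thesis by simp
    qed
    have "Ne \<noteq> 0"
    proof
      assume "Ne = 0"
      then have "real (L\<^sup>2) \<le> (1 - \<nu>) powr (1/4) / 5 * real (L\<^sup>2) powr (3/4)" using assms(7) by simp
      also have "\<dots> \<le> 1 / 5 * real (L\<^sup>2) powr 1"
        using \<nu> L by (intro mult_mono divide_right_mono powr_mono powr_le1) auto
      finally show False using L by simp
    qed
    then obtain N' where N': "Ne = Suc N'" by (cases Ne) auto
    have low: "(w - 6 * real (L\<^sup>2 - Ne)) * ?ip lo \<le> ?h lo"
      using hform_lower_bound[OF L fe(2) ne(2)[unfolded N'] w2] unfolding N' by blast
    obtain \<psi> where \<psi>: "ne_state L (L\<^sup>2 - (L\<^sup>2 - Ne)) \<psi>" "finite_energy L \<mu> ori \<psi>" "ip (nmodes L) \<psi> \<psi> = 1"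
      "?h \<psi> \<le> w0 - 6 * real (L\<^sup>2 - Ne)"
      using ferromagnetic_trial_state[OF L h3, of \<mu> ori] unfolding w0_def by auto
    have "?h \<Phi> \<le> ?h \<psi>" using gs(4)[of \<psi>] \<psi> NL by simp
    then have up: "?h \<Phi> < w - 6 * real (L\<^sup>2 - Ne)" using \<psi>(4) w by simp
    \<comment> \<open>The high-spin part costs at least the minimal energy per unit of norm and the
      low-spin part strictly more, so a nonzero low-spin part contradicts minimality.\<close>
    have "?h \<Phi> * ?ip hi \<le> ?h hi" by (rule gs(4)[OF ne(1) fe(1)])
    then have "?h \<Phi> * (?ip hi + ?ip lo) \<ge> ?h \<Phi> * ?ip hi + (w - 6 * real (L\<^sup>2 - Ne)) * ?ip lo"
      using low E one by simp
    then have "(w - 6 * real (L\<^sup>2 - Ne)) * ?ip lo \<le> ?h \<Phi> * ?ip lo" by (simp add: distrib_left)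
    then show False using up lopos by (simp only: mult_le_cancel_right_pos)
  qed
  obtain f n where f: "bij_betw f {..<n::nat} Hi" using fin(1) ex_bij_betw_nat_finite by (metis lessThan_atLeast0)
  have fHi: "f i \<in> Hi" if "i < n" for i using f that by (auto simp: bij_betw_def)
  show ?thesis
  proof (intro exI conjI allI impI)
    show "\<Phi> = (\<lambda>T. \<Sum>i<n. \<phi> (f i) T)"
      unfolding \<Phi> lo0 hi_def using sum.reindex_bij_betw[OF f, of "\<lambda>j. \<phi> j _"] by (simp add: fun_eq_iff)
    fix i assume "i < n"
    then have "f i \<in> Hi" by (rule fHi)
    then have "f i \<in> J" "S (f i) > \<nu> * (real Ne / 2)" by (auto simp: Hi_def)
    then show "S (f i) \<ge> 0" "S (f i) > \<nu> * (real Ne / 2)"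
      "stot2 L (\<phi> (f i)) = (\<lambda>T. complex_of_real (S (f i) * (S (f i) + 1)) * \<phi> (f i) T)"
      using J(5,6) by blast+
  qed
qed

end
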